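(* Let $f\colon I\to I$ be a piecewise $C^{1+BV}$ expanding map on the interval $I=[a,b]$. There is an integer $p\ge1$ such that for every function $\phi\in L^\infty(I)$ satisfying $$\int\phi\,\Phi_1(\gamma)\,dm=0\quad\text{for every }\gamma\in BV,$$ the function $$\psi(x)=\int 1_{[a,x]}\cdot\Big(\sum_{k=0}^\infty\sum_{j=0}^{p-1}\phi\circ f^{kp+j}\Big)\,dm,\qquad x\in I,$$ is Log-Lipschitz continuous.
   Context: $m$ is Lebesgue measure on $I=[a,b]$; $BV$ is the space of complex-valued functions of bounded variation on $I$. Piecewise $C^{1+BV}$ expanding map: there are points $a=c_0<c_1<\dots<c_n=b$ such that on each $(c_i,c_{i+1})$ the map $f$ is monotone and extends to an absolutely continuous map $f_i\colon[c_i,c_{i+1}]\to I$ whose derivative $Df_i$ has bounded variation, and there is $\theta>1$ with $|Df_i|\ge\theta$ on $[c_i,c_{i+1}]$ for all $i$. Such an $f$ has a finite number of ergodic absolutely continuous invariant probabilities $\mu_\ell=\rho_\ell m$, with $\rho_\ell\in BV$. Their basins $A_\ell=\{x\in I:\lim_{N}\frac1N\sum_{k<N}\theta(f^k(x))=\int\theta\,d\mu_\ell\ \text{for all }\theta\in C^0(I)\}$ are pairwise disjoint and cover $m$-almost every point of $I$. Define $\Phi_1\colon L^1(m)\to BV$ by $\Phi_1(\gamma)=\sum_\ell\big(\int_{A_\ell}\gamma\,dm\big)\rho_\ell$. The integral of an infinite Birkhoff sum is defined as the (convergent) series of integrals: $\psi(x)=\sum_{k=0}^\infty\int 1_{[a,x]}\sum_{j=0}^{p-1}\phi\circ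 f^{kp+j}\,dm$. Log-Lipschitz continuous means that there is $K>0$ with $|\psi(x)-\psi(y)|\le K|x-y|\,(1+|\ln|x-y||)$ for all $x\ne y$ in $I$. *)

theory Defs
  imports "HOL-Probability.Probability_Measure"
begin

definition has_bounded_variation_on_interval ::
    "real \<Rightarrow> real \<Rightarrow> (real \<Rightarrow> 'a::real_normed_vector) \<Rightarrow> bool" where
  "has_bounded_variation_on_interval a b g \<longleftrightarrow>
     (\<exists>V. \<forall>n (t::nat \<Rightarrow> real).
        (\<forall>i\<le>n. t i \<in> {a..b}) \<and> (\<forall>i<n. t i \<le> t (Suc i)) \<longrightarrow>
        (\<Sum>i<n. norm (g (t (Suc i)) - g (t i))) \<le> V)"

definition BV :: "real \<Rightarrow> real \<Rightarrow> (real \<Rightarrow> complex) set" where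
  "BV a b = {g. has_bounded_variation_on_interval a b g}"

definition absolutely_continuous_on_interval ::
    "real \<Rightarrow> real \<Rightarrow> (real \<Rightarrow> real) \<Rightarrow> bool" where
  "absolutely_continuous_on_interval a b g \<longleftrightarrow>
     (\<forall>\<epsilon>>0. \<exists>\<delta>>0. \<forall>n (u::nat \<Rightarrow> real) v.
        (\<forall>i<n. a \<le> u i \<and> u i \<le> v i \<and> v i \<le> b) \<and>
        disjoint_family_on (\<lambda>i. {u i<..<v i}) {..<n} \<and>
        (\<Sum>i<n. v i - u i) < \<delta> \<longrightarrow>
        (\<Sum>i<n. \<bar>g (v i) - g (u i)\<bar>) < \<epsilon>)"

text \<open>
  An absolutely continuous branch \<open>F i\<close> is differentiable only almost everywhere; \<open>D i\<close> is a
  representative of its derivative that has bounded variation and satisfies the expansion bound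
  at every point of the closed interval. The values of \<open>f\<close> at the points \<open>c i\<close> are arbitrary.
\<close>
definition piecewise_C1BV_expanding :: "real \<Rightarrow> real \<Rightarrow> (real \<Rightarrow> real) \<Rightarrow> bool" where
  "piecewise_C1BV_expanding a b f \<longleftrightarrow>
     f ` {a..b} \<subseteq> {a..b} \<and>
     (\<exists>(n::nat) (c::nat \<Rightarrow> real) (F::nat \<Rightarrow> real \<Rightarrow> real) (D::nat \<Rightarrow> real \<Rightarrow> real) (\<theta>::real).
        n \<ge> 1 \<and> c 0 = a \<and> c n = b \<and> \<theta> > 1 \<and>
        (\<forall>i<n.
           c i < c (Suc i) \<and>
           (mono_on {c i<..<c (Suc i)} f \<or> antimono_on {c i<..<c (Suc i)} f) \<and>
           (\<forall>x\<in>{c i<..<c (Suc i)}. F i x = f x) \<and>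
           F i ` {c i..c (Suc i)} \<subseteq> {a..b} \<and>
           absolutely_continuous_on_interval (c i) (c (Suc i)) (F i) \<and>
           (AE x in lebesgue_on {c i..c (Suc i)}.
              (F i has_real_derivative D i x) (at x within {c i..c (Suc i)})) \<and>
           has_bounded_variation_on_interval (c i) (c (Suc i)) (D i) \<and>
           (\<forall>x\<in>{c i..c (Suc i)}. \<bar>D i x\<bar> \<ge> \<theta>)))"

text \<open>The ergodic absolutely continuous invariant probabilities of \<open>f\<close>.\<close>
definition ergodic_acips :: "real \<Rightarrow> real \<Rightarrow> (real \<Rightarrow> real) \<Rightarrow> real measure set" where
  "ergodic_acips a b f =
     {\<mu>. sets \<mu> = sets (lebesgue_on {a..b}) \<and> prob_space \<mu> \<and>
         absolutely_continuous (lebesgue_on {a..b}) \<mu> \<and>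
         f \<in> \<mu> \<rightarrow>\<^sub>M \<mu> \<and> distr \<mu> \<mu> f = \<mu> \<and>
         (\<forall>A\<in>sets \<mu>. f -` A \<inter> space \<mu> = A \<longrightarrow> emeasure \<mu> A = 0 \<or> emeasure \<mu> A = 1)}"

definition basin :: "real \<Rightarrow> real \<Rightarrow> (real \<Rightarrow> real) \<Rightarrow> real measure \<Rightarrow> real set" where
  "basin a b f \<mu> =
     {x \<in> {a..b}. \<forall>\<theta> :: real \<Rightarrow> complex. continuous_on {a..b} \<theta> \<longrightarrow>
        (\<lambda>N. (\<Sum>k<N. \<theta> ((f ^^ k) x)) / of_nat N) \<longlonglongrightarrow> (LINT y|\<mu>. \<theta> y)}"

text \<open>
  The density of \<open>\<mu>\<close> is taken to be the Radon--Nikodym derivative, so \<open>Phi1 a b f \<gamma>\<close> is determined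
  up to modification on a null set, which does not affect integrals against it. The index set is finite
  for piecewise expanding \<open>f\<close>, so the sum is a genuine one.
\<close>
definition Phi1 ::
    "real \<Rightarrow> real \<Rightarrow> (real \<Rightarrow> real) \<Rightarrow> (real \<Rightarrow> complex) \<Rightarrow> real \<Rightarrow> complex" where
  "Phi1 a b f \<gamma> x =
     (\<Sum>\<mu>\<in>ergodic_acips a b f.
        (LINT y:basin a b f \<mu>|lebesgue_on {a..b}. \<gamma> y) *
        of_real (enn2real (RN_deriv (lebesgue_on {a..b}) \<mu> x)))"

definition Linfty :: "real \<Rightarrow> real \<Rightarrow> (real \<Rightarrow> complex) set" where
  "Linfty a b =
     {\<phi>. \<phi> \<in> borel_measurable (lebesgue_on {a..b}) \<and>
         (\<exists>C. AE x in lebesgue_on {a..b}. norm (\<phi> x) \<le> C)}"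

definition psi_term ::
    "real \<Rightarrow> real \<Rightarrow> (real \<Rightarrow> real) \<Rightarrow> nat \<Rightarrow> (real \<Rightarrow> complex) \<Rightarrow> real \<Rightarrow> nat \<Rightarrow> complex" where
  "psi_term a b f p \<phi> x k =
     (LINT y|lebesgue_on {a..b}.
        indicator {a..x} y * (\<Sum>j<p. \<phi> ((f ^^ (k * p + j)) y)))"

definition psi ::
    "real \<Rightarrow> real \<Rightarrow> (real \<Rightarrow> real) \<Rightarrow> nat \<Rightarrow> (real \<Rightarrow> complex) \<Rightarrow> real \<Rightarrow> complex" where
  "psi a b f p \<phi> x = (\<Sum>k. psi_term a b f p \<phi> x k)"

definition log_Lipschitz_on :: "real set \<Rightarrow> (real \<Rightarrow> complex) \<Rightarrow> bool" where
  "log_Lipschitz_on S g \<longleftrightarrow>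
     (\<exists>K>0. \<forall>x\<in>S. \<forall>y\<in>S. x \<noteq> y \<longrightarrow>
        norm (g x - g y) \<le> K * \<bar>x - y\<bar> * (1 + \<bar>ln \<bar>x - y\<bar>\<bar>))"

end

theory Submission
  imports Defs "HOL-Complex_Analysis.Great_Picard"
begin

text \<open>Let \<open>U g = g \<circ> f\<close> and measure bounded functions by \<open>pn g = sup\<^sub>x \<bar>\<integral>\<^bsub>[a,x]\<^esub> g dm\<bar>\<close>, the norm dual to that of
  \<open>BV\<close>. Expansion and bounded variation of the derivative split \<open>U\<^sup>n g = h1 + h2\<close> with \<open>pn h1 \<le> e\<^sub>n pn g\<close>,
  \<open>e\<^sub>n \<longlonglongrightarrow> 0\<close> and \<open>\<bar>h2\<bar> \<le> C pn g\<close>, while sets of bounded functions are totally bounded for \<open>pn\<close>.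
  Hence orbits under \<open>U\<close> accumulate at recurrent functions, and the level sets of a recurrent function are
  recurrent sets. Distinct translates of such a set are uniformly separated, so all of them are periodic
  modulo null sets with a common period \<open>p\<close>.
  For \<open>A = \<Sum>\<^sub>j\<^sub><\<^sub>p U\<^sup>j\<close> the accumulation points of \<open>U\<^sup>n (A \<phi>)\<close> are therefore invariant, and they vanish if \<open>\<phi>\<close> has
  integral zero for every ergodic absolutely continuous invariant probability; the hypothesis on \<open>\<Phi>\<^sub>1\<close>,
  tested on indicators of \<open>[a,t]\<close>, says precisely this. By compactness and the splitting the decay
  \<open>pn (U\<^sup>k\<^sup>p A \<phi>) \<longlonglongrightarrow> 0\<close> is exponential. As each term of the series for \<open>\<psi>\<close> is also Lipschitz with the same
  constant, the sum is Log-Lipschitz.\<close>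

section \<open>Absolute continuity and bounded variation\<close>

text \<open>The obstacle is that the iterates of \<open>U\<close> need not converge: when
  \<open>f\<close> permutes subintervals cyclically, expansion does not damp the rotation. Summing
  over \<open>p\<close> iterates, with \<open>p\<close> a common multiple of all cycle lengths,
  removes it. Recurrent functions play the part of eigenfunctions of modulus one: for them
  \<open>h1\<close> disappears in the limit, so that |g| \<le> \<open>C * pn g\<close> almost
  everywhere. The difference of two indicators takes only the values -1, 0, 1, hence two translates
  of a recurrent set either coincide or are at distance at least \<open>1 / C\<close>. "Almost
  everywhere" refers to an invariant measure \<open>N\<close>, which may miss part of the interval;
  but \<open>N\<close> gives every strictly invariant set its Lebesgue measure, so a function that
  vanishes \<open>N\<close>-almost everywhere still decays along orbits. Basins enter because
  \<open>Phi1\<close> weighs each density with an integral over a basin: to read off the integral of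
  \<phi> against \<mu>, basins must be measurable, disjoint and of full measure for their own \<mu>,
  and this rests on Birkhoff's theorem.\<close>

lemma absolutely_continuous_on_interval_finite:
  assumes ac: "absolutely_continuous_on_interval c d F" and e: "e > 0"
  obtains \<delta> where "\<delta> > 0"
    "\<And>(P :: 'i set) u v. \<lbrakk>finite P; \<And>i. i \<in> P \<Longrightarrow> c \<le> u i \<and> u i \<le> v i \<and> v i \<le> d;
        disjoint_family_on (\<lambda>i. {u i<..<v i}) P; (\<Sum>i\<in>P. v i - u i) < \<delta>\<rbrakk>
       \<Longrightarrow> (\<Sum>i\<in>P. \<bar>F (v i) - F (u i)\<bar>) < e"
proof -
  obtain \<delta> where d: "\<delta> > 0" and *: "\<And>(n::nat) (u::nat \<Rightarrow> real) v.
       (\<forall>i<n. c \<le> u i \<and> u i \<le> v i \<and> v i \<le> d) \<and>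
        disjoint_family_on (\<lambda>i. {u i<..<v i}) {..<n} \<and>
        (\<Sum>i<n. v i - u i) < \<delta> \<Longrightarrow>
        (\<Sum>i<n. \<bar>F (v i) - F (u i)\<bar>) < e"
    using ac e unfolding absolutely_continuous_on_interval_def by meson
  show ?thesis
  proof (rule that[OF d])
    fix P :: "'i set" and u v :: "'i \<Rightarrow> real"
    assume P: "finite P" and uv: "\<And>i. i \<in> P \<Longrightarrow> c \<le> u i \<and> u i \<le> v i \<and> v i \<le> d"
      and dis: "disjoint_family_on (\<lambda>i. {u i<..<v i}) P" and s: "(\<Sum>i\<in>P. v i - u i) < \<delta>"
    obtain h where h: "bij_betw h {..<card P} P"
      using ex_bij_betw_nat_finite[OF P] by (auto simp: lessThan_atLeast0)
    have hP: "h i \<in> P" if "i < card P" for i using h that by (auto simp: bij_betw_def)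
    have "(\<Sum>i<card P. \<bar>F (v (h i)) - F (u (h i))\<bar>) < e"
    proof (rule *, intro conjI)
      show "disjoint_family_on (\<lambda>i. {u (h i)<..<v (h i)}) {..<card P}"
        using dis h hP unfolding disjoint_family_on_def bij_betw_def inj_on_def
        by (metis lessThan_iff)
      show "(\<Sum>i<card P. v (h i) - u (h i)) < \<delta>"
        using s sum.reindex_bij_betw[OF h, of "\<lambda>i. v i - u i"] by simp
    qed (use uv hP in auto)
    then show "(\<Sum>i\<in>P. \<bar>F (v i) - F (u i)\<bar>) < e"
      using sum.reindex_bij_betw[OF h, of "\<lambda>i. \<bar>F (v i) - F (u i)\<bar>"] by simp
  qed
qed

text \<open>The gauge sends tags in the exceptional set into an open set of measure below the
  \<delta> of absolute continuity, where the increments of \<open>F\<close> are small in total;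
  every other tag is handled by differentiability at that tag.\<close>

theorem absolutely_continuous_has_integral_deriv:
  assumes ac: "absolutely_continuous_on_interval c d F" and cd: "c \<le> d"
    and E: "negligible E"
    and deriv: "\<And>x. x \<in> {c..d} - E \<Longrightarrow> (F has_real_derivative D x) (at x within {c..d})"
  shows "(D has_integral (F d - F c)) {c..d}"
proof -
  \<comment> \<open>With the value 0 on \<open>E\<close> the Riemann terms at tags in
    \<open>E\<close> vanish, so that only the increments of \<open>F\<close> remain to be estimated
    there.\<close>
  define D' where "D' x = (if x \<in> E then 0 else D x)" for x
  have "(D' has_integral (F d - F c)) {c..d}"
  proof (cases "c = d")
    case False
    with cd have cd': "c < d" by simp
    show ?thesis
      unfolding has_integral_factor_content box_real[symmetric]
    proof safe
      fix e :: real assume e: "e > 0"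
      \<comment> \<open>The admissible error is \<open>e * (d - c)\<close>: one half for the tags in
        \<open>E\<close>, the other half for the remaining tags.\<close>
      define e' where "e' = e * (d - c) / 2"
      have e': "e' > 0" using e cd' by (simp add: e'_def)
      obtain \<delta> where \<delta>: "\<delta> > 0" and ACd: "\<And>(P :: (real \<times> real set) set) u v. \<lbrakk>finite P;
          \<And>i. i \<in> P \<Longrightarrow> c \<le> u i \<and> u i \<le> v i \<and> v i \<le> d;
          disjoint_family_on (\<lambda>i. {u i<..<v i}) P; (\<Sum>i\<in>P. v i - u i) < \<delta>\<rbrakk>
         \<Longrightarrow> (\<Sum>i\<in>P. \<bar>F (v i) - F (u i)\<bar>) < e'"
        using absolutely_continuous_on_interval_finite[OF ac e', where 'i = "real \<times> real set"] by blast
      have El: "E \<in> sets lebesgue" "emeasure lebesgue E = 0"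
        using E by (auto simp: negligible_iff_null_sets)
      obtain U where U: "open U" "E \<subseteq> U" "U - E \<in> lmeasurable" "emeasure lebesgue (U - E) < ennreal \<delta>"
        using sets_lebesgue_outer_open[OF El(1) \<delta>] by blast
      have Ul: "U \<in> sets lebesgue" using U(1) by (simp add: borel_open)
      have "emeasure lebesgue U = emeasure lebesgue (U - E)"
        using E Ul by (subst emeasure_Diff_null_set) (auto simp: negligible_iff_null_sets)
      with U(4) have Um: "emeasure lebesgue U < ennreal \<delta>" by simp
      then have Ulm: "U \<in> lmeasurable" by (intro fmeasurableI[OF Ul] order.strict_trans[OF Um]) simp
      have Um': "measure lebesgue U < \<delta>"
        using Um Ulm \<delta> by (metis emeasure_eq_measure2 ennreal_less_iff measure_nonneg)
      have "\<forall>x. \<exists>r>0. x \<in> {c..d} - E \<longrightarrow>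
           (\<forall>y\<in>{c..d}. norm (y-x) < r \<longrightarrow> norm (F y - F x - (y-x) *\<^sub>R D x) \<le> e/2 * norm (y-x))"
        using deriv e
        unfolding has_real_derivative_iff_has_vector_derivative has_vector_derivative_def has_derivative_within_alt
        by (metis half_gt_zero zero_less_one)
      then obtain r where r: "\<And>x. 0 < r x"
        "\<And>x y. \<lbrakk>x \<in> {c..d} - E; y \<in> {c..d}; norm (y-x) < r x\<rbrakk>
                        \<Longrightarrow> norm (F y - F x - (y-x) *\<^sub>R D x) \<le> e/2 * norm (y-x)"
        by metis
      define \<gamma> where "\<gamma> x = (if x \<in> E then U else ball x (r x))" for x
      show "\<exists>\<gamma>. gauge \<gamma> \<and> (\<forall>p. p tagged_division_of (cbox c d) \<and> \<gamma> fine p \<longrightarrow>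
         norm ((\<Sum>(x, k)\<in>p. measure lborel k *\<^sub>R D' x) - (F d - F c)) \<le> e * measure lborel (cbox c d))"
      proof (rule exI[of _ \<gamma>], safe)
        show "gauge \<gamma>"
          using U(1,2) r(1) by (auto simp: gauge_def \<gamma>_def)
      next
        fix p assume p: "p tagged_division_of cbox c d" and fine: "\<gamma> fine p"
        have finp: "finite p" using p by (rule tagged_division_of_finite)
        have Fdc: "F d - F c = (\<Sum>(x,K)\<in>p. F (Sup K) - F (Inf K))"
          and dc: "d - c = (\<Sum>(x,K)\<in>p. Sup K - Inf K)"
          using additive_tagged_division_1[where f= "\<lambda>x. x"] additive_tagged_division_1[where f= F]
            cd p by auto
        have K: "\<exists>u v. K = {u..v} \<and> u \<le> v \<and> c \<le> u \<and> v \<le> d \<and> x \<in> {u..v} \<and> Inf K = u \<and> Sup K = v \<and> measure lborel K = v - u"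
          if xKp: "(x,K) \<in> p" for x K
        proof -
          have xK: "x \<in> K" "K \<subseteq> cbox c d" using tagged_division_ofD(2,3)[OF p that] by auto
          obtain u v where uv: "K = {u..v}" using tagged_division_ofD(4)[OF p xKp] by (auto simp: cbox_interval)
          have "u \<le> v" using xK uv by auto
          then show ?thesis using xK unfolding uv by (intro exI[of _ u] exI[of _ v]) auto
        qed
        have K': "{Inf K<..<Sup K} \<subseteq> K" if xKp: "(x,K) \<in> p" for x K
        proof -
          obtain u v where "K = {u..v}" "Inf K = u" "Sup K = v" using K[OF xKp] by metis
          then show ?thesis by (simp add: greaterThanLessThan_subseteq_atLeastAtMost_iff)
        qed
        have K'': "c \<le> Inf K \<and> Inf K \<le> Sup K \<and> Sup K \<le> d" if xKp: "(x,K) \<in> p" for x K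
          using K[OF xKp] by metis
        define p1 where "p1 = {(x,K)\<in>p. x \<in> E}"
        define p2 where "p2 = {(x,K)\<in>p. x \<notin> E}"
        have pp: "p = p1 \<union> p2" "p1 \<inter> p2 = {}" "finite p1" "finite p2"
          using finp by (auto simp: p1_def p2_def intro: finite_subset)
        define t where "t = (\<lambda>(x::real,K). measure lborel K *\<^sub>R D' x - (F (Sup K) - F (Inf K)))"
        have "(\<Sum>(x, k)\<in>p. measure lborel k *\<^sub>R D' x) - (F d - F c) = sum t p"
          unfolding Fdc t_def by (simp add: split_def sum_subtractf)
        also have "\<dots> = sum t p1 + sum t p2"
          unfolding pp(1) using pp by (intro sum.union_disjoint) auto
        finally have split: "(\<Sum>(x, k)\<in>p. measure lborel k *\<^sub>R D' x) - (F d - F c) = sum t p1 + sum t p2" .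
        have n1: "\<bar>sum t p1\<bar> \<le> e'"
        proof -
          have "\<bar>sum t p1\<bar> \<le> (\<Sum>i\<in>p1. \<bar>t i\<bar>)" by (rule sum_abs)
          also have "\<dots> = (\<Sum>i\<in>p1. \<bar>F (Sup (snd i)) - F (Inf (snd i))\<bar>)"
            by (intro sum.cong) (auto simp: t_def p1_def D'_def)
          also have "\<dots> < e'"
          proof (rule ACd[OF pp(3)])
            fix i assume "i \<in> p1"
            then show "c \<le> Inf (snd i) \<and> Inf (snd i) \<le> Sup (snd i) \<and> Sup (snd i) \<le> d"
              using K''[of "fst i" "snd i"] by (auto simp: p1_def)
          next
            have int: "interior (snd i) = {Inf (snd i)<..<Sup (snd i)}" if "i \<in> p" for i
              using K[of "fst i" "snd i"] that interior_atLeastAtMost_real by (metis prod.collapse)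
            show dis: "disjoint_family_on (\<lambda>i. {Inf (snd i)<..<Sup (snd i)}) p1"
              unfolding disjoint_family_on_def
            proof (intro ballI impI)
              fix i j assume ij: "i \<in> p1" "j \<in> p1" "i \<noteq> j"
              then have "interior (snd i) \<inter> interior (snd j) = {}"
                using tagged_division_ofD(5)[OF p, of "fst i" "snd i" "fst j" "snd j"] pp(1)
                by (auto simp: prod_eq_iff)
              then show "{Inf (snd i)<..<Sup (snd i)} \<inter> {Inf (snd j)<..<Sup (snd j)} = {}"
                using int ij pp(1) by auto
            qed
            have "(\<Sum>i\<in>p1. Sup (snd i) - Inf (snd i)) = (\<Sum>i\<in>p1. measure lebesgue {Inf (snd i)<..<Sup (snd i)})"
            proof (intro sum.cong refl)
              fix i assume "i \<in> p1"
              then show "Sup (snd i) - Inf (snd i) = measure lebesgue {Inf (snd i)<..<Sup (snd i)}"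
                using K''[of "fst i" "snd i"] by (auto simp: p1_def)
            qed
            also have "\<dots> = measure lebesgue (\<Union>i\<in>p1. {Inf (snd i)<..<Sup (snd i)})"
            proof (rule measure_finite_Union[symmetric, OF pp(3) _ dis])
              fix i assume "i \<in> p1"
              then show "emeasure lebesgue {Inf (snd i)<..<Sup (snd i)} \<noteq> \<infinity>"
                using K''[of "fst i" "snd i"] by (auto simp: p1_def)
            qed auto
            also have "\<dots> \<le> measure lebesgue U"
            proof (rule measure_mono_fmeasurable[OF _ _ Ulm])
              show "(\<Union>i\<in>p1. {Inf (snd i)<..<Sup (snd i)}) \<subseteq> U"
              proof (rule UN_least)
                fix i assume i: "i \<in> p1"
                then have "snd i \<subseteq> \<gamma> (fst i)" "fst i \<in> E" using fineD[OF fine, of "fst i" "snd i"] by (auto simp: p1_def)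
                then have "snd i \<subseteq> U" by (simp add: \<gamma>_def)
                moreover have "{Inf (snd i)<..<Sup (snd i)} \<subseteq> snd i"
                  using K'[of "fst i" "snd i"] i by (simp add: p1_def case_prod_beta)
                ultimately show "{Inf (snd i)<..<Sup (snd i)} \<subseteq> U" by blast
              qed
            qed (use pp(3) in auto)
            finally show "(\<Sum>i\<in>p1. Sup (snd i) - Inf (snd i)) < \<delta>" using Um' by simp
          qed
          finally show ?thesis by simp
        qed
        \<comment> \<open>The tag lies between the endpoints \<open>u\<close> and \<open>v\<close>,
          so the two errors at the tag add up to \<open>e/2\<close> times the length of the
          interval.\<close>
        have tp2: "\<bar>t i\<bar> \<le> e/2 * (Sup (snd i) - Inf (snd i))" if i: "i \<in> p2" for i
        proof -
          obtain x K' where xK: "i = (x,K')" "(x,K') \<in> p" "x \<notin> E" using i by (auto simp: p2_def)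
          obtain u v where uv: "K' = {u..v}" "u \<le> v" "c \<le> u" "v \<le> d" "x \<in> {u..v}" "Inf K' = u" "Sup K' = v" "measure lborel K' = v - u"
            using K[OF xK(2)] by auto
          have "K' \<subseteq> ball x (r x)" using fineD[OF fine xK(2)] xK(3) by (simp add: \<gamma>_def)
          moreover have "u \<in> K'" "v \<in> K'" using uv by auto
          ultimately have b: "u \<in> ball x (r x)" "v \<in> ball x (r x)" by blast+
          have "\<bar>(v - u) * D x - (F v - F u)\<bar> = \<bar>(F u - F x - (u - x) * D x) - (F v - F x - (v - x) * D x)\<bar>"
            by (simp add: algebra_simps)
          also have "\<dots> \<le> \<bar>F u - F x - (u - x) * D x\<bar> + \<bar>F v - F x - (v - x) * D x\<bar>" by (rule abs_triangle_ineq4)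
          also have "\<dots> \<le> e/2 * \<bar>u - x\<bar> + e/2 * \<bar>v - x\<bar>"
            using r(2)[of x u] r(2)[of x v] b uv xK
            by (intro add_mono) (auto simp: dist_real_def abs_minus_commute)
          also have "\<dots> = e/2 * (v - u)" using uv by (simp add: field_simps)
          finally show ?thesis using xK uv by (simp add: t_def D'_def)
        qed
        have n2: "\<bar>sum t p2\<bar> \<le> e/2 * (d - c)"
        proof -
          have "\<bar>sum t p2\<bar> \<le> (\<Sum>i\<in>p2. \<bar>t i\<bar>)" by (rule sum_abs)
          also have "\<dots> \<le> (\<Sum>i\<in>p2. e/2 * (Sup (snd i) - Inf (snd i)))"
            by (rule sum_mono) (rule tp2)
          also have "\<dots> \<le> (\<Sum>i\<in>p. e/2 * (Sup (snd i) - Inf (snd i)))"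
          proof (rule sum_mono2[OF finp])
            fix i assume "i \<in> p - p2"
            then show "0 \<le> e/2 * (Sup (snd i) - Inf (snd i))"
              using K''[of "fst i" "snd i"] e by auto
          qed (use pp in auto)
          also have "\<dots> = e/2 * (d - c)" unfolding dc by (simp add: sum_distrib_left split_def)
          finally show ?thesis .
        qed
        show "norm ((\<Sum>(x, k)\<in>p. measure lborel k *\<^sub>R D' x) - (F d - F c)) \<le> e * measure lborel (cbox c d)"
          unfolding split using n1 n2 cd unfolding e'_def by (simp add: field_simps)
      qed
    qed
  qed (simp add: has_integral_refl)
  moreover have "D x = D' x" if "x \<in> {c..d} - E" for x using that by (simp add: D'_def)
  ultimately show ?thesis using has_integral_spike[OF E, of "{c..d}" D D'] by blast
qed

section \<open>Functions of bounded variation as weights\<close>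

text \<open>\<open>V\<close> is the variation of \<open>g\<close> on [c,x]: a chain in [c,x] is
  prolonged by the two points \<open>x\<close> and \<open>y\<close>, which adds at least |g y - g x|
  to its sum. Later estimates use the variation through this inequality only.\<close>

lemma bounded_variation_majorant:
  fixes g :: "real \<Rightarrow> real"
  assumes "has_bounded_variation_on_interval c d g"
  obtains V where "\<And>x y. \<lbrakk>c \<le> x; x \<le> y; y \<le> d\<rbrakk> \<Longrightarrow> \<bar>g y - g x\<bar> \<le> V y - V x"
proof -
  obtain B where B: "\<And>n (t::nat \<Rightarrow> real). \<lbrakk>\<And>i. i \<le> n \<Longrightarrow> t i \<in> {c..d}; \<And>i. i < n \<Longrightarrow> t i \<le> t (Suc i)\<rbrakk>
      \<Longrightarrow> (\<Sum>i<n. \<bar>g (t (Suc i)) - g (t i)\<bar>) \<le> B"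
    using assms unfolding has_bounded_variation_on_interval_def real_norm_def by meson
  define S where "S x = {(\<Sum>i<n. \<bar>g (t (Suc i)) - g (t i)\<bar>) |n (t::nat \<Rightarrow> real).
     (\<forall>i\<le>n. t i \<in> {c..x}) \<and> (\<forall>i<n. t i \<le> t (Suc i))}" for x
  have bdd: "bdd_above (S x)" if "x \<le> d" for x
  proof (rule bdd_aboveI[of _ B])
    fix s assume "s \<in> S x"
    then show "s \<le> B" using that unfolding S_def by (auto intro!: B)
  qed
  have ne: "S x \<noteq> {}" if "c \<le> x" for x
  proof -
    have "(\<Sum>i<(0::nat). \<bar>g c - g c\<bar>) \<in> S x"
      unfolding S_def using that by (intro CollectI exI[of _ 0] exI[of _ "\<lambda>_. c"]) auto
    then show ?thesis by blast
  qed
  show ?thesis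
  proof (rule that[of "\<lambda>x. Sup (S x)"])
    fix x y assume xy: "c \<le> x" "x \<le> y" "y \<le> d"
    have "s \<le> Sup (S y) - \<bar>g y - g x\<bar>" if sS: "s \<in> S x" for s
    proof -
      obtain n and t :: "nat \<Rightarrow> real" where s: "s = (\<Sum>i<n. \<bar>g (t (Suc i)) - g (t i)\<bar>)"
        and t: "\<And>i. i \<le> n \<Longrightarrow> t i \<in> {c..x}" "\<And>i. i < n \<Longrightarrow> t i \<le> t (Suc i)"
        using sS unfolding S_def by blast
      \<comment> \<open>The step from \<open>t n\<close> to \<open>x\<close> can only increase the
        sum, so it need not be controlled.\<close>
      define t' where "t' i = (if i \<le> n then t i else if i = Suc n then x else y)" for i
      have "(\<Sum>i<Suc (Suc n). \<bar>g (t' (Suc i)) - g (t' i)\<bar>) \<in> S y"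
        unfolding S_def
      proof (intro CollectI exI[of _ "Suc (Suc n)"] exI[of _ t'] conjI allI impI refl)
        fix i assume "i \<le> Suc (Suc n)"
        then show "t' i \<in> {c..y}" using t(1)[of i] xy by (auto simp: t'_def)
      next
        fix i assume "i < Suc (Suc n)"
        then consider "i < n" | "i = n" | "i = Suc n" by linarith
        then show "t' i \<le> t' (Suc i)" using t(1)[of n] t(2)[of i] xy by cases (auto simp: t'_def)
      qed
      then have "(\<Sum>i<Suc (Suc n). \<bar>g (t' (Suc i)) - g (t' i)\<bar>) \<le> Sup (S y)"
        using bdd[OF xy(3)] by (rule cSup_upper)
      moreover have "(\<Sum>i<n. \<bar>g (t' (Suc i)) - g (t' i)\<bar>) = s"
        unfolding s by (intro sum.cong) (auto simp: t'_def)
      ultimately show ?thesis by (simp add: t'_def)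
    qed
    then have "Sup (S x) \<le> Sup (S y) - \<bar>g y - g x\<bar>"
      using ne[OF xy(1)] by (intro cSup_least)
    then show "\<bar>g y - g x\<bar> \<le> Sup (S y) - Sup (S x)" by simp
  qed
qed

text \<open>Jordan decomposition \<open>w = w x + g1 - g2\<close> with \<open>g1\<close> and
  \<open>g2\<close> increasing and zero at \<open>x\<close>, and the second mean value theorem for
  each. The bound sees \<open>k\<close> only through its integrals over subintervals, never through
  |k|, which is what makes estimates in the norm of the primitive possible. The three summands cost
  \<open>W\<close>, \<eta> and \<open>2 * \<eta>\<close>.\<close>

lemma integral_bounded_variation_weight:
  fixes k w V :: "real \<Rightarrow> real"
  assumes xy: "x \<le> y" and k: "k integrable_on {x..y}"
    and V: "\<And>s t. \<lbrakk>x \<le> s; s \<le> t; t \<le> y\<rbrakk> \<Longrightarrow> \<bar>w t - w s\<bar> \<le> V t - V s"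
    and eta: "V y - V x \<le> \<eta>" and W: "\<bar>w x\<bar> \<le> W"
    and S: "\<And>u v. \<lbrakk>x \<le> u; u \<le> v; v \<le> y\<rbrakk> \<Longrightarrow> \<bar>integral {u..v} k\<bar> \<le> S"
  shows "(\<lambda>s. w s * k s) integrable_on {x..y}"
    and "\<bar>integral {x..y} (\<lambda>s. w s * k s)\<bar> \<le> (W + 3 * \<eta>) * S"
proof -
  define g1 where "g1 t = V t - V x" for t
  define g2 where "g2 t = (V t - V x) - (w t - w x)" for t
  obtain c1 where c1: "c1 \<in> {x..y}" and i1: "((\<lambda>s. g1 s * k s) has_integral (g1 x * integral {x..c1} k + g1 y * integral {c1..y} k)) {x..y}"
  proof (rule second_mean_value_theorem_full[OF k xy, of g1])
    fix s t assume "x \<le> s" "s \<le> t" "t \<le> y"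
    then show "g1 s \<le> g1 t" using V[of s t] by (auto simp: g1_def)
  qed auto
  obtain c2 where c2: "c2 \<in> {x..y}" and i2: "((\<lambda>s. g2 s * k s) has_integral (g2 x * integral {x..c2} k + g2 y * integral {c2..y} k)) {x..y}"
  proof (rule second_mean_value_theorem_full[OF k xy, of g2])
    fix s t assume "x \<le> s" "s \<le> t" "t \<le> y"
    then show "g2 s \<le> g2 t" using V[of s t] by (auto simp: g2_def)
  qed auto
  have i0: "((\<lambda>s. w x * k s) has_integral (w x * integral {x..y} k)) {x..y}"
    using k by (intro has_integral_mult_right) auto
  have "((\<lambda>s. w x * k s + g1 s * k s - g2 s * k s) has_integral
     (w x * integral {x..y} k + g1 y * integral {c1..y} k - g2 y * integral {c2..y} k)) {x..y}"
    using has_integral_diff[OF has_integral_add[OF i0 i1] i2] by (simp add: g1_def g2_def)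
  moreover have "(\<lambda>s. w x * k s + g1 s * k s - g2 s * k s) = (\<lambda>s. w s * k s)"
    by (auto simp: g1_def g2_def algebra_simps)
  ultimately have i: "((\<lambda>s. w s * k s) has_integral
     (w x * integral {x..y} k + g1 y * integral {c1..y} k - g2 y * integral {c2..y} k)) {x..y}" by simp
  then show "(\<lambda>s. w s * k s) integrable_on {x..y}" by blast
  have b1: "\<bar>g1 y\<bar> \<le> \<eta>" "\<bar>g2 y\<bar> \<le> 2 * \<eta>" using V[of x y] eta xy by (auto simp: g1_def g2_def)
  have S0: "\<bar>integral {x..y} k\<bar> \<le> S" "\<bar>integral {c1..y} k\<bar> \<le> S" "\<bar>integral {c2..y} k\<bar> \<le> S"
    using c1 c2 xy by (auto intro!: S)
  have "\<bar>w x * integral {x..y} k + g1 y * integral {c1..y} k - g2 y * integral {c2..y} k\<bar>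
     \<le> \<bar>w x\<bar> * \<bar>integral {x..y} k\<bar> + \<bar>g1 y\<bar> * \<bar>integral {c1..y} k\<bar> + \<bar>g2 y\<bar> * \<bar>integral {c2..y} k\<bar>"
    unfolding abs_mult[symmetric] by linarith
  also have "\<dots> \<le> W * S + \<eta> * S + (2 * \<eta>) * S"
    using b1 W S0 by (intro add_mono mult_mono) auto
  finally show "\<bar>integral {x..y} (\<lambda>s. w s * k s)\<bar> \<le> (W + 3 * \<eta>) * S"
    using integral_unique[OF i] by (simp add: algebra_simps)
qed

section \<open>Expanding branches\<close>

text \<open>\<open>s\<close> is the sign of the monotonicity, so that \<open>s * F\<close> increases
  and both orientations are treated at once. \<open>E\<close> absorbs the points where the
  derivative of \<open>F\<close> may fail to be \<open>D\<close>; the expansion bound on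
  \<open>D\<close> holds on \<open>E\<close> as well.\<close>

locale expanding_branch =
  fixes c d \<theta> s :: real and F D :: "real \<Rightarrow> real" and E :: "real set"
  assumes th: "\<theta> > 1" and negE: "negligible E" and s: "s = 1 \<or> s = -1"
    and der: "\<And>x. x \<in> {c..d} - E \<Longrightarrow> (F has_real_derivative D x) (at x within {c..d})"
    and sgn: "\<And>x. x \<in> {c..d} - E \<Longrightarrow> s * D x = \<bar>D x\<bar>"
    and ac: "absolutely_continuous_on_interval c d F"
    and ex: "\<And>x. x \<in> {c..d} \<Longrightarrow> \<bar>D x\<bar> \<ge> \<theta>"
begin

lemma absD_has_integral:
  assumes uv: "c \<le> u" "u \<le> v" "v \<le> d"
  shows "((\<lambda>x. \<bar>D x\<bar>) has_integral s * (F v - F u)) {u..v}"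
proof -
  have "absolutely_continuous_on_interval u v F"
    unfolding absolutely_continuous_on_interval_def
  proof (intro allI impI)
    fix \<epsilon> :: real assume "\<epsilon> > 0"
    then obtain \<delta> where d: "\<delta> > 0" and *: "\<And>(n::nat) (ul::nat \<Rightarrow> real) vl.
       (\<forall>i<n. c \<le> ul i \<and> ul i \<le> vl i \<and> vl i \<le> d) \<and>
        disjoint_family_on (\<lambda>i. {ul i<..<vl i}) {..<n} \<and>
        (\<Sum>i<n. vl i - ul i) < \<delta> \<Longrightarrow>
        (\<Sum>i<n. \<bar>F (vl i) - F (ul i)\<bar>) < \<epsilon>"
      using ac unfolding absolutely_continuous_on_interval_def by meson
    show "\<exists>\<delta>>0. \<forall>(n::nat) (ul::nat \<Rightarrow> real) vl. (\<forall>i<n. u \<le> ul i \<and> ul i \<le> vl i \<and> vl i \<le> v) \<and>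
        disjoint_family_on (\<lambda>i. {ul i<..<vl i}) {..<n} \<and>
        (\<Sum>i<n. vl i - ul i) < \<delta> \<longrightarrow> (\<Sum>i<n. \<bar>F (vl i) - F (ul i)\<bar>) < \<epsilon>"
    proof (rule exI[of _ \<delta>], intro conjI d allI impI)
      fix n :: nat and ul vl :: "nat \<Rightarrow> real"
      assume h: "(\<forall>i<n. u \<le> ul i \<and> ul i \<le> vl i \<and> vl i \<le> v) \<and>
        disjoint_family_on (\<lambda>i. {ul i<..<vl i}) {..<n} \<and> (\<Sum>i<n. vl i - ul i) < \<delta>"
      show "(\<Sum>i<n. \<bar>F (vl i) - F (ul i)\<bar>) < \<epsilon>"
        by (rule *) (use h uv in force)
    qed
  qed
  then have "(D has_integral F v - F u) {u..v}"
  proof (rule absolutely_continuous_has_integral_deriv[OF _ uv(2) negE])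
    fix x assume "x \<in> {u..v} - E"
    then show "(F has_real_derivative D x) (at x within {u..v})"
      using uv by (intro DERIV_subset[OF der]) auto
  qed
  then have i: "((\<lambda>x. s * D x) has_integral s * (F v - F u)) {u..v}" by (rule has_integral_mult_right)
  show ?thesis
    by (rule has_integral_spike[OF negE _ i]) (use sgn uv in auto)
qed

lemma expand:
  assumes uv: "c \<le> u" "u \<le> v" "v \<le> d"
  shows "\<theta> * (v - u) \<le> s * (F v - F u)"
proof -
  have "((\<lambda>x. \<theta>) has_integral \<theta> * (v - u)) {u..v}"
    using has_integral_const_real[of \<theta> u v] uv by (simp add: mult.commute)
  then show ?thesis
    by (rule has_integral_le[OF _ absD_has_integral[OF uv]]) (use ex uv in auto)
qed

lemma inj: "inj_on F {c..d}"
proof (rule linorder_inj_onI)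
  fix u v assume "u < v" "u \<in> {c..d}" "v \<in> {c..d}"
  then have "\<theta> * (v - u) \<le> s * (F v - F u)" "\<theta> * (v - u) > 0" using th by (auto intro!: expand)
  then show "F u \<noteq> F v" by auto
qed auto

lemma cont: "continuous_on {c..d} F"
  unfolding continuous_on_iff
proof (intro ballI allI impI)
  fix x e :: real assume x: "x \<in> {c..d}" and e: "e > 0"
  obtain \<delta> where d: "\<delta> > 0" and *: "\<And>(P :: nat set) u v. \<lbrakk>finite P; \<And>i. i \<in> P \<Longrightarrow> c \<le> u i \<and> u i \<le> v i \<and> v i \<le> d;
        disjoint_family_on (\<lambda>i. {u i<..<v i}) P; (\<Sum>i\<in>P. v i - u i) < \<delta>\<rbrakk>
       \<Longrightarrow> (\<Sum>i\<in>P. \<bar>F (v i) - F (u i)\<bar>) < e"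
    using absolutely_continuous_on_interval_finite[OF ac e, where 'i = nat] by blast
  show "\<exists>\<delta>>0. \<forall>x'\<in>{c..d}. dist x' x < \<delta> \<longrightarrow> dist (F x') (F x) < e"
  proof (intro exI[of _ \<delta>] conjI d ballI impI)
    fix y assume y: "y \<in> {c..d}" "dist y x < \<delta>"
    have "(\<Sum>i\<in>{0::nat}. \<bar>F (max x y) - F (min x y)\<bar>) < e"
      by (rule *) (use x y in \<open>auto simp: disjoint_family_on_def dist_real_def max_def min_def\<close>)
    then show "dist (F y) (F x) < e"
      by (auto simp: dist_real_def max_def min_def abs_minus_commute split: if_splits)
  qed
qed

lemma image_interval:
  assumes uv: "c \<le> u" "u \<le> v" "v \<le> d"
  obtains p q where "F ` {u..v} = {p..q}" "p \<le> q" "q - p = s * (F v - F u)"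
proof -
  have mono: "s * F x \<le> s * F y" if "u \<le> x" "x \<le> y" "y \<le> v" for x y
  proof -
    have "0 \<le> \<theta> * (y - x)" using th that by auto
    also have "\<dots> \<le> s * (F y - F x)" using that uv by (intro expand) auto
    finally show ?thesis by (simp add: algebra_simps)
  qed
  have co: "continuous_on {u..v} F" using uv by (intro continuous_on_subset[OF cont]) auto
  from s show ?thesis
  proof
    assume s1: "s = 1"
    have "F ` {u..v} = {F u..F v}"
    proof
      show "F ` {u..v} \<subseteq> {F u..F v}" using mono[of u] mono[of _ v] uv(2) unfolding s1 by auto
      show "{F u..F v} \<subseteq> F ` {u..v}" using IVT'[of F u _ v] co uv(2) by force
    qed
    then show ?thesis using that mono[of u v] uv s1 by auto
  next
    assume s1: "s = -1"
    have "F ` {u..v} = {F v..F u}"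
    proof
      show "F ` {u..v} \<subseteq> {F v..F u}" using mono[of u] mono[of _ v] uv(2) unfolding s1 by auto
      show "{F v..F u} \<subseteq> F ` {u..v}" using IVT2'[of F v _ u] co uv(2) by force
    qed
    then show ?thesis using that mono[of u v] uv s1 by auto
  qed
qed

text \<open>Substitution is applied on \<open>S = {u..v} - E\<close>, where \<open>F\<close> is
  differentiable at every point. To return to the whole interval, the image of \<open>S\<close> must
  have full measure in the image of \<open>{u..v}\<close>. Substitution with the constant 1 shows
  this: the measure of the image of \<open>S\<close> is the integral of |D|, which by
  \<open>absD_has_integral\<close> is the length of the whole image.\<close>

lemma change_of_variables:
  assumes uv: "c \<le> u" "u \<le> v" "v \<le> d"
    and g: "(g :: real \<Rightarrow> real) \<in> borel_measurable lebesgue" "\<And>x. \<bar>g x\<bar> \<le> B"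
  shows "(\<lambda>x. \<bar>D x\<bar> * g (F x)) absolutely_integrable_on {u..v}"
    and "integral {u..v} (\<lambda>x. \<bar>D x\<bar> * g (F x)) = integral (F ` {u..v}) g"
proof -
  define S where "S = {u..v} - E"
  have Sl: "S \<in> sets lebesgue" unfolding S_def by (rule sets.Diff) (auto intro: negligible_imp_sets[OF negE])
  have dS: "(F has_field_derivative D x) (at x within S)" if "x \<in> S" for x
    using that uv by (intro DERIV_subset[OF der]) (auto simp: S_def)
  have iS: "inj_on F S" using uv by (intro inj_on_subset[OF inj]) (auto simp: S_def)
  note cov = has_absolute_integral_change_of_variables_1'[OF Sl dS iS]
  have nn: "negligible {x \<in> S - {u..v}. Q x}" "negligible {x \<in> {u..v} - S. Q x}" for Q
    by (rule negligible_subset[OF negE], force simp: S_def)+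
  obtain p q where pq: "F ` {u..v} = {p..q}" "p \<le> q" "q - p = s * (F v - F u)" using image_interval[OF uv] .
  have hi: "((\<lambda>x. \<bar>D x\<bar>) has_integral (q - p)) {u..v}" using absD_has_integral[OF uv] pq by simp
  then have hiS: "((\<lambda>x. \<bar>D x\<bar>) has_integral (q - p)) S"
    using has_integral_spike_set_eq[OF nn(1) nn(2), of "\<lambda>x. \<bar>D x\<bar>"] by blast
  then have "(\<lambda>x. \<bar>D x\<bar> * 1) absolutely_integrable_on S"
    by (intro nonnegative_absolutely_integrable_1) auto
  then have c1: "(\<lambda>x. 1::real) absolutely_integrable_on F ` S" "integral (F ` S) (\<lambda>x. 1::real) = q - p"
    using cov[of "\<lambda>_. 1" "q - p"] integral_unique[OF hiS] by auto
  have FS: "F ` S \<in> lmeasurable" using c1(1) lmeasurable_iff_integrable_on set_lebesgue_integral_eq_integral(1) by blast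
  have mFS: "measure lebesgue (F ` S) = q - p" using c1(2) lmeasure_integral[OF FS] by simp
  have sub: "F ` S \<subseteq> {p..q}" using pq(1) by (auto simp: S_def)
  have "measure lebesgue ({p..q} - F ` S) = 0"
    using measurable_measure_Diff[OF _ fmeasurableD[OF FS] sub] mFS pq(2) by simp
  then have n2: "negligible ({p..q} - F ` S)"
    using FS by (subst negligible_iff_measure0) (auto intro: fmeasurable_Diff)
  have gp: "g absolutely_integrable_on {p..q}"
    by (rule measurable_bounded_by_integrable_imp_absolutely_integrable[of _ _ "\<lambda>_. B"])
      (use g in \<open>auto intro: measurable_restrict_space1\<close>)
  have gS: "g absolutely_integrable_on F ` S"
    using set_integrable_subset[OF gp fmeasurableD[OF FS] sub] .
  have ieq: "integral (F ` S) g = integral {p..q} g"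
  proof (rule integral_spike_set)
    have "{x \<in> F ` S - {p..q}. g x \<noteq> 0} = {}" using sub by blast
    then show "negligible {x \<in> F ` S - {p..q}. g x \<noteq> 0}" by (simp only: negligible_empty)
    show "negligible {x \<in> {p..q} - F ` S. g x \<noteq> 0}" by (rule negligible_subset[OF n2]) blast
  qed
  have r: "(\<lambda>x. \<bar>D x\<bar> * g (F x)) absolutely_integrable_on S"
      "integral S (\<lambda>x. \<bar>D x\<bar> * g (F x)) = integral {p..q} g"
    using cov[of g "integral {p..q} g"] gS ieq by auto
  show "(\<lambda>x. \<bar>D x\<bar> * g (F x)) absolutely_integrable_on {u..v}"
    using r(1) absolutely_integrable_spike_set_eq[OF nn(1) nn(2), of "\<lambda>x. \<bar>D x\<bar> * g (F x)"] by blast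
  show "integral {u..v} (\<lambda>x. \<bar>D x\<bar> * g (F x)) = integral (F ` {u..v}) g"
    unfolding pq(1) r(2)[symmetric] by (intro integral_spike_set nn)
qed

text \<open>A Lebesgue measurable function composed with a continuous one need not be measurable.
  Here the product of |D| and \<open>g (F x)\<close> is measurable because it is integrable, and
  |D|, which stays away from zero, can be divided out.\<close>

lemma measurable_comp:
  assumes cd: "c \<le> d" and g: "(g :: real \<Rightarrow> real) \<in> borel_measurable lebesgue" "\<And>x. \<bar>g x\<bar> \<le> B"
  shows "(\<lambda>x. g (F x)) \<in> borel_measurable (lebesgue_on {c..d})"
proof -
  have m1: "(\<lambda>x. \<bar>D x\<bar> * g (F x)) \<in> borel_measurable (lebesgue_on {c..d})"
    using cd change_of_variables(1)[OF _ _ _ g, of c d] by (intro absolutely_integrable_imp_borel_measurable) auto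
  have "(\<lambda>x. \<bar>D x\<bar>) absolutely_integrable_on {c..d}"
    using absD_has_integral[of c d] cd by (intro nonnegative_absolutely_integrable_1) auto
  then have m2: "(\<lambda>x. \<bar>D x\<bar>) \<in> borel_measurable (lebesgue_on {c..d})"
    by (intro absolutely_integrable_imp_borel_measurable) auto
  have "(\<lambda>x. (\<bar>D x\<bar> * g (F x)) / \<bar>D x\<bar>) \<in> borel_measurable (lebesgue_on {c..d})"
    using m1 m2 by measurable
  moreover have "(\<lambda>x. (\<bar>D x\<bar> * g (F x)) / \<bar>D x\<bar>) \<in> borel_measurable (lebesgue_on {c..d})
      \<longleftrightarrow> (\<lambda>x. g (F x)) \<in> borel_measurable (lebesgue_on {c..d})"
  proof (rule measurable_cong)
    fix x assume "x \<in> space (lebesgue_on {c..d})"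
    then show "(\<bar>D x\<bar> * g (F x)) / \<bar>D x\<bar> = g (F x)" using ex[of x] th by auto
  qed
  ultimately show ?thesis by blast
qed

text \<open>The nonzero derivative off \<open>E\<close> prevents \<open>F\<close> from collapsing a
  set of positive measure to a null set.\<close>

lemma vimage_negligible:
  assumes N: "negligible N"
  shows "negligible {x \<in> {c..d}. F x \<in> N}"
proof -
  have "negligible {x \<in> {c..d} - E. F x \<in> N}"
  proof (rule negligible_differentiable_vimage[OF N])
    fix x assume x: "x \<in> {c..d} - E"
    show "(F has_derivative ((*) (D x))) (at x within {c..d} - E)"
      using DERIV_subset[OF der[OF x]] unfolding has_field_derivative_def by blast
    show "inj ((*) (D x))" using ex[of x] x th by (auto simp: inj_on_def)
  qed
  then have "negligible ({x \<in> {c..d} - E. F x \<in> N} \<union> E)" using negE by simp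
  then show ?thesis by (rule negligible_subset) auto
qed

text \<open>\<open>g (F x)\<close> is the product of the weight 1/|D| and the function |D|
  \<open>g (F x)\<close>. The latter integrates over a subinterval to the integral of
  \<open>g\<close> over an image interval, at most \<open>S\<close>; the weight is bounded by
  \<open>1 / \<theta>\<close> and its variation is at most that of \<open>D\<close>, since |D| \<ge>
  1.\<close>

lemma integral_comp_bound:
  assumes uv: "c \<le> u" "u \<le> v" "v \<le> d"
    and g: "(g :: real \<Rightarrow> real) \<in> borel_measurable lebesgue" "\<And>x. \<bar>g x\<bar> \<le> B"
    and V: "\<And>x y. \<lbrakk>u \<le> x; x \<le> y; y \<le> v\<rbrakk> \<Longrightarrow> \<bar>D y - D x\<bar> \<le> V y - V x" and eta: "V v - V u \<le> \<eta>"
    and S: "\<And>p q. \<lbrakk>p \<le> q; {p..q} \<subseteq> F ` {u..v}\<rbrakk> \<Longrightarrow> \<bar>integral {p..q} g\<bar> \<le> S"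
  shows "\<bar>integral {u..v} (\<lambda>x. g (F x))\<bar> \<le> (1 / \<theta> + 3 * \<eta>) * S"
proof -
  have "\<bar>integral {u..v} (\<lambda>x. (1 / \<bar>D x\<bar>) * (\<bar>D x\<bar> * g (F x)))\<bar> \<le> (1 / \<theta> + 3 * \<eta>) * S"
  proof (rule integral_bounded_variation_weight(2)[OF uv(2), where V = V])
    show "(\<lambda>x. \<bar>D x\<bar> * g (F x)) integrable_on {u..v}"
      using change_of_variables(1)[OF uv g] by (rule set_lebesgue_integral_eq_integral(1))
    show "V v - V u \<le> \<eta>" by (rule eta)
    show "\<bar>1 / \<bar>D u\<bar>\<bar> \<le> 1 / \<theta>" using ex[of u] th uv by (auto simp: divide_simps)
    show "\<bar>integral {u'..v'} (\<lambda>x. \<bar>D x\<bar> * g (F x))\<bar> \<le> S" if uv': "u \<le> u'" "u' \<le> v'" "v' \<le> v" for u' v'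
    proof -
      have 1: "c \<le> u'" "v' \<le> d" using that uv by auto
      obtain p q where pq: "F ` {u'..v'} = {p..q}" "p \<le> q" using image_interval[OF 1(1) uv'(2) 1(2)] .
      have "{p..q} \<subseteq> F ` {u..v}" unfolding pq(1)[symmetric] using that by (intro image_mono) auto
      then show ?thesis
        using change_of_variables(2)[OF 1(1) that(2) 1(2) g] S[OF pq(2)] unfolding pq(1) by simp
    qed
    show "\<bar>1 / \<bar>D y\<bar> - 1 / \<bar>D x\<bar>\<bar> \<le> V y - V x" if "u \<le> x" "x \<le> y" "y \<le> v" for x y
    proof -
      have D1: "\<bar>D x\<bar> \<ge> 1" "\<bar>D y\<bar> \<ge> 1" using ex[of x] ex[of y] th uv that by auto
      then have "1 / \<bar>D y\<bar> - 1 / \<bar>D x\<bar> = (\<bar>D x\<bar> - \<bar>D y\<bar>) / (\<bar>D x\<bar> * \<bar>D y\<bar>)" by (auto simp: field_simps)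
      then have "\<bar>1 / \<bar>D y\<bar> - 1 / \<bar>D x\<bar>\<bar> = \<bar>\<bar>D x\<bar> - \<bar>D y\<bar>\<bar> / (\<bar>D x\<bar> * \<bar>D y\<bar>)"
        by (simp add: abs_mult)
      also have "\<dots> \<le> \<bar>\<bar>D x\<bar> - \<bar>D y\<bar>\<bar> / 1"
        using D1 mult_mono[of 1 "\<bar>D x\<bar>" 1 "\<bar>D y\<bar>"] by (intro divide_left_mono) auto
      also have "\<dots> \<le> \<bar>D y - D x\<bar>" by simp
      also have "\<dots> \<le> V y - V x" by (rule V[OF that])
      finally show ?thesis .
    qed
  qed
  moreover have "integral {u..v} (\<lambda>x. (1 / \<bar>D x\<bar>) * (\<bar>D x\<bar> * g (F x))) = integral {u..v} (\<lambda>x. g (F x))"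
  proof (rule integral_cong)
    fix x assume "x \<in> {u..v}"
    then show "(1 / \<bar>D x\<bar>) * (\<bar>D x\<bar> * g (F x)) = g (F x)" using ex[of x] th uv by auto
  qed
  ultimately show ?thesis by simp
qed

end

lemma expanding_branchI:
  assumes cd: "c < d" and th: "\<theta> > 1"
    and m: "mono_on {c<..<d} f \<or> antimono_on {c<..<d} f"
    and Ff: "\<And>x. x \<in> {c<..<d} \<Longrightarrow> F x = f x"
    and ac: "absolutely_continuous_on_interval c d F"
    and der: "AE x in lebesgue_on {c..d}. (F has_real_derivative D x) (at x within {c..d})"
    and ex: "\<And>x. x \<in> {c..d} \<Longrightarrow> \<bar>D x\<bar> \<ge> \<theta>"
  obtains s E where "expanding_branch c d \<theta> s F D E"
proof -
  obtain N where N: "{x \<in> space (lebesgue_on {c..d}). \<not> (F has_real_derivative D x) (at x within {c..d})} \<subseteq> N"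
      "emeasure (lebesgue_on {c..d}) N = 0" "N \<in> sets (lebesgue_on {c..d})"
    using AE_E[OF der] .
  have "N \<in> null_sets (lebesgue_on {c..d})" using N by auto
  then have nN: "negligible N" by (simp add: negligible_iff_null_sets null_sets_restrict_space)
  \<comment> \<open>The endpoints are added because \<open>f\<close> is known to be monotone on the
    open interval only, and the sign of \<open>D\<close> is read off from two-sided
    derivatives.\<close>
  define E where "E = N \<union> {c, d}"
  have nE: "negligible E" using nN by (simp add: E_def)
  have derE: "(F has_real_derivative D x) (at x within {c..d})" if "x \<in> {c..d} - E" for x
    using N(1) that by (auto simp: E_def)
  have derI: "(F has_real_derivative D x) (at x)" "x \<in> interior {c<..<d}" if "x \<in> {c..d} - E" for x
    using derE[OF that] that by (auto simp: E_def at_within_Icc_at)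
  have mF: "mono_on {c<..<d} F \<or> mono_on {c<..<d} (\<lambda>x. - F x)"
    using m Ff unfolding monotone_on_def by force
  have "\<exists>s. (s = 1 \<or> s = -1) \<and> (\<forall>x\<in>{c..d} - E. s * D x = \<bar>D x\<bar>)"
    using mF
  proof
    assume "mono_on {c<..<d} F"
    then have "D x \<ge> 0" if "x \<in> {c..d} - E" for x using mono_on_imp_deriv_nonneg derI[OF that] by blast
    then show ?thesis by (intro exI[of _ 1]) auto
  next
    assume a: "mono_on {c<..<d} (\<lambda>x. - F x)"
    have "- D x \<ge> 0" if "x \<in> {c..d} - E" for x
      using mono_on_imp_deriv_nonneg[OF a DERIV_minus[OF derI(1)[OF that]] derI(2)[OF that]] by simp
    then show ?thesis by (intro exI[of _ "-1"]) auto
  qed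
  then obtain s where "s = 1 \<or> s = -1" "\<And>x. x \<in> {c..d} - E \<Longrightarrow> s * D x = \<bar>D x\<bar>" by blast
  then have "expanding_branch c d \<theta> s F D E"
    by (intro expanding_branch.intro th nE derE ac ex) auto
  then show ?thesis by (rule that)
qed

lemma sum_indicator_disjoint:
  fixes k :: "'a set \<Rightarrow> real"
  assumes Q: "finite Q" "disjoint Q" and A: "A \<in> Q" "x \<in> A"
  shows "(\<Sum>B\<in>Q. k B * indicator (B \<inter> T) x) = k A * indicator T x"
proof -
  have "(\<Sum>B\<in>Q. k B * indicator (B \<inter> T) x) = (\<Sum>B\<in>Q. if B = A then k A * indicator T x else 0)"
  proof (rule sum.cong[OF refl])
    fix B assume B: "B \<in> Q"
    show "k B * indicator (B \<inter> T) x = (if B = A then k A * indicator T x else 0)"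
    proof (cases "B = A")
      case False
      then have "x \<notin> B" using disjointD[OF Q(2) B A(1)] A(2) by blast
      then show ?thesis using False by simp
    qed (use A in \<open>simp add: indicator_def\<close>)
  qed
  then show ?thesis using Q(1) A(1) by simp
qed

section \<open>The norm of the primitive\<close>

locale bounded_interval =
  fixes a b :: real
  assumes ab: "a < b"
begin

abbreviation M :: "real measure" where "M \<equiv> lebesgue_on {a..b}"

text \<open>Bounded at every point and not merely almost everywhere: such functions are integrable
  against every finite measure on the same sigma-algebra, and composition with the map keeps them in
  the class, with no null sets to track.\<close>

definition bm :: "(real \<Rightarrow> real) set" where
  "bm = {g. g \<in> borel_measurable M \<and> (\<exists>B. \<forall>x\<in>{a..b}. \<bar>g x\<bar> \<le> B)}"

definition J :: "real set \<Rightarrow> (real \<Rightarrow> real) \<Rightarrow> real" where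
  "J S g = (LINT y|M. indicator S y * g y)"

text \<open>Only a seminorm, blind to changes on null sets. As a supremum of reals it is meaningful
  where the primitive is bounded; \<open>pn_upper\<close> provides this on
  \<open>bm\<close>.\<close>

definition pn :: "(real \<Rightarrow> real) \<Rightarrow> real" where
  "pn g = (SUP x\<in>{a..b}. \<bar>J {a..x} g\<bar>)"

sublocale M: finite_measure M
  by (rule finite_measure_lebesgue_on) auto

lemma measure_M: "S \<in> sets lebesgue \<Longrightarrow> measure M ({a..b} \<inter> S) = measure lebesgue ({a..b} \<inter> S)"
  by (subst measure_restrict_space) auto

lemma bmI: "\<lbrakk>g \<in> borel_measurable M; \<And>x. x \<in> {a..b} \<Longrightarrow> \<bar>g x\<bar> \<le> B\<rbrakk> \<Longrightarrow> g \<in> bm"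
  unfolding bm_def by blast

lemma bmE:
  assumes "g \<in> bm"
  obtains B where "B > 0" "\<And>x. x \<in> {a..b} \<Longrightarrow> \<bar>g x\<bar> \<le> B"
proof -
  obtain B where "\<And>x. x \<in> {a..b} \<Longrightarrow> \<bar>g x\<bar> \<le> B" using assms unfolding bm_def by blast
  then show ?thesis using that[of "\<bar>B\<bar> + 1"] by (meson abs_ge_zero abs_ge_self add_increasing2 add_nonneg_pos le_add_same_cancel1 order.trans zero_le_one zero_less_one)
qed

lemma bm_measurable: "g \<in> bm \<Longrightarrow> g \<in> borel_measurable M" by (simp add: bm_def)

lemma bm_integrable: assumes "g \<in> bm" shows "integrable M g"
proof -
  obtain B where "\<And>x. x \<in> {a..b} \<Longrightarrow> \<bar>g x\<bar> \<le> B" using bmE[OF assms] by blast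
  then show ?thesis by (intro M.integrable_const_bound[of _ B] bm_measurable assms) auto
qed

lemma ind_measurable: "S \<in> sets lebesgue \<Longrightarrow> indicat_real S \<in> borel_measurable M"
  by (intro measurable_restrict_space1) auto

lemma bm_add: assumes "g \<in> bm" "h \<in> bm" shows "(\<lambda>x. g x + h x) \<in> bm"
proof -
  obtain B C where "\<And>x. x \<in> {a..b} \<Longrightarrow> \<bar>g x\<bar> \<le> B" "\<And>x. x \<in> {a..b} \<Longrightarrow> \<bar>h x\<bar> \<le> C"
    using bmE assms by metis
  then show ?thesis using assms bm_measurable
    by (intro bmI[of _ "B + C"] borel_measurable_add) (auto intro: order_trans[OF abs_triangle_ineq] add_mono)
qed

lemma bm_mult: assumes "g \<in> bm" "h \<in> bm" shows "(\<lambda>x. g x * h x) \<in> bm"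
proof -
  obtain B C where "\<And>x. x \<in> {a..b} \<Longrightarrow> \<bar>g x\<bar> \<le> B" "\<And>x. x \<in> {a..b} \<Longrightarrow> \<bar>h x\<bar> \<le> C" "B > 0" "C > 0"
    using bmE assms by metis
  then show ?thesis using assms bm_measurable
    by (intro bmI[of _ "B * C"] borel_measurable_times) (auto simp: abs_mult intro: mult_mono)
qed

lemma bm_const: "(\<lambda>x. k) \<in> bm" by (intro bmI[of _ "\<bar>k\<bar>"]) auto

lemma bm_cmult: "g \<in> bm \<Longrightarrow> (\<lambda>x. k * g x) \<in> bm" by (rule bm_mult[OF bm_const])

lemma bm_diff: assumes "g \<in> bm" "h \<in> bm" shows "(\<lambda>x. g x - h x) \<in> bm"
  using bm_add[OF assms(1) bm_cmult[OF assms(2), of "-1"]] by simp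

lemma bm_ind: "S \<in> sets lebesgue \<Longrightarrow> indicat_real S \<in> bm"
  by (intro bmI[of _ 1] ind_measurable) (auto simp: indicator_def)

lemma bm_abs: assumes "g \<in> bm" shows "(\<lambda>x. \<bar>g x\<bar>) \<in> bm"
proof -
  obtain B where B: "\<And>x. x \<in> {a..b} \<Longrightarrow> \<bar>g x\<bar> \<le> B" using bmE[OF assms] by blast
  show ?thesis by (rule bmI[of _ B]) (use B bm_measurable[OF assms] in auto)
qed

lemma bm_sum: "\<lbrakk>\<And>i. i \<in> I \<Longrightarrow> g i \<in> bm\<rbrakk> \<Longrightarrow> (\<lambda>x. \<Sum>i\<in>I. g i x) \<in> bm"
  by (induction I rule: infinite_finite_induct) (auto intro: bm_add bm_const)

lemma J_int: "\<lbrakk>S \<in> sets lebesgue; g \<in> bm\<rbrakk> \<Longrightarrow> integrable M (\<lambda>y. indicator S y * g y)"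
  by (intro bm_integrable bm_mult bm_ind)

lemma J_add: "\<lbrakk>S \<in> sets lebesgue; g \<in> bm; h \<in> bm\<rbrakk> \<Longrightarrow> J S (\<lambda>x. g x + h x) = J S g + J S h"
  unfolding J_def by (subst Bochner_Integration.integral_add[symmetric]) (auto intro!: J_int simp: distrib_left)

lemma J_diff: "\<lbrakk>S \<in> sets lebesgue; g \<in> bm; h \<in> bm\<rbrakk> \<Longrightarrow> J S (\<lambda>x. g x - h x) = J S g - J S h"
  unfolding J_def by (subst Bochner_Integration.integral_diff[symmetric]) (auto intro!: J_int simp: right_diff_distrib)

lemma J_cmult: "J S (\<lambda>x. k * g x) = k * J S g"
  unfolding J_def by (simp add: mult.left_commute)

lemma J_sum: assumes "S \<in> sets lebesgue" "\<And>i. i \<in> I \<Longrightarrow> g i \<in> bm"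
  shows "J S (\<lambda>x. \<Sum>i\<in>I. g i x) = (\<Sum>i\<in>I. J S (g i))"
  unfolding J_def sum_distrib_left by (rule Bochner_Integration.integral_sum) (auto intro: J_int assms)

lemma J_Un: assumes "S \<in> sets lebesgue" "T \<in> sets lebesgue" "g \<in> bm" "S \<inter> T = {}"
  shows "J (S \<union> T) g = J S g + J T g"
proof -
  have "indicator (S \<union> T) x * g x = indicator S x * g x + indicator T x * g x" for x
    using assms(4) by (auto simp: indicator_def)
  then show ?thesis unfolding J_def using assms by (simp add: J_int)
qed

lemma J_bound:
  assumes "S \<in> sets lebesgue" "g \<in> bm" "\<And>x. x \<in> {a..b} \<Longrightarrow> \<bar>g x\<bar> \<le> B"
  shows "\<bar>J S g\<bar> \<le> B * measure lebesgue ({a..b} \<inter> S)"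
proof -
  have "\<bar>J S g\<bar> \<le> (LINT y|M. B * indicator S y)"
    unfolding J_def using assms
    by (intro integral_abs_bound_integral J_int bm_integrable bm_cmult bm_ind)
      (auto simp: abs_mult indicator_def)
  also have "\<dots> = B * measure lebesgue ({a..b} \<inter> S)"
    using measure_M[OF assms(1)] by (simp add: Int_commute)
  finally show ?thesis .
qed

lemma J_cong_negligible:
  assumes S: "S \<in> sets lebesgue" "T \<in> sets lebesgue" and g: "g \<in> bm" and n: "negligible (sym_diff S T)"
  shows "J S g = J T g"
proof -
  have "AE x in lebesgue. x \<notin> sym_diff S T"
    using n by (intro AE_not_in) (simp add: negligible_iff_null_sets)
  then have ae: "AE x in M. x \<notin> sym_diff S T"
    by (subst AE_restrict_space_iff) (auto elim: AE_mp)
  show ?thesis unfolding J_def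
    using ae by (intro integral_cong_AE borel_measurable_times ind_measurable S bm_measurable g)
      (auto simp: indicator_def)
qed

text \<open>The bridge between the Lebesgue integral behind \<open>J\<close> and the gauge integral
  in which the estimates for the branches are stated.\<close>

lemma J_eq_integral:
  assumes "a \<le> p" "q \<le> b" "g \<in> bm"
  shows "J {p..q} g = integral {p..q} g"
proof -
  have 1: "{p..q} \<subseteq> {a..b}" using assms by auto
  have "J {p..q} g = integral\<^sup>L lebesgue (\<lambda>x. indicator {a..b} x *\<^sub>R (indicator {p..q} x * g x))"
    unfolding J_def by (rule integral_restrict_space) auto
  also have "\<dots> = integral\<^sup>L lebesgue (\<lambda>x. indicator {p..q} x *\<^sub>R g x)"
    using 1 by (intro Bochner_Integration.integral_cong) (auto simp: indicator_def)
  also have "\<dots> = integral\<^sup>L (lebesgue_on {p..q}) g"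
    by (rule integral_restrict_space[symmetric]) auto
  also have "\<dots> = integral {p..q} g"
  proof (rule lebesgue_integral_eq_integral)
    have "integrable lebesgue (\<lambda>x. indicator {a..b} x *\<^sub>R g x)"
      using bm_integrable[OF assms(3)] by (subst (asm) integrable_restrict_space) auto
    then have "set_integrable lebesgue {p..q} g"
      using 1 set_integrable_subset[of lebesgue "{a..b}" g "{p..q}"] by (auto simp: set_integrable_def)
    then show "integrable (lebesgue_on {p..q}) g"
      by (subst integrable_restrict_space) (auto simp: set_integrable_def)
  qed auto
  finally show ?thesis .
qed

lemma J_diff_prim:
  assumes "a \<le> p" "p \<le> q" "q \<le> b" "g \<in> bm"
  shows "J {p..q} g = J {a..q} g - J {a..p} g"
proof -
  have "J {a..q} g = J ({a..p} \<union> {p<..q}) g" using assms by (intro arg_cong[where f="\<lambda>S. J S g"]) auto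
  also have "\<dots> = J {a..p} g + J {p<..q} g" using assms by (intro J_Un) auto
  also have "J {p<..q} g = J {p..q} g"
  proof (rule J_cong_negligible)
    have "sym_diff {p<..q} {p..q} \<subseteq> {p}" by auto
    then show "negligible (sym_diff {p<..q} {p..q})" using negligible_subset by blast
  qed (use assms in auto)
  finally show ?thesis by simp
qed

lemma pn_upper: assumes "g \<in> bm" "x \<in> {a..b}" shows "\<bar>J {a..x} g\<bar> \<le> pn g"
proof -
  obtain B where B: "B > 0" "\<And>x. x \<in> {a..b} \<Longrightarrow> \<bar>g x\<bar> \<le> B" using bmE[OF assms(1)] by blast
  have "bdd_above ((\<lambda>x. \<bar>J {a..x} g\<bar>) ` {a..b})"
  proof (rule bdd_aboveI2)
    fix x assume "x \<in> {a..b}"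
    have "\<bar>J {a..x} g\<bar> \<le> B * measure lebesgue ({a..b} \<inter> {a..x})"
      using assms B by (intro J_bound) auto
    also have "\<dots> \<le> B * measure lebesgue {a..b}"
      using B by (intro mult_left_mono measure_mono_fmeasurable) auto
    finally show "\<bar>J {a..x} g\<bar> \<le> B * measure lebesgue {a..b}" .
  qed
  then show ?thesis unfolding pn_def using assms(2) by (intro cSUP_upper)
qed

lemma pn_least: "(\<And>x. x \<in> {a..b} \<Longrightarrow> \<bar>J {a..x} g\<bar> \<le> s) \<Longrightarrow> pn g \<le> s"
  unfolding pn_def using ab by (intro cSUP_least) auto

lemma pn_nonneg: "g \<in> bm \<Longrightarrow> 0 \<le> pn g"
  using pn_upper[of g a] ab by (meson abs_ge_zero atLeastAtMost_iff order.refl order.strict_implies_order order_trans)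

lemma pn_add: "\<lbrakk>g \<in> bm; h \<in> bm\<rbrakk> \<Longrightarrow> pn (\<lambda>x. g x + h x) \<le> pn g + pn h"
proof (rule pn_least)
  fix x assume "g \<in> bm" "h \<in> bm" "x \<in> {a..b}"
  then show "\<bar>J {a..x} (\<lambda>x. g x + h x)\<bar> \<le> pn g + pn h"
    using pn_upper[of g x] pn_upper[of h x] by (simp add: J_add)
qed

lemma pn_diff: "\<lbrakk>g \<in> bm; h \<in> bm\<rbrakk> \<Longrightarrow> pn (\<lambda>x. g x - h x) \<le> pn g + pn h"
proof (rule pn_least)
  fix x assume "g \<in> bm" "h \<in> bm" "x \<in> {a..b}"
  then show "\<bar>J {a..x} (\<lambda>x. g x - h x)\<bar> \<le> pn g + pn h"
    using pn_upper[of g x] pn_upper[of h x] by (simp add: J_diff)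
qed

lemma pn_diff_commute: "pn (\<lambda>x. g x - h x) = pn (\<lambda>x. h x - g x)"
proof -
  have "J S (\<lambda>x. g x - h x) = - J S (\<lambda>x. h x - g x)" for S
    using J_cmult[of S "-1" "\<lambda>x. h x - g x"] by simp
  then show ?thesis unfolding pn_def by simp
qed

lemma pn_triangle: assumes "g \<in> bm" "h \<in> bm" shows "pn g \<le> pn h + pn (\<lambda>x. g x - h x)"
  using pn_add[OF assms(2) bm_diff[OF assms]] by simp

lemma pn_cmult: assumes "g \<in> bm" shows "pn (\<lambda>x. k * g x) \<le> \<bar>k\<bar> * pn g"
  by (rule pn_least) (auto simp: J_cmult abs_mult intro!: mult_left_mono pn_upper assms)

lemma pn_sum: "\<lbrakk>finite I; \<And>i. i \<in> I \<Longrightarrow> g i \<in> bm\<rbrakk> \<Longrightarrow> pn (\<lambda>x. \<Sum>i\<in>I. g i x) \<le> (\<Sum>i\<in>I. pn (g i))"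
proof (induction I rule: finite_induct)
  case empty
  show ?case by (rule pn_least) (auto simp: J_def)
next
  case (insert i I)
  have "pn (\<lambda>x. g i x + (\<Sum>i\<in>I. g i x)) \<le> pn (g i) + pn (\<lambda>x. \<Sum>i\<in>I. g i x)"
    using insert by (intro pn_add bm_sum) auto
  then show ?case using insert by simp
qed

lemma pn_bound:
  assumes "g \<in> bm" "\<And>x. x \<in> {a..b} \<Longrightarrow> \<bar>g x\<bar> \<le> B"
  shows "pn g \<le> B * (b - a)"
proof (rule pn_least)
  fix x assume x: "x \<in> {a..b}"
  have B: "0 \<le> B" using assms(2)[of a] ab by (meson abs_ge_zero atLeastAtMost_iff order.refl order.strict_implies_order order_trans)
  have "\<bar>J {a..x} g\<bar> \<le> B * measure lebesgue ({a..b} \<inter> {a..x})"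
    using assms by (intro J_bound) auto
  also have "\<dots> \<le> B * measure lebesgue {a..b}"
    using B by (intro mult_left_mono measure_mono_fmeasurable) auto
  finally show "\<bar>J {a..x} g\<bar> \<le> B * (b - a)" using ab by simp
qed

lemma pn_ind_le:
  assumes S: "S \<in> sets lebesgue" shows "pn (indicat_real S) \<le> measure lebesgue ({a..b} \<inter> S)"
proof (rule pn_least)
  fix x assume x: "x \<in> {a..b}"
  have "J {a..x} (indicat_real S) = J S (indicat_real {a..x})"
    unfolding J_def by (simp add: mult.commute)
  also have "\<bar>\<dots>\<bar> \<le> 1 * measure lebesgue ({a..b} \<inter> S)"
    using S by (intro J_bound bm_ind) (auto simp: indicator_def)
  finally show "\<bar>J {a..x} (indicat_real S)\<bar> \<le> measure lebesgue ({a..b} \<inter> S)" by simp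
qed

lemma J_Icc_pn:
  assumes "a \<le> p" "p \<le> q" "q \<le> b" "g \<in> bm"
  shows "\<bar>J {p..q} g\<bar> \<le> 2 * pn g"
  using J_diff_prim[OF assms] pn_upper[OF assms(4), of p] pn_upper[OF assms(4), of q] assms by auto

lemma is_interval_sets_lebesgue: "is_interval (S :: real set) \<Longrightarrow> S \<in> sets lebesgue"
  using real_interval_borel_measurable by fastforce

text \<open>The contraction estimate concerns closed subintervals, while cylinders may lack their
  endpoints. Cutting off two end strips of width \<open>d\<close> leaves a closed interval inside
  \<open>S\<close>, and the strips cost at most \<open>B * d\<close> each.\<close>

lemma J_is_interval_bound:
  assumes S: "is_interval S" "S \<subseteq> {a..b}" and h: "h \<in> bm" and s: "0 \<le> s"
    and I: "\<And>u v. \<lbrakk>u \<le> v; {u..v} \<subseteq> S\<rbrakk> \<Longrightarrow> \<bar>J {u..v} h\<bar> \<le> s"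
  shows "\<bar>J S h\<bar> \<le> s"
proof (cases "S = {}")
  case True then show ?thesis using s by (simp add: J_def)
next
  case False
  have bd: "bdd_above S" "bdd_below S" using S(2) by (meson bdd_above_Icc bdd_above_mono bdd_below_Icc bdd_below_mono)+
  define l r where "l = Inf S" and "r = Sup S"
  have lr: "S \<subseteq> {l..r}" using bd by (auto simp: l_def r_def intro: cInf_lower cSup_upper)
  have la: "a \<le> l" unfolding l_def using S(2) False by (intro cInf_greatest) auto
  have rb: "r \<le> b" unfolding r_def using S(2) False by (intro cSup_least) auto
  have inn: "{u..v} \<subseteq> S" if luv: "l < u" "v < r" for u v
  proof
    fix x assume x: "x \<in> {u..v}"
    obtain y where "y \<in> S" "y < u" using cInf_lessD[OF False luv(1)[unfolded l_def]] by blast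
    moreover obtain z where "z \<in> S" "v < z" using less_cSupE[OF luv(2)[unfolded r_def] False] by blast
    ultimately show "x \<in> S" using S(1) x unfolding is_interval_1 by (meson atLeastAtMost_iff less_imp_le order_trans)
  qed
  have Sl: "S \<in> sets lebesgue" using S(1) by (rule is_interval_sets_lebesgue)
  have JS: "J S h = J {l..r} h"
  proof (rule J_cong_negligible[OF Sl _ h])
    have "x \<in> {l, r}" if "x \<in> sym_diff S {l..r}" for x
    proof (rule ccontr)
      assume "x \<notin> {l, r}"
      with that lr have "l < x" "x < r" "x \<notin> S" by auto
      then show False using inn[of x x] by auto
    qed
    then have "sym_diff S {l..r} \<subseteq> {l,r}" by blast
    then show "negligible (sym_diff S {l..r})" by (rule negligible_subset[rotated]) simp
  qed auto
  obtain B where B: "B > 0" "\<And>x. x \<in> {a..b} \<Longrightarrow> \<bar>h x\<bar> \<le> B" using bmE[OF h] by blast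
  have lip: "\<bar>J {u..v} h\<bar> \<le> B * (v - u)" if "a \<le> u" "u \<le> v" "v \<le> b" for u v
  proof -
    have "\<bar>J {u..v} h\<bar> \<le> B * measure lebesgue ({a..b} \<inter> {u..v})" using B h by (intro J_bound) auto
    also have "{a..b} \<inter> {u..v} = {u..v}" using that by auto
    finally show ?thesis using that by simp
  qed
  have lr': "l \<le> r" using False lr by auto
  have "\<bar>J {l..r} h\<bar> \<le> s + e" if e: "e > 0" for e
  proof (cases "l = r")
    case True
    then show ?thesis using lip[of l r] la rb s e by simp
  next
    case False
    with lr' have lr'': "l < r" by simp
    \<comment> \<open>\<open>e / (2 * B)\<close> makes the two strips cost at most \<open>e\<close>
      together; \<open>(r - l) / 3\<close> keeps the middle interval nondegenerate.\<close>
    define d where "d = min (e / (2 * B)) ((r - l) / 3)"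
    have d: "d > 0" "2 * (B * d) \<le> e" "2 * d < r - l"
      using e B(1) lr'' by (auto simp: d_def min_def field_simps)
    have "J {l..r} h = (J {a..r} h - J {a..r - d} h) + (J {a..r-d} h - J {a..l+d} h) + (J {a..l+d} h - J {a..l} h)"
      using J_diff_prim[of l r h] la rb lr' h by simp
    also have "\<dots> = J {r-d..r} h + J {l+d..r-d} h + J {l..l+d} h"
      using J_diff_prim[of "r-d" r h] J_diff_prim[of "l+d" "r-d" h] J_diff_prim[of l "l+d" h] la rb d h by simp
    finally have "\<bar>J {l..r} h\<bar> \<le> \<bar>J {r-d..r} h\<bar> + \<bar>J {l+d..r-d} h\<bar> + \<bar>J {l..l+d} h\<bar>" by linarith
    moreover have "\<bar>J {r-d..r} h\<bar> \<le> B * d" "\<bar>J {l..l+d} h\<bar> \<le> B * d"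
      using lip[of "r-d" r] lip[of l "l+d"] la rb d by auto
    moreover have "\<bar>J {l+d..r-d} h\<bar> \<le> s" using d by (intro I inn) auto
    ultimately show ?thesis using d(2) by linarith
  qed
  then show ?thesis unfolding JS by (rule field_le_epsilon)
qed

end

section \<open>The dual Lasota--Yorke inequality\<close>

text \<open>Nonsingularity, \<open>f_null\<close>, is what transports statements that hold almost
  everywhere along orbits.\<close>

locale interval_map = bounded_interval +
  fixes f :: "real \<Rightarrow> real"
  assumes f_meas: "f \<in> M \<rightarrow>\<^sub>M M"
    and f_null: "N \<in> null_sets M \<Longrightarrow> f -` N \<inter> {a..b} \<in> null_sets M"
begin

lemma f_in: "x \<in> {a..b} \<Longrightarrow> f x \<in> {a..b}"
  using measurable_space[OF f_meas] by simp

lemma fn_in: "x \<in> {a..b} \<Longrightarrow> (f ^^ n) x \<in> {a..b}"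
  by (induction n) (auto simp: f_in[simplified])

lemma fn_meas: "f ^^ n \<in> M \<rightarrow>\<^sub>M M"
  by (rule measurable_compose_n[OF f_meas])

lemma fn_null: "N \<in> null_sets M \<Longrightarrow> (f ^^ n) -` N \<inter> {a..b} \<in> null_sets M"
proof (induction n)
  case 0
  then have "N \<subseteq> {a..b}" using sets.sets_into_space[of N M] by auto
  then have "(f ^^ 0) -` N \<inter> {a..b} = N" by auto
  then show ?case using 0 by simp
next
  case (Suc n)
  have "(f ^^ Suc n) -` N \<inter> {a..b} = f -` ((f ^^ n) -` N \<inter> {a..b}) \<inter> {a..b}"
    using f_in by (auto simp: funpow_Suc_right simp del: funpow.simps)
  then show ?case using f_null[OF Suc.IH[OF Suc.prems]] by (simp only:)
qed

lemma AE_fn: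
  assumes "AE x in M. Q x" shows "AE x in M. Q ((f ^^ n) x)"
proof -
  obtain N where N: "{x \<in> space M. \<not> Q x} \<subseteq> N" "emeasure M N = 0" "N \<in> sets M" by (rule AE_E[OF assms])
  show ?thesis
  proof (rule AE_I')
    show "(f ^^ n) -` N \<inter> {a..b} \<in> null_sets M" using N by (intro fn_null) auto
    show "{x \<in> space M. \<not> Q ((f ^^ n) x)} \<subseteq> (f ^^ n) -` N \<inter> {a..b}"
    proof
      fix x assume "x \<in> {x \<in> space M. \<not> Q ((f ^^ n) x)}"
      then have x: "x \<in> {a..b}" "\<not> Q ((f ^^ n) x)" by auto
      then have "(f ^^ n) x \<in> N" using N(1) fn_in[OF x(1), of n] by auto
      then show "x \<in> (f ^^ n) -` N \<inter> {a..b}" using x by simp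
    qed
  qed
qed

lemma bm_comp: assumes "g \<in> bm" shows "(\<lambda>x. g ((f ^^ n) x)) \<in> bm"
proof -
  obtain B where B: "\<And>x. x \<in> {a..b} \<Longrightarrow> \<bar>g x\<bar> \<le> B" using bmE[OF assms] by blast
  show ?thesis
    by (rule bmI[of _ B]) (use B fn_in measurable_compose[OF fn_meas bm_measurable[OF assms]] in auto)
qed

lemma bm_comp1: "g \<in> bm \<Longrightarrow> (\<lambda>x. g (f x)) \<in> bm" using bm_comp[of g 1] by simp

lemma fn_vimage: "A \<in> sets M \<Longrightarrow> (f ^^ n) -` A \<inter> {a..b} \<in> sets M"
  using measurable_sets[OF fn_meas, of A n] by simp

lemma f_vimage: "A \<in> sets M \<Longrightarrow> f -` A \<inter> {a..b} \<in> sets M"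
  using fn_vimage[of A 1] by simp

end

text \<open>Expansion survives only as \<open>P_contr\<close>: bounds on integrals of
  \<open>g\<close> over intervals shrink by the factor \<beta> under composition with
  \<open>f\<close>. The bound is required only inside the image of \<open>{u..v}\<close>, which is
  what lets the estimate be iterated along cylinders.\<close>

locale expanding_partition = interval_map +
  fixes \<beta> :: real and P :: "real set set"
  assumes \<beta>: "0 < \<beta>" "\<beta> < 1"
    and P_finite: "finite P" and P_cover: "\<Union>P = {a..b}" and P_disjoint: "disjoint P"
    and P_interval: "A \<in> P \<Longrightarrow> is_interval A"
    and P_mono: "A \<in> P \<Longrightarrow> mono_on A f \<or> antimono_on A f"
    and P_contr: "\<lbrakk>A \<in> P; u \<le> v; {u..v} \<subseteq> A; g \<in> bm;
        \<And>p q. \<lbrakk>p \<le> q; {p..q} \<subseteq> f ` {u..v}\<rbrakk> \<Longrightarrow> \<bar>J {p..q} g\<bar> \<le> s\<rbrakk>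
      \<Longrightarrow> \<bar>J {u..v} (\<lambda>x. g (f x))\<bar> \<le> \<beta> * s"
begin

text \<open>Any finite partition into intervals with the \<open>n\<close>-fold contraction
  qualifies; how it arises from itineraries is forgotten.\<close>

definition cylinders :: "nat \<Rightarrow> real set set \<Rightarrow> bool" where
  "cylinders n Q \<longleftrightarrow> finite Q \<and> \<Union>Q = {a..b} \<and> disjoint Q \<and> (\<forall>A\<in>Q. is_interval A) \<and>
    (\<forall>A\<in>Q. \<forall>u v g s. u \<le> v \<longrightarrow> {u..v} \<subseteq> A \<longrightarrow> g \<in> bm \<longrightarrow>
      (\<forall>p q. p \<le> q \<longrightarrow> {p..q} \<subseteq> {a..b} \<longrightarrow> \<bar>J {p..q} g\<bar> \<le> s) \<longrightarrow>
      \<bar>J {u..v} (\<lambda>x. g ((f ^^ n) x))\<bar> \<le> \<beta> ^ n * s)"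

lemma cylindersD:
  assumes "cylinders n Q"
  shows "finite Q" "\<Union>Q = {a..b}" "disjoint Q" "\<And>A. A \<in> Q \<Longrightarrow> is_interval A"
  using assms by (simp_all add: cylinders_def)

lemmas cylinders_contr =
  cylinders_def[THEN iffD1, THEN conjunct2, THEN conjunct2, THEN conjunct2, THEN conjunct2, rule_format]

text \<open>A cell of order \<open>Suc n\<close> is the part of a piece \<open>A\<close> of
  \<open>P\<close> that \<open>f\<close> sends into a cell \<open>B\<close> of order
  \<open>n\<close>. It is an interval because \<open>f\<close> is monotone on \<open>A\<close>. The
  image of a subinterval of it lies in the single cell \<open>B\<close>, so the estimate for
  \<open>B\<close> supplies the hypothesis of \<open>P_contr\<close>.\<close>

lemma cylinders_exist: "\<exists>Q. cylinders n Q"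
proof (induction n)
  case 0
  show ?case unfolding cylinders_def
  proof (intro exI[of _ "{{a..b}}"] conjI ballI allI impI)
    fix A u v g s
    assume "A \<in> {{a..b}}" "u \<le> v" "{u..v} \<subseteq> A"
      "\<forall>p q. p \<le> q \<longrightarrow> {p..q} \<subseteq> {a..b} \<longrightarrow> \<bar>J {p..q} g\<bar> \<le> s"
    then show "\<bar>J {u..v} (\<lambda>x. g ((f ^^ 0) x))\<bar> \<le> \<beta> ^ 0 * s" by simp
  qed (auto simp: disjoint_def)
next
  case (Suc n)
  then obtain Q where cyl: "cylinders n Q" by blast
  note Q = cylindersD[OF cyl]
  note QC = cylinders_contr[OF cyl]
  define R where "R = (\<lambda>(A,B). A \<inter> f -` B) ` (P \<times> Q)"
  have 1: "finite R" using P_finite Q(1) by (simp add: R_def)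
  have 2: "\<Union>R = {a..b}"
  proof
    show "\<Union>R \<subseteq> {a..b}" unfolding R_def using P_cover by auto
    show "{a..b} \<subseteq> \<Union>R"
    proof
      fix x assume x: "x \<in> {a..b}"
      then obtain A where "A \<in> P" "x \<in> A" using P_cover by blast
      moreover obtain B where "B \<in> Q" "f x \<in> B" using Q(2) f_in[OF x] by blast
      ultimately show "x \<in> \<Union>R" unfolding R_def by blast
    qed
  qed
  have 3: "disjoint R"
  proof (rule disjointI)
    fix S T assume ST: "S \<in> R" "T \<in> R" "S \<noteq> T"
    obtain A B where S: "S = A \<inter> f -` B" "A \<in> P" "B \<in> Q" using ST(1) by (auto simp: R_def)
    obtain C D where T: "T = C \<inter> f -` D" "C \<in> P" "D \<in> Q" using ST(2) by (auto simp: R_def)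
    have "A \<noteq> C \<or> B \<noteq> D" using S T ST(3) by auto
    then show "S \<inter> T = {}"
      using disjointD[OF P_disjoint S(2) T(2)] disjointD[OF Q(3) S(3) T(3)] S(1) T(1) by blast
  qed
  have 4: "is_interval S" if SR: "S \<in> R" for S
  proof -
    obtain A B where S: "S = A \<inter> f -` B" "A \<in> P" "B \<in> Q" using SR by (auto simp: R_def)
    show ?thesis unfolding is_interval_1
    proof (intro ballI allI impI)
      fix x y z assume x: "x \<in> S" "y \<in> S" "x \<le> z \<and> z \<le> y"
      then have zA: "z \<in> A" using P_interval[OF S(2)] S(1) unfolding is_interval_1 by blast
      have "f x \<le> f z \<and> f z \<le> f y \<or> f y \<le> f z \<and> f z \<le> f x"
        using P_mono[OF S(2)] x zA S(1) unfolding monotone_on_def by blast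
      moreover have "f x \<in> B" "f y \<in> B" using x S(1) by auto
      ultimately have "f z \<in> B" using Q(4)[OF S(3)] unfolding is_interval_1 by blast
      then show "z \<in> S" using zA S(1) by simp
    qed
  qed
  show ?case unfolding cylinders_def
  proof (intro exI[of _ R] conjI ballI allI impI)
    fix S u v g s
    assume SR: "S \<in> R" and uv: "u \<le> v" "{u..v} \<subseteq> S" and g: "g \<in> bm"
      and s: "\<forall>p q. p \<le> q \<longrightarrow> {p..q} \<subseteq> {a..b} \<longrightarrow> \<bar>J {p..q} g\<bar> \<le> s"
    have s': "\<bar>J {p..q} g\<bar> \<le> s" if "p \<le> q" "{p..q} \<subseteq> {a..b}" for p q
      using s that by blast
    obtain A B where S: "S = A \<inter> f -` B" "A \<in> P" "B \<in> Q" using SR by (auto simp: R_def)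
    have "\<bar>J {u..v} (\<lambda>x. g ((f ^^ n) (f x)))\<bar> \<le> \<beta> * (\<beta> ^ n * s)"
    proof (rule P_contr[OF S(2) uv(1) _ bm_comp[OF g]])
      show "{u..v} \<subseteq> A" using uv S(1) by blast
      fix p q assume pq: "p \<le> q" "{p..q} \<subseteq> f ` {u..v}"
      then have "{p..q} \<subseteq> B" using uv S(1) by blast
      then show "\<bar>J {p..q} (\<lambda>x. g ((f ^^ n) x))\<bar> \<le> \<beta> ^ n * s"
        by (rule QC[OF S(3) pq(1) _ g s'])
    qed
    then show "\<bar>J {u..v} (\<lambda>x. g ((f ^^ Suc n) x))\<bar> \<le> \<beta> ^ Suc n * s"
      by (simp add: funpow_Suc_right mult.assoc del: funpow.simps)
  qed (use 1 2 3 4 in auto)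
qed

text \<open>Subtracting from \<open>g \<circ> f ^^ n\<close> its mean over each cylinder
  leaves a function whose primitive vanishes at the cylinder ends, so that only a single cylinder contributes
  to the norm of the remainder.\<close>
lemma Lasota_Yorke_step:
  "\<exists>C. \<forall>g\<in>bm. \<exists>h1\<in>bm. \<exists>h2\<in>bm. (\<forall>x. g ((f ^^ n) x) = h1 x + h2 x) \<and>
     pn h1 \<le> 4 * \<beta> ^ n * pn g \<and> (\<forall>x\<in>{a..b}. \<bar>h2 x\<bar> \<le> C * pn g)"
proof -
  obtain Q where cyl: "cylinders n Q" using cylinders_exist by blast
  note Q = cylindersD[OF cyl]
  note QC = cylinders_contr[OF cyl]
  define m where "m S = measure lebesgue S" for S :: "real set"
  \<comment> \<open>Depends on \<open>n\<close> through the measures of the cylinders, a dependence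
    that \<open>Lasota_Yorke\<close> removes. A cylinder of measure zero contributes 0, by division
    by zero.\<close>
  define C where "C = (\<Sum>A\<in>Q. 2 * \<beta> ^ n / m A)"
  have Qab: "A \<subseteq> {a..b}" if "A \<in> Q" for A using Q(2) that by blast
  have Ql: "A \<in> sets lebesgue" if "A \<in> Q" for A using Q(4)[OF that] by (rule is_interval_sets_lebesgue)
  show ?thesis
  proof (intro exI[of _ C] ballI)
    fix g assume g: "g \<in> bm"
    define G where "G x = g ((f ^^ n) x)" for x
    have G: "G \<in> bm" unfolding G_def by (rule bm_comp[OF g])
    \<comment> \<open>The factor 2 comes from writing an integral over a subinterval as a difference
      of two values of the primitive.\<close>
    define t where "t = \<beta> ^ n * (2 * pn g)"
    have t0: "0 \<le> t" using \<beta> pn_nonneg[OF g] by (simp add: t_def)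
    have JB: "\<bar>J S G\<bar> \<le> t" if A: "A \<in> Q" and S: "S \<subseteq> A" "is_interval S" for A S
    proof (rule J_is_interval_bound[OF S(2) _ G t0])
      show "S \<subseteq> {a..b}" using S Qab[OF A] by blast
      fix u v assume uv: "u \<le> v" "{u..v} \<subseteq> S"
      show "\<bar>J {u..v} G\<bar> \<le> t" unfolding G_def t_def
      proof (rule QC[OF A uv(1) _ g])
        show "{u..v} \<subseteq> A" using uv S by blast
        fix p q assume "p \<le> q" "{p..q} \<subseteq> {a..b}"
        then show "\<bar>J {p..q} g\<bar> \<le> 2 * pn g" by (intro J_Icc_pn g) auto
      qed
    qed
    \<comment> \<open>For a cylinder of measure zero the mean is 0 by convention, which is harmless
      because the integral of \<open>G\<close> over it is 0 as well.\<close>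
    define avg where "avg A = J A G / m A" for A
    define h2 where "h2 x = (\<Sum>A\<in>Q. avg A * indicator A x)" for x
    define h1 where "h1 x = G x - h2 x" for x
    have h2: "h2 \<in> bm" unfolding h2_def by (intro bm_sum bm_cmult bm_ind Ql)
    have h1: "h1 \<in> bm" unfolding h1_def by (intro bm_diff G h2)
    have h2b: "\<bar>h2 x\<bar> \<le> C * pn g" for x
    proof -
      have "\<bar>h2 x\<bar> \<le> (\<Sum>A\<in>Q. \<bar>avg A * indicator A x\<bar>)" unfolding h2_def by (rule sum_abs)
      also have "\<dots> \<le> (\<Sum>A\<in>Q. (2 * \<beta> ^ n / m A) * pn g)"
      proof (rule sum_mono)
        fix A assume A: "A \<in> Q"
        have "\<bar>avg A * indicator A x\<bar> \<le> \<bar>avg A\<bar>" by (auto simp: indicator_def)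
        also have "\<dots> \<le> t / m A" unfolding avg_def abs_divide
          using JB[OF A order_refl Q(4)[OF A]] by (simp add: m_def divide_right_mono)
        also have "\<dots> = (2 * \<beta> ^ n / m A) * pn g" by (simp add: t_def)
        finally show "\<bar>avg A * indicator A x\<bar> \<le> (2 * \<beta> ^ n / m A) * pn g" .
      qed
      finally show ?thesis by (simp add: C_def sum_distrib_right)
    qed
    have h2A: "h2 x = avg A" if "A \<in> Q" "x \<in> A" for A x
    proof -
      show ?thesis unfolding h2_def
        using sum_indicator_disjoint[OF Q(1) Q(3) that, of avg UNIV] by simp
    qed
    have Jh2: "J S h2 = avg A * m S" if A: "A \<in> Q" and S: "S \<subseteq> A" "S \<in> sets lebesgue" for A S
    proof -
      have "J S h2 = (LINT y|M. avg A * indicator S y)"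
        unfolding J_def using h2A[OF A] S(1)
        by (intro Bochner_Integration.integral_cong) (auto simp: indicator_def subset_iff)
      also have "\<dots> = avg A * measure M ({a..b} \<inter> S)" using S by (simp add: Int_commute)
      also have "measure M ({a..b} \<inter> S) = m S"
        using S Qab[OF A] by (subst measure_M) (auto simp: m_def intro!: arg_cong[where f="measure lebesgue"])
      finally show ?thesis .
    qed
    \<comment> \<open>The integral of \<open>h1\<close> vanishes over the empty part of a cylinder
      and over the whole of it; over any other part it costs at most \<open>t\<close> for
      \<open>G\<close> and \<open>t\<close> for the mean.\<close>
    have JA0: "J S h1 = 0 \<or> (\<bar>J S h1\<bar> \<le> 2 * t \<and> S \<noteq> {} \<and> S \<noteq> A)"
      if A: "A \<in> Q" and S: "S \<subseteq> A" "is_interval S" for A S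
    proof -
      have Sl: "S \<in> sets lebesgue" using S by (intro is_interval_sets_lebesgue)
      have "bounded A" using Qab[OF A] by (rule bounded_subset[rotated]) simp
      then have Afm: "A \<in> lmeasurable" using is_interval_convex[OF Q(4)[OF A]] by (intro measurable_convex)
      have mS: "0 \<le> m S" "m S \<le> m A" unfolding m_def using S Sl Afm by (auto intro: measure_mono_fmeasurable)
      have eq: "J S h1 = J S G - avg A * m S"
        unfolding h1_def using J_diff[OF Sl G h2] Jh2[OF A S(1) Sl] by simp
      have "J S G = 0" if "m A = 0"
      proof -
        obtain B where B: "B > 0" "\<And>x. x \<in> {a..b} \<Longrightarrow> \<bar>G x\<bar> \<le> B" using bmE[OF G] by blast
        have "\<bar>J S G\<bar> \<le> B * measure lebesgue ({a..b} \<inter> S)" by (rule J_bound[OF Sl G B(2)])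
        also have "{a..b} \<inter> S = S" using S Qab[OF A] by blast
        finally have "\<bar>J S G\<bar> \<le> B * m S" by (simp add: m_def)
        moreover have "m S = 0" using mS that by linarith
        ultimately show ?thesis by simp
      qed
      then have z: "J S h1 = 0" if "m A = 0" using eq that by (simp add: avg_def)
      have z': "J S h1 = 0" if "S = A" using eq z that by (cases "m A = 0") (auto simp: avg_def)
      have z'': "J S h1 = 0" if "S = {}" using that by (simp add: J_def)
      have "\<bar>J S h1\<bar> \<le> 2 * t" if "m A \<noteq> 0"
      proof -
        have "\<bar>avg A * m S\<bar> = \<bar>J A G\<bar> * (m S / m A)" using mS by (simp add: avg_def abs_mult)
        also have "\<dots> \<le> t * 1"
          using JB[OF A order_refl Q(4)[OF A]] mS that t0 by (intro mult_mono) (auto simp: divide_simps)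
        finally show ?thesis unfolding eq using JB[OF A S] by linarith
      qed
      then show ?thesis using z z' z'' by blast
    qed
    have "pn h1 \<le> 2 * t"
    proof (rule pn_least)
      fix x assume x: "x \<in> {a..b}"
      have int: "is_interval (A \<inter> {a..x})" if "A \<in> Q" for A
        using Q(4)[OF that] by (intro is_interval_Int) auto
      obtain A0 where A0: "A0 \<in> Q" "x \<in> A0" using Q(2) x by blast
      \<comment> \<open>A cylinder that meets \<open>{a..x}\<close> without being contained in it
        has points on both sides of \<open>x\<close>, hence contains \<open>x\<close>; by
        disjointness it is \<open>A0\<close>.\<close>
      have other: "J (A \<inter> {a..x}) h1 = 0" if A: "A \<in> Q" "A \<noteq> A0" for A
      proof (rule ccontr)
        assume "J (A \<inter> {a..x}) h1 \<noteq> 0"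
        then have "A \<inter> {a..x} \<noteq> {}" "A \<inter> {a..x} \<noteq> A" using JA0[OF A(1) _ int[OF A(1)]] by blast+
        then obtain y z where "y \<in> A" "y \<le> x" "z \<in> A" "x \<le> z" using Qab[OF A(1)] by fastforce
        then have "x \<in> A" using Q(4)[OF A(1)] unfolding is_interval_1 by blast
        then show False using disjointD[OF Q(3) A(1) A0(1) A(2)] A0(2) by blast
      qed
      have "J {a..x} h1 = (\<Sum>A\<in>Q. J (A \<inter> {a..x}) h1)"
      proof -
        have "J {a..x} h1 = (LINT y|M. (\<Sum>A\<in>Q. indicator (A \<inter> {a..x}) y * h1 y))"
          unfolding J_def
        proof (rule Bochner_Integration.integral_cong[OF refl])
          fix y assume "y \<in> space M"
          then have "y \<in> \<Union>Q" unfolding Q(2) by simp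
          then obtain A where A: "A \<in> Q" "y \<in> A" by blast
          show "indicator {a..x} y * h1 y = (\<Sum>A\<in>Q. indicator (A \<inter> {a..x}) y * h1 y)"
            using sum_indicator_disjoint[OF Q(1) Q(3) A, of "\<lambda>_. h1 y" "{a..x}"] by (simp add: mult.commute)
        qed
        also have "\<dots> = (\<Sum>A\<in>Q. J (A \<inter> {a..x}) h1)"
          unfolding J_def using h1 Ql by (intro Bochner_Integration.integral_sum J_int) auto
        finally show ?thesis .
      qed
      also have "\<dots> = (\<Sum>A\<in>{A0}. J (A \<inter> {a..x}) h1)"
        using A0 Q(1) other by (intro sum.mono_neutral_right) auto
      finally have "J {a..x} h1 = J (A0 \<inter> {a..x}) h1" by simp
      then show "\<bar>J {a..x} h1\<bar> \<le> 2 * t" using JA0[OF A0(1) _ int[OF A0(1)]] t0 by fastforce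
    qed
    then show "\<exists>h1\<in>bm. \<exists>h2\<in>bm. (\<forall>x. g ((f ^^ n) x) = h1 x + h2 x) \<and>
     pn h1 \<le> 4 * \<beta> ^ n * pn g \<and> (\<forall>x\<in>{a..b}. \<bar>h2 x\<bar> \<le> C * pn g)"
      using h1 h2 h2b by (intro bexI[of _ h1] bexI[of _ h2]) (auto simp: h1_def G_def t_def mult_ac)
  qed
qed

text \<open>The constant of \<open>Lasota_Yorke_step\<close> depends on \<open>n\<close>. To make it
  uniform, a power \<open>f ^^ N\<close> with \<open>4 * \<beta> ^ N < 1 / 2\<close> is fixed and
  iterated: each application splits the small part again, while the bounded parts are carried along
  and sum to a geometric series.\<close>

lemma Lasota_Yorke:
  obtains C and e :: "nat \<Rightarrow> real" where "C > 0" "e \<longlonglongrightarrow> 0"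
    "\<And>n g. g \<in> bm \<Longrightarrow> \<exists>h1\<in>bm. \<exists>h2\<in>bm. (\<forall>x. g ((f ^^ n) x) = h1 x + h2 x) \<and>
       pn h1 \<le> e n * pn g \<and> (\<forall>x\<in>{a..b}. \<bar>h2 x\<bar> \<le> C * pn g)"
proof -
  obtain N where N: "\<beta> ^ N < 1 / 8" using real_arch_pow_inv[of "1/8" \<beta>] \<beta> by auto
  have N0: "N > 0" using N by (cases N) auto
  obtain K where K: "\<And>n g. g \<in> bm \<Longrightarrow> \<exists>h1\<in>bm. \<exists>h2\<in>bm. (\<forall>x. g ((f ^^ n) x) = h1 x + h2 x) \<and>
     pn h1 \<le> 4 * \<beta> ^ n * pn g \<and> (\<forall>x\<in>{a..b}. \<bar>h2 x\<bar> \<le> K n * pn g)"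
    using Lasota_Yorke_step by metis
  define C0 where "C0 = \<bar>K N\<bar> + 1"
  have C0: "C0 > 0" by (simp add: C0_def)
  \<comment> \<open>\<open>2 - 2 * (1/2) ^ k\<close> is the sum of \<open>(1/2) ^ i\<close> over
    \<open>i < k\<close>.\<close>
  have iter: "\<exists>h1\<in>bm. \<exists>h2\<in>bm. (\<forall>x. g ((f ^^ (k * N)) x) = h1 x + h2 x) \<and>
     pn h1 \<le> (1/2) ^ k * pn g \<and> (\<forall>x\<in>{a..b}. \<bar>h2 x\<bar> \<le> C0 * (2 - 2 * (1/2) ^ k) * pn g)" if g: "g \<in> bm" for g k
  proof (induction k)
    case 0
    show ?case by (rule bexI[OF _ g], rule bexI[OF _ bm_const[of 0]]) auto
  next
    case (Suc k)
    then obtain h1 h2 where h: "h1 \<in> bm" "h2 \<in> bm" "\<And>x. g ((f ^^ (k * N)) x) = h1 x + h2 x"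
      "pn h1 \<le> (1/2) ^ k * pn g" "\<And>x. x \<in> {a..b} \<Longrightarrow> \<bar>h2 x\<bar> \<le> C0 * (2 - 2 * (1/2) ^ k) * pn g" by blast
    obtain h3 h4 where h': "h3 \<in> bm" "h4 \<in> bm" "\<And>x. h1 ((f ^^ N) x) = h3 x + h4 x"
      "pn h3 \<le> 4 * \<beta> ^ N * pn h1" "\<And>x. x \<in> {a..b} \<Longrightarrow> \<bar>h4 x\<bar> \<le> K N * pn h1" using K[OF h(1), of N] by blast
    have "pn h3 \<le> (1/2) * pn h1"
      using h'(4) mult_right_mono[of "4 * \<beta> ^ N" "1/2" "pn h1"] N pn_nonneg[OF h(1)] by linarith
    then have p: "pn h3 \<le> (1/2) ^ Suc k * pn g" using h(4) by simp
    have q: "\<bar>h4 x + h2 ((f ^^ N) x)\<bar> \<le> C0 * (2 - 2 * (1/2) ^ Suc k) * pn g" if x: "x \<in> {a..b}" for x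
    proof -
      have "\<bar>h4 x\<bar> \<le> C0 * ((1/2) ^ k * pn g)"
      proof -
        have "K N * pn h1 \<le> C0 * ((1/2) ^ k * pn g)"
          using h(4) pn_nonneg[OF h(1)] C0 by (intro mult_mono) (auto simp: C0_def)
        then show ?thesis using h'(5)[OF x] by linarith
      qed
      moreover have "\<bar>h2 ((f ^^ N) x)\<bar> \<le> C0 * (2 - 2 * (1/2) ^ k) * pn g" by (intro h(5) fn_in x)
      ultimately show ?thesis by (simp add: algebra_simps)
    qed
    have r: "g ((f ^^ (Suc k * N)) x) = h3 x + (h4 x + h2 ((f ^^ N) x))" for x
    proof -
      have "(f ^^ (Suc k * N)) x = (f ^^ (k * N)) ((f ^^ N) x)"
        using funpow_add[of "k * N" N f] by (simp add: add.commute)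
      then show ?thesis using h(3) h'(3) by simp
    qed
    show ?case
      by (rule bexI[OF _ h'(1)], rule bexI[OF _ bm_add[OF h'(2) bm_comp[OF h(2), of N]]]) (use p q r in auto)
  qed
  \<comment> \<open>A crude bound for the fewer than \<open>N\<close> leftover iterates: 4 bounds
    \<open>4 * \<beta> ^ r\<close>, and the factor \<open>b - a\<close> turns the sup bound on
    \<open>h2\<close> into a bound on its primitive.\<close>
  define L where "L = (\<Sum>r<N. 4 + \<bar>K r\<bar> * (b - a))"
  have Lr: "4 + \<bar>K r\<bar> * (b - a) \<le> L" if "r < N" for r
    unfolding L_def using that ab by (intro member_le_sum) auto
  have L0: "L > 0"
  proof -
    have "0 < 4 + \<bar>K 0\<bar> * (b - a)" using ab by (intro add_pos_nonneg) auto
    also have "\<dots> \<le> L" by (rule Lr[OF N0])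
    finally show ?thesis .
  qed
  have small: "pn (\<lambda>x. g ((f ^^ r) x)) \<le> L * pn g" if r: "r < N" and g: "g \<in> bm" for r g
  proof -
    obtain h1 h2 where h: "h1 \<in> bm" "h2 \<in> bm" "\<And>x. g ((f ^^ r) x) = h1 x + h2 x"
      "pn h1 \<le> 4 * \<beta> ^ r * pn g" "\<And>x. x \<in> {a..b} \<Longrightarrow> \<bar>h2 x\<bar> \<le> K r * pn g" using K[OF g, of r] by blast
    have "pn (\<lambda>x. g ((f ^^ r) x)) \<le> pn h1 + pn h2" unfolding h(3) by (rule pn_add[OF h(1,2)])
    moreover have "pn h2 \<le> K r * pn g * (b - a)" by (rule pn_bound[OF h(2,5)])
    moreover have "\<beta> ^ r * pn g \<le> 1 * pn g" using \<beta> pn_nonneg[OF g] by (intro mult_right_mono power_le_one) auto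
    moreover have "K r * pn g * (b - a) \<le> \<bar>K r\<bar> * pn g * (b - a)"
      using ab pn_nonneg[OF g] by (intro mult_right_mono) auto
    ultimately have "pn (\<lambda>x. g ((f ^^ r) x)) \<le> (4 + \<bar>K r\<bar> * (b - a)) * pn g"
      using h(4) by (simp add: algebra_simps)
    also have "\<dots> \<le> L * pn g" using Lr[OF r] pn_nonneg[OF g] by (rule mult_right_mono)
    finally show ?thesis .
  qed
  define e where "e n = L * (1/2) ^ (n div N)" for n
  show ?thesis
  proof (rule that)
    show "2 * C0 * L > 0" using C0 L0 by simp
    have "filterlim (\<lambda>n. n div N) at_top sequentially"
      unfolding filterlim_at_top
    proof
      fix Z
      show "\<forall>\<^sub>F n in sequentially. Z \<le> n div N"
        using eventually_ge_at_top[of "Z * N"] by eventually_elim (metis N0 div_le_mono nonzero_mult_div_cancel_right less_numeral_extra(3))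
    qed
    then have "(\<lambda>n. (1/2 :: real) ^ (n div N)) \<longlonglongrightarrow> 0"
      by (intro filterlim_compose[OF LIMSEQ_power_zero]) auto
    then show "e \<longlonglongrightarrow> 0" unfolding e_def by (rule tendsto_mult_right_zero)
    fix n g assume g: "g \<in> bm"
    define r where "r = n mod N"
    define k where "k = n div N"
    have r: "r < N" using N0 by (simp add: r_def)
    \<comment> \<open>The leftover iterates are attached to \<open>g\<close>: the iteration runs on
      \<open>g \<circ> f ^^ r\<close>, whose norm is at most \<open>L * pn g\<close>.\<close>
    have nk: "(f ^^ n) x = (f ^^ r) ((f ^^ (k * N)) x)" for x
      by (simp add: r_def k_def funpow_add[symmetric, unfolded o_def fun_eq_iff, rule_format])
    obtain h1 h2 where h: "h1 \<in> bm" "h2 \<in> bm" "\<And>x. g ((f ^^ r) ((f ^^ (k * N)) x)) = h1 x + h2 x"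
      "pn h1 \<le> (1/2) ^ k * pn (\<lambda>x. g ((f ^^ r) x))"
      "\<And>x. x \<in> {a..b} \<Longrightarrow> \<bar>h2 x\<bar> \<le> C0 * (2 - 2 * (1/2) ^ k) * pn (\<lambda>x. g ((f ^^ r) x))"
      using iter[OF bm_comp[OF g, of r], of k] by blast
    have "pn h1 \<le> (1/2) ^ k * (L * pn g)"
      using h(4) mult_left_mono[OF small[OF r g], of "(1/2) ^ k"] by (meson order_trans zero_le_divide_1_iff zero_le_numeral zero_le_power)
    moreover have "\<bar>h2 x\<bar> \<le> 2 * C0 * L * pn g" if "x \<in> {a..b}" for x
    proof -
      have "C0 * (2 - 2 * (1/2) ^ k) * pn (\<lambda>x. g ((f ^^ r) x)) \<le> C0 * 2 * (L * pn g)"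
        using C0 small[OF r g] pn_nonneg[OF bm_comp[OF g, of r]] by (intro mult_mono) (auto simp: power_le_one)
      then show ?thesis using h(5)[OF that] by (simp add: mult_ac)
    qed
    ultimately show "\<exists>h1\<in>bm. \<exists>h2\<in>bm. (\<forall>x. g ((f ^^ n) x) = h1 x + h2 x) \<and>
       pn h1 \<le> e n * pn g \<and> (\<forall>x\<in>{a..b}. \<bar>h2 x\<bar> \<le> 2 * C0 * L * pn g)"
      using h(1-3) by (intro bexI[of _ h1] bexI[of _ h2]) (auto simp: nk e_def k_def mult_ac)
  qed
qed

end

section \<open>The partition into monotone branches\<close>

lemma negligible_null_sets_lebesgue_on:
  assumes "S \<in> sets lebesgue"
  shows "N \<in> null_sets (lebesgue_on S) \<longleftrightarrow> negligible N \<and> N \<subseteq> S"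
  using assms by (auto simp: null_sets_restrict_space negligible_iff_null_sets)

text \<open>Each open branch is cut at the levels of the variation \<open>V i\<close> of
  \<open>D i\<close>, so that the derivative varies by at most \<eta> on every piece; larger jumps
  fall between pieces. With \<eta> small, \<open>1 / \<theta> + 3 * \<eta>\<close> is below 1 for
  every \<open>\<theta> > 1\<close>. The branch points, where \<open>f\<close> is arbitrary, form
  pieces of their own.\<close>

theorem piecewise_expanding_partition:
  assumes "piecewise_C1BV_expanding a b f"
  obtains \<beta> P where "expanding_partition a b f \<beta> P"
proof -
  obtain n :: nat and c F D \<theta> where fab: "f ` {a..b} \<subseteq> {a..b}" and n: "n \<ge> 1" and c0: "c 0 = a" and cn: "c n = b" and th: "\<theta> > 1"
    and br: "\<forall>i<n. c i < c (Suc i) \<and>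
           (mono_on {c i<..<c (Suc i)} f \<or> antimono_on {c i<..<c (Suc i)} f) \<and>
           (\<forall>x\<in>{c i<..<c (Suc i)}. F i x = f x) \<and>
           F i ` {c i..c (Suc i)} \<subseteq> {a..b} \<and>
           absolutely_continuous_on_interval (c i) (c (Suc i)) (F i) \<and>
           (AE x in lebesgue_on {c i..c (Suc i)}.
              (F i has_real_derivative D i x) (at x within {c i..c (Suc i)})) \<and>
           has_bounded_variation_on_interval (c i) (c (Suc i)) (D i) \<and>
           (\<forall>x\<in>{c i..c (Suc i)}. \<bar>D i x\<bar> \<ge> \<theta>)"
    using assms unfolding piecewise_C1BV_expanding_def by (elim conjE exE) (rule that, assumption+)
  have b1: "c i < c (Suc i)" and b2: "mono_on {c i<..<c (Suc i)} f \<or> antimono_on {c i<..<c (Suc i)} f"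
    and b3: "\<And>x. x \<in> {c i<..<c (Suc i)} \<Longrightarrow> F i x = f x" and b4: "F i ` {c i..c (Suc i)} \<subseteq> {a..b}"
    and b5: "absolutely_continuous_on_interval (c i) (c (Suc i)) (F i)"
    and b6: "AE x in lebesgue_on {c i..c (Suc i)}. (F i has_real_derivative D i x) (at x within {c i..c (Suc i)})"
    and b7: "has_bounded_variation_on_interval (c i) (c (Suc i)) (D i)"
    and b8: "\<And>x. x \<in> {c i..c (Suc i)} \<Longrightarrow> \<bar>D i x\<bar> \<ge> \<theta>" if "i < n" for i
    using br[rule_format, OF that] by blast+
  have cmono: "c i < c j" if "i < j" "j \<le> n" for i j
    using that
  proof (induction j)
    case (Suc j)
    then show ?case using b1[of j] by (cases "i = j") auto
  qed simp
  have cmono': "c i \<le> c j" if "i \<le> j" "j \<le> n" for i j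
    using cmono[of i j] that by (cases "i = j") auto
  have ab: "a < b" using cmono[of 0 n] n c0 cn by simp
  have sub: "{c i..c (Suc i)} \<subseteq> {a..b}" if "i < n" for i
    using cmono'[of 0 i] cmono'[of "Suc i" n] that c0 cn by auto
  have cab: "c i \<in> {a..b}" if "i \<le> n" for i
    using cmono'[of 0 i] cmono'[of i n] that c0 cn by auto
  have cover: "x \<in> c ` {..n} \<or> (\<exists>i<n. x \<in> {c i<..<c (Suc i)})" if x: "x \<in> {a..b}" for x
  proof -
    have "m \<le> n \<Longrightarrow> x \<le> c m \<Longrightarrow> x \<in> c ` {..m} \<or> (\<exists>i<m. x \<in> {c i<..<c (Suc i)})" for m
    proof (induction m)
      case 0
      then show ?case using x c0 by auto
    next
      case (Suc m)
      show ?case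
      proof (cases "x \<le> c m")
        case True
        then show ?thesis using Suc by (auto simp: atMost_Suc less_Suc_eq)
      next
        case False
        then show ?thesis using Suc.prems by (cases "x = c (Suc m)") auto
      qed
    qed
    then show ?thesis using x cn by auto
  qed
  have "\<exists>s E. expanding_branch (c i) (c (Suc i)) \<theta> s (F i) (D i) E" if i: "i < n" for i
    using expanding_branchI[OF b1[OF i] th b2[OF i] b3[OF i] b5[OF i] b6[OF i] b8[OF i]] by metis
  then obtain s E where eb: "\<And>i. i < n \<Longrightarrow> expanding_branch (c i) (c (Suc i)) \<theta> (s i) (F i) (D i) (E i)" by metis
  have "\<exists>V. \<forall>x y. c i \<le> x \<longrightarrow> x \<le> y \<longrightarrow> y \<le> c (Suc i) \<longrightarrow> \<bar>D i y - D i x\<bar> \<le> V y - V x" if i: "i < n" for i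
    using bounded_variation_majorant[OF b7[OF i]] by metis
  then obtain V where V: "\<And>i x y. \<lbrakk>i < n; c i \<le> x; x \<le> y; y \<le> c (Suc i)\<rbrakk> \<Longrightarrow> \<bar>D i y - D i x\<bar> \<le> V i y - V i x"
    by metis
  \<comment> \<open>Preimages are computed branch by branch, and the branch points contribute a
    finite set; measurability and nonsingularity of \<open>f\<close> thus reduce to the absolutely
    continuous branches \<open>F i\<close>.\<close>
  have pre: "f -` A \<inter> {a..b} = (\<Union>i<n. {x \<in> {c i..c (Suc i)}. F i x \<in> A} \<inter> {c i<..<c (Suc i)}) \<union> (c ` {..n} \<inter> f -` A)" for A
  proof (intro set_eqI iffI)
    fix x assume x: "x \<in> f -` A \<inter> {a..b}"
    then have "x \<in> c ` {..n} \<or> (\<exists>i<n. x \<in> {c i<..<c (Suc i)})" using cover by blast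
    then show "x \<in> (\<Union>i<n. {x \<in> {c i..c (Suc i)}. F i x \<in> A} \<inter> {c i<..<c (Suc i)}) \<union> (c ` {..n} \<inter> f -` A)"
    proof
      assume "\<exists>i<n. x \<in> {c i<..<c (Suc i)}"
      then obtain i where "i < n" "x \<in> {c i<..<c (Suc i)}" by blast
      then show ?thesis using x b3[of i x] by (intro UnI1 UN_I[of i]) auto
    qed (use x in auto)
  next
    fix x assume "x \<in> (\<Union>i<n. {x \<in> {c i..c (Suc i)}. F i x \<in> A} \<inter> {c i<..<c (Suc i)}) \<union> (c ` {..n} \<inter> f -` A)"
    then show "x \<in> f -` A \<inter> {a..b}"
    proof
      assume "x \<in> (\<Union>i<n. {x \<in> {c i..c (Suc i)}. F i x \<in> A} \<inter> {c i<..<c (Suc i)})"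
      then obtain i where "i < n" "x \<in> {c i<..<c (Suc i)}" "F i x \<in> A" "x \<in> {c i..c (Suc i)}" by blast
      then show ?thesis using b3[of i x] sub[of i] by auto
    qed (use cab in auto)
  qed
  have fin: "finite (c ` {..n} \<inter> f -` A)" for A by simp
  interpret im: interval_map a b f
  proof unfold_locales
    show "a < b" by (rule ab)
    show "f \<in> lebesgue_on {a..b} \<rightarrow>\<^sub>M lebesgue_on {a..b}"
    proof (rule measurableI)
      fix A assume "A \<in> sets (lebesgue_on {a..b})"
      then have A: "A \<in> sets lebesgue" by (simp add: sets_restrict_space_iff)
      have "{x \<in> {c i..c (Suc i)}. F i x \<in> A} \<in> sets lebesgue" if i: "i < n" for i
      proof -
        interpret e: expanding_branch "c i" "c (Suc i)" \<theta> "s i" "F i" "D i" "E i" by (rule eb[OF i])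
        have "(\<lambda>x. indicat_real A (F i x)) \<in> borel_measurable (lebesgue_on {c i..c (Suc i)})"
          using b1[OF i] A by (intro e.measurable_comp[of _ 1]) (auto simp: indicator_def)
        then have "(\<lambda>x. indicat_real A (F i x)) -` {1} \<inter> space (lebesgue_on {c i..c (Suc i)}) \<in> sets (lebesgue_on {c i..c (Suc i)})"
          by (rule measurable_sets) auto
        moreover have "(\<lambda>x. indicat_real A (F i x)) -` {1} \<inter> space (lebesgue_on {c i..c (Suc i)}) = {x \<in> {c i..c (Suc i)}. F i x \<in> A}"
          by (auto simp: indicator_def split: if_splits)
        ultimately show ?thesis by (simp add: sets_restrict_space_iff)
      qed
      then have "f -` A \<inter> {a..b} \<in> sets lebesgue"
        unfolding pre by (intro sets.Un sets.finite_UN negligible_imp_sets[OF negligible_finite[OF fin]] sets.Int) auto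
      then show "f -` A \<inter> space (lebesgue_on {a..b}) \<in> sets (lebesgue_on {a..b})"
        by (simp add: sets_restrict_space_iff)
    next
      fix x assume "x \<in> space (lebesgue_on {a..b})"
      then show "f x \<in> space (lebesgue_on {a..b})" using fab by (simp add: image_subset_iff)
    qed
    fix N assume "N \<in> null_sets (lebesgue_on {a..b})"
    then have N: "negligible N" by (simp add: negligible_null_sets_lebesgue_on)
    have "negligible {x \<in> {c i..c (Suc i)}. F i x \<in> N}" if i: "i < n" for i
    proof -
      interpret e: expanding_branch "c i" "c (Suc i)" \<theta> "s i" "F i" "D i" "E i" by (rule eb[OF i])
      show ?thesis by (rule e.vimage_negligible[OF N])
    qed
    then have "negligible (f -` N \<inter> {a..b})"
      unfolding pre
      by (intro negligible_Un negligible_Union finite_imageI negligible_finite[OF fin])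
        (auto intro!: negligible_subset[OF _ Int_lower1])
    then show "f -` N \<inter> {a..b} \<in> null_sets (lebesgue_on {a..b})"
      by (simp add: negligible_null_sets_lebesgue_on)
  qed
  \<comment> \<open>Chosen so that \<open>\<beta> = (1 + 1 / \<theta>) / 2\<close>.\<close>
  define \<eta> where "\<eta> = (1 - 1 / \<theta>) / 6"
  define \<beta> where "\<beta> = 1 / \<theta> + 3 * \<eta>"
  have eta: "\<eta> > 0" using th by (simp add: \<eta>_def)
  have \<beta>: "0 < \<beta>" "\<beta> < 1" using th by (auto simp: \<beta>_def \<eta>_def field_simps)
  \<comment> \<open>Level sets of the floor of a nondecreasing function are intervals, possibly
    empty, and \<open>V i\<close> varies by at most \<eta> on each. Finitely many indices
    \<open>k\<close> suffice because \<open>V i\<close> lies between its values at the two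
    ends.\<close>
  define piece where "piece i k = {x \<in> {c i<..<c (Suc i)}. \<lfloor>V i x / \<eta>\<rfloor> = k}" for i k
  define I where "I = (SIGMA i:{..<n}. {\<lfloor>V i (c i) / \<eta>\<rfloor>..\<lfloor>V i (c (Suc i)) / \<eta>\<rfloor>})"
  define P where "P = (\<lambda>i. {c i}) ` {..n} \<union> (\<lambda>(i,k). piece i k) ` I"
  have Vmono: "V i x \<le> V i y" if "i < n" "c i \<le> x" "x \<le> y" "y \<le> c (Suc i)" for i x y
    using V[OF that] by linarith
  have Pcases: "(\<exists>i\<le>n. A = {c i}) \<or> (\<exists>i k. i < n \<and> A = piece i k)" if "A \<in> P" for A
    using that unfolding P_def I_def by auto
  have idx: "i = j" if "x \<in> {c i<..<c (Suc i)}" "x \<in> {c j<..<c (Suc j)}" "i < n" "j < n" for x i j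
  proof (rule ccontr)
    assume "i \<noteq> j"
    then consider "Suc i \<le> j" | "Suc j \<le> i" by linarith
    then show False
    proof cases
      case 1
      then show False using cmono'[of "Suc i" j] that by auto
    next
      case 2
      then show False using cmono'[of "Suc j" i] that by auto
    qed
  qed
  have nidx: "x \<noteq> c j" if "x \<in> {c i<..<c (Suc i)}" "i < n" "j \<le> n" for x i j
  proof (cases "j \<le> i")
    case True
    then have "c j \<le> c i" using cmono'[of j i] that by auto
    then show ?thesis using that by auto
  next
    case False
    then have "c (Suc i) \<le> c j" using cmono'[of "Suc i" j] that by auto
    then show ?thesis using that by auto
  qed
  have "expanding_partition a b f \<beta> P"
  proof unfold_locales
    show "0 < \<beta>" "\<beta> < 1" by (fact \<beta>)+
    show "finite P" unfolding P_def I_def by (intro finite_UnI finite_imageI finite_SigmaI) auto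
    show "\<Union>P = {a..b}"
    proof
      show "\<Union>P \<subseteq> {a..b}"
      proof (rule Union_least)
        fix A assume "A \<in> P"
        then consider i where "i \<le> n" "A = {c i}" | i k where "i < n" "A = piece i k" using Pcases by blast
        then show "A \<subseteq> {a..b}"
        proof cases
          case 1
          then show ?thesis using cab by auto
        next
          case (2 i k)
          have "piece i k \<subseteq> {c i..c (Suc i)}" unfolding piece_def by auto
          then show ?thesis using sub[OF 2(1)] 2(2) by blast
        qed
      qed
      show "{a..b} \<subseteq> \<Union>P"
      proof
        fix x assume "x \<in> {a..b}"
        from cover[OF this] show "x \<in> \<Union>P"
        proof
          assume "x \<in> c ` {..n}"
          then show ?thesis unfolding P_def by auto
        next
          assume "\<exists>i<n. x \<in> {c i<..<c (Suc i)}"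
          then obtain i where i: "i < n" "x \<in> {c i<..<c (Suc i)}" by blast
          define k where "k = \<lfloor>V i x / \<eta>\<rfloor>"
          have "V i (c i) \<le> V i x" "V i x \<le> V i (c (Suc i))" using i by (auto intro!: Vmono)
          then have "(i, k) \<in> I" unfolding I_def k_def using i eta
            by (auto intro!: floor_mono divide_right_mono)
          then have "piece i k \<in> P" unfolding P_def by force
          moreover have "x \<in> piece i k" using i by (simp add: piece_def k_def)
          ultimately show ?thesis by blast
        qed
      qed
    qed
    show "disjoint P"
    proof (rule disjointI, rule ccontr)
      fix A B assume AB: "A \<in> P" "B \<in> P" "A \<noteq> B" "A \<inter> B \<noteq> {}"
      obtain x where x: "x \<in> A" "x \<in> B" using AB by blast
      have "A = B"
        using Pcases[OF AB(1)] Pcases[OF AB(2)]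
      proof (elim disjE exE conjE)
        fix i k j l assume "i < n" "A = piece i k" "j < n" "B = piece j l"
        then show "A = B" using x idx[of x i j] by (auto simp: piece_def)
      qed (use x nidx in \<open>auto simp: piece_def\<close>)
      then show False using AB by simp
    qed
    fix A assume "A \<in> P"
    then consider i where "i \<le> n" "A = {c i}" | i k where "i < n" "A = piece i k" using Pcases by blast
    note A = this
    from A show "is_interval A"
    proof cases
      case (2 i k)
      show ?thesis unfolding is_interval_1
      proof (intro ballI allI impI)
        fix x y z assume xyz: "x \<in> A" "y \<in> A" "x \<le> z \<and> z \<le> y"
        then have "V i x \<le> V i z" "V i z \<le> V i y" using 2 by (auto simp: piece_def intro!: Vmono)
        then have "\<lfloor>V i x / \<eta>\<rfloor> \<le> \<lfloor>V i z / \<eta>\<rfloor>" "\<lfloor>V i z / \<eta>\<rfloor> \<le> \<lfloor>V i y / \<eta>\<rfloor>"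
          using eta by (auto intro!: floor_mono divide_right_mono)
        then show "z \<in> A" using xyz 2 by (auto simp: piece_def)
      qed
    qed (simp add: is_interval_1)
    from A show "mono_on A f \<or> antimono_on A f"
    proof cases
      case (2 i k)
      have "A \<subseteq> {c i<..<c (Suc i)}" using 2 by (auto simp: piece_def)
      then show ?thesis using b2[OF 2(1)] by (meson monotone_on_subset)
    qed (auto simp: monotone_on_def)
    fix u v g S
    assume uv: "u \<le> v" "{u..v} \<subseteq> A" and g: "g \<in> im.bm"
      and S: "\<And>p q. \<lbrakk>p \<le> q; {p..q} \<subseteq> f ` {u..v}\<rbrakk> \<Longrightarrow> \<bar>im.J {p..q} g\<bar> \<le> S"
    from A show "\<bar>im.J {u..v} (\<lambda>x. g (f x))\<bar> \<le> \<beta> * S"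
    proof cases
      case (1 i)
      have uvc: "u = c i" "v = c i" using uv 1 by auto
      \<comment> \<open>The degenerate interval yields \<open>0 \<le> S\<close>, which is all that a
        single point requires.\<close>
      have "{f (c i)..f (c i)} \<subseteq> f ` {u..v}" using uvc by simp
      then have "0 \<le> S" using S[of "f (c i)" "f (c i)"] by linarith
      moreover have "im.J {u..v} (\<lambda>x. g (f x)) = 0"
        using im.J_eq_integral[of u v "\<lambda>x. g (f x)"] im.bm_comp1[OF g] cab[OF 1(1)] uvc by simp
      ultimately show ?thesis using \<beta> by simp
    next
      case (2 i k)
      interpret e: expanding_branch "c i" "c (Suc i)" \<theta> "s i" "F i" "D i" "E i" by (rule eb[OF 2(1)])
      have uvi: "{u..v} \<subseteq> {c i<..<c (Suc i)}" using uv 2 by (auto simp: piece_def)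
      then have uv3: "c i \<le> u" "v \<le> c (Suc i)" using uv(1) by (auto simp: subset_iff) 
      have uvab: "a \<le> u" "v \<le> b" using sub[OF 2(1)] uv(1) uv3 by (auto simp: subset_iff)
      \<comment> \<open>Extended by zero, since the estimate for a branch is stated for functions
        measurable and bounded on the whole line.\<close>
      define g' where "g' x = (if x \<in> {a..b} then g x else 0)" for x
      obtain B where B: "B > 0" "\<And>x. x \<in> {a..b} \<Longrightarrow> \<bar>g x\<bar> \<le> B" using im.bmE[OF g] by blast
      have g'm: "g' \<in> borel_measurable lebesgue"
        unfolding g'_def using im.bm_measurable[OF g] by (intro borel_measurable_if_I) auto
      have g'B: "\<bar>g' x\<bar> \<le> B" for x using B by (auto simp: g'_def)
      have FF: "F i ` {u..v} = f ` {u..v}" using uvi b3[OF 2(1)] by (intro image_cong) auto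
      have Fab: "F i x \<in> {a..b}" if "x \<in> {u..v}" for x using b4[OF 2(1)] uv3 that by (simp add: image_subset_iff)
      have "\<bar>integral {u..v} (\<lambda>x. g' (F i x))\<bar> \<le> (1 / \<theta> + 3 * \<eta>) * S"
      proof (rule e.integral_comp_bound[OF uv3(1) uv(1) uv3(2) g'm g'B, where V = "V i"])
        show "\<bar>D i y - D i x\<bar> \<le> V i y - V i x" if "u \<le> x" "x \<le> y" "y \<le> v" for x y
          using that uv3 by (intro V[OF 2(1)]) auto
        have "u \<in> A" "v \<in> A" using uv by auto
        then have "\<lfloor>V i u / \<eta>\<rfloor> = \<lfloor>V i v / \<eta>\<rfloor>" using 2 by (simp add: piece_def)
        then have "V i v / \<eta> - V i u / \<eta> \<le> 1" by linarith
        then show "V i v - V i u \<le> \<eta>" using eta by (simp add: diff_divide_distrib[symmetric])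
        fix p q assume pq: "p \<le> q" "{p..q} \<subseteq> F i ` {u..v}"
        have "{p..q} \<subseteq> {a..b}" using pq(2) Fab by blast
        then have pqab: "a \<le> p" "q \<le> b" using pq(1) by auto
        have "integral {p..q} g' = integral {p..q} g"
          using pqab by (intro integral_cong) (auto simp: g'_def)
        then show "\<bar>integral {p..q} g'\<bar> \<le> S"
          using S[OF pq(1)] pq(2) FF im.J_eq_integral[OF pqab g] by simp
      qed
      moreover have "im.J {u..v} (\<lambda>x. g (f x)) = integral {u..v} (\<lambda>x. g (f x))"
        by (rule im.J_eq_integral[OF uvab im.bm_comp1[OF g]])
      moreover have "integral {u..v} (\<lambda>x. g (f x)) = integral {u..v} (\<lambda>x. g' (F i x))"
        using uvi b3[OF 2(1)] Fab by (intro integral_cong) (auto simp: g'_def)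
      ultimately show ?thesis by (simp add: \<beta>_def)
    qed
  qed
  then show ?thesis by (rule that)
qed

section \<open>Compactness\<close>

lemma (in finite_measure) AE_le_of_set_integral_le:
  fixes h :: "'a \<Rightarrow> real"
  assumes h: "integrable M h" and le: "\<And>A. A \<in> sets M \<Longrightarrow> (LINT x|M. indicator A x * h x) \<le> K * measure M A"
  shows "AE x in M. h x \<le> K"
proof -
  define A where "A = {x \<in> space M. K < h x}"
  have A: "A \<in> sets M" unfolding A_def using h by measurable
  have i: "integrable M (\<lambda>x. indicator A x * h x)" "integrable M (\<lambda>x. K * indicator A x)"
    using integrable_mult_indicator[OF A h] A by (auto simp: emeasure_finite less_top[symmetric])
  then have iu: "integrable M (\<lambda>x. indicator A x * (h x - K))"
    using Bochner_Integration.integrable_diff[OF i] by (simp add: algebra_simps)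
  have "(LINT x|M. indicator A x * (h x - K)) = (LINT x|M. indicator A x * h x) - (LINT x|M. K * indicator A x)"
    using Bochner_Integration.integral_diff[OF i] by (simp add: algebra_simps)
  also have "\<dots> \<le> 0" using le[OF A] A by simp
  finally have le0: "(LINT x|M. indicator A x * (h x - K)) \<le> 0" .
  have nn: "0 \<le> indicator A x * (h x - K)" for x by (auto simp: A_def indicator_def)
  then have "(LINT x|M. indicator A x * (h x - K)) = 0"
    using le0 by (intro antisym) (auto intro!: Bochner_Integration.integral_nonneg)
  then have "AE x in M. indicator A x * (h x - K) = 0"
    using integral_nonneg_eq_0_iff_AE[OF iu] nn by simp
  then show ?thesis
    by (rule AE_mp) (auto simp: A_def indicator_def intro!: AE_I2)
qed

context bounded_interval
begin

section \<open>Set functions dominated by Lebesgue measure\<close>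

text \<open>Limits of measures, taken set by set, are clearly finitely additive. Countable
  additivity comes from the bound by \<open>K * measure M A\<close>, which forces continuity at the
  empty set; the same bound gives absolute continuity.\<close>

lemma bounded_additive_measure:
  assumes nu: "\<And>A. A \<in> sets M \<Longrightarrow> 0 \<le> \<nu> A" "\<And>A. A \<in> sets M \<Longrightarrow> \<nu> A \<le> K * measure M A"
    and add: "\<And>A B. \<lbrakk>A \<in> sets M; B \<in> sets M; A \<inter> B = {}\<rbrakk> \<Longrightarrow> \<nu> (A \<union> B) = \<nu> A + \<nu> B"
  obtains N where "sets N = sets M" "finite_measure N" "\<And>A. A \<in> sets M \<Longrightarrow> measure N A = \<nu> A" "absolutely_continuous M N"
proof -
  define N where "N = measure_of (space M) (sets M) (\<lambda>A. ennreal (\<nu> A))"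
  have sN: "sets N = sets M" unfolding N_def by (rule sets.sets_measure_of_eq)
  have zero: "\<nu> A = 0" if "A \<in> sets M" "measure M A = 0" for A
    using nu(1)[OF that(1)] nu(2)[OF that(1)] that by simp
  have pos: "positive (sets M) (\<lambda>A. ennreal (\<nu> A))" using zero[of "{}"] by (simp add: positive_def)
  have ca: "countably_additive (sets M) (\<lambda>A. ennreal (\<nu> A))"
  proof (rule sets.empty_continuous_imp_countably_additive[OF pos])
    show "additive (sets M) (\<lambda>A. ennreal (\<nu> A))"
      by (auto simp: additive_def add nu)
    fix A :: "nat \<Rightarrow> real set" assume A: "range A \<subseteq> sets M" "decseq A" "(\<Inter>i. A i) = {}"
    have "(\<lambda>i. measure M (A i)) \<longlonglongrightarrow> 0" using M.finite_Lim_measure_decseq[OF A(1,2)] A(3) by simp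
    then have "(\<lambda>i. K * measure M (A i)) \<longlonglongrightarrow> 0" by (rule tendsto_mult_right_zero)
    moreover have "\<forall>\<^sub>F i in sequentially. norm (\<nu> (A i)) \<le> K * measure M (A i)"
    proof (intro always_eventually allI)
      fix i
      have "A i \<in> sets M" using A(1) by blast
      then show "norm (\<nu> (A i)) \<le> K * measure M (A i)" using nu by simp
    qed
    ultimately have "(\<lambda>i. \<nu> (A i)) \<longlonglongrightarrow> 0" by (rule Lim_null_comparison[rotated])
    then show "(\<lambda>i. ennreal (\<nu> (A i))) \<longlonglongrightarrow> 0" using tendsto_ennrealI by fastforce
  qed auto
  have em: "emeasure N A = ennreal (\<nu> A)" if "A \<in> sets M" for A
    unfolding N_def by (rule emeasure_measure_of_sigma[OF _ pos ca that]) (rule sets.sigma_algebra_axioms)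
  have fin: "finite_measure N"
    by (rule finite_measureI) (use em[of "space M"] sN sets_eq_imp_space_eq[OF sN] in simp)
  have meas: "measure N A = \<nu> A" if "A \<in> sets M" for A
    using em[OF that] nu(1)[OF that] by (simp add: measure_def)
  have "absolutely_continuous M N"
    unfolding absolutely_continuous_def
  proof
    fix A assume "A \<in> null_sets M"
    then have "A \<in> sets M" "measure M A = 0" by (auto simp: measure_def)
    then show "A \<in> null_sets N" using zero[of A] em[of A] sN by auto
  qed
  then show ?thesis using that sN fin meas by blast
qed

text \<open>\<open>Phi1\<close> is written with this particular representative of the density, hence
  the explicit form; \<open>density_real\<close> hides the representative.\<close>

lemma RN_deriv_integral_real:
  assumes N: "sets N = sets M" "finite_measure N" "absolutely_continuous M N"
  shows "integrable M (\<lambda>x. enn2real (RN_deriv M N x))"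
    and "\<And>h. h \<in> borel_measurable M \<Longrightarrow> (LINT x|N. h x) = (LINT x|M. enn2real (RN_deriv M N x) * h x :: real)"
proof -
  define \<gamma> where "\<gamma> x = enn2real (RN_deriv M N x)" for x
  interpret N: finite_measure N by fact
  have d: "density M (RN_deriv M N) = N" by (rule M.density_RN_deriv[OF N(3) N(1)])
  have "AE x in M. RN_deriv M N x \<noteq> \<infinity>" by (rule M.RN_deriv_finite[OF N.sigma_finite_measure_axioms N(3) N(1)])
  then have "AE x in M. RN_deriv M N x = ennreal (\<gamma> x)"
    by (rule AE_mp) (auto intro!: AE_I2 simp: \<gamma>_def less_top)
  then have "density M (RN_deriv M N) = density M (\<lambda>x. ennreal (\<gamma> x))"
    by (intro density_cong) (auto simp: \<gamma>_def)
  with d have d': "density M (\<lambda>x. ennreal (\<gamma> x)) = N" by simp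
  have mg: "\<gamma> \<in> borel_measurable M" unfolding \<gamma>_def by measurable
  have pos: "0 \<le> \<gamma> x" for x by (simp add: \<gamma>_def)
  have "integral\<^sup>N M (\<lambda>x. ennreal (\<gamma> x)) = emeasure N (space M)"
    unfolding d'[symmetric] using mg by (subst emeasure_density) (auto intro!: nn_integral_cong)
  also have "\<dots> < \<infinity>"
    using N.emeasure_finite[of "space M"] top.not_eq_extremum[of "emeasure N (space M)"] by (simp only: infinity_ennreal_def)
  finally have "integrable M \<gamma>" using mg pos by (intro integrableI_nonneg) auto
  moreover have geq: "\<gamma> = (\<lambda>x. enn2real (RN_deriv M N x))" by (rule ext) (rule \<gamma>_def)
  ultimately show "integrable M (\<lambda>x. enn2real (RN_deriv M N x))" by metis
  fix h :: "real \<Rightarrow> real" assume "h \<in> borel_measurable M"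
  then have "(LINT x|N. h x) = (LINT x|M. \<gamma> x * h x)"
    unfolding d'[symmetric] using integral_density[of h M \<gamma>] mg pos by simp
  then show "(LINT x|N. h x) = (LINT x|M. enn2real (RN_deriv M N x) * h x)" unfolding geq .
qed

lemma density_real:
  assumes N: "sets N = sets M" "finite_measure N" "absolutely_continuous M N"
  obtains \<gamma> where "integrable M \<gamma>" "\<And>x. 0 \<le> \<gamma> x"
    "\<And>h. h \<in> borel_measurable M \<Longrightarrow> (LINT x|N. h x) = (LINT x|M. \<gamma> x * h x :: real)"
  by (rule that[OF RN_deriv_integral_real(1)[OF N] enn2real_nonneg RN_deriv_integral_real(2)[OF N]])

lemma bm_integrable_measure:
  assumes "sets N = sets M" "finite_measure N" "g \<in> bm"
  shows "integrable N g"
proof -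
  interpret N: finite_measure N by fact
  obtain B where B: "\<And>x. x \<in> {a..b} \<Longrightarrow> \<bar>g x\<bar> \<le> B" using bmE[OF assms(3)] by blast
  have sp: "space N = {a..b}" using sets_eq_imp_space_eq[OF assms(1)] by simp
  have "g \<in> borel_measurable N" using bm_measurable[OF assms(3)] measurable_cong_sets[OF assms(1) refl] by blast
  then show ?thesis using B sp by (intro N.integrable_const_bound[of _ B]) auto
qed

section \<open>Weak convergence against integrable functions\<close>

text \<open>By the uniform bound on the \<open>g n\<close>, the functions against which the pairing
  tends to zero form a set closed in the mean.\<close>

lemma pairing_closure:
  assumes g: "\<And>n. g n \<in> bm" "\<And>n x. x \<in> {a..b} \<Longrightarrow> \<bar>g n x\<bar> \<le> B"
    and \<gamma>: "integrable M \<gamma>"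
    and app: "\<And>\<epsilon>. \<epsilon> > 0 \<Longrightarrow> \<exists>\<gamma>'. integrable M \<gamma>' \<and> (LINT x|M. \<bar>\<gamma> x - \<gamma>' x\<bar>) \<le> \<epsilon> \<and> (\<lambda>n. LINT x|M. \<gamma>' x * g n x) \<longlonglongrightarrow> 0"
  shows "(\<lambda>n. LINT x|M. \<gamma> x * g n x :: real) \<longlonglongrightarrow> 0"
proof (rule LIMSEQ_I)
  fix r :: real assume r: "r > 0"
  have B: "0 \<le> B" using g(2)[of a 0] ab by (meson abs_ge_zero atLeastAtMost_iff order.refl order.strict_implies_order order_trans)
  define \<epsilon> where "\<epsilon> = r / (2 * (B + 1))"
  have e: "\<epsilon> > 0" "B * \<epsilon> < r / 2" using r B by (auto simp: \<epsilon>_def field_simps)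
  obtain \<gamma>' where \<gamma>': "integrable M \<gamma>'" "(LINT x|M. \<bar>\<gamma> x - \<gamma>' x\<bar>) \<le> \<epsilon>" "(\<lambda>n. LINT x|M. \<gamma>' x * g n x) \<longlonglongrightarrow> 0"
    using app[OF e(1)] by blast
  obtain n0 where n0: "\<And>n. n \<ge> n0 \<Longrightarrow> \<bar>LINT x|M. \<gamma>' x * g n x\<bar> < r / 2"
    using LIMSEQ_D[OF \<gamma>'(3), of "r/2"] r by auto
  have int: "integrable M (\<lambda>x. \<delta> x * g n x)" if "integrable M \<delta>" for \<delta> n
  proof (rule Bochner_Integration.integrable_bound[of _ "\<lambda>x. B * \<delta> x"])
    show "AE x in M. norm (\<delta> x * g n x) \<le> norm (B * \<delta> x)"
      using g(2)[of _ n] B by (auto intro!: AE_I2 mult_right_mono simp: abs_mult mult.commute[of "\<bar>\<delta> _\<bar>"])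
  qed (use that bm_measurable[OF g(1)] in auto)
  show "\<exists>n0. \<forall>n\<ge>n0. norm ((LINT x|M. \<gamma> x * g n x) - 0) < r"
  proof (intro exI allI impI)
    fix n assume n: "n \<ge> n0"
    have "(LINT x|M. \<gamma> x * g n x) - (LINT x|M. \<gamma>' x * g n x) = (LINT x|M. (\<gamma> x - \<gamma>' x) * g n x)"
      using int[OF \<gamma>] int[OF \<gamma>'(1)] by (subst Bochner_Integration.integral_diff[symmetric]) (auto simp: left_diff_distrib)
    also have "\<bar>\<dots>\<bar> \<le> (LINT x|M. B * \<bar>\<gamma> x - \<gamma>' x\<bar>)"
      using int[of "\<lambda>x. \<gamma> x - \<gamma>' x" n] \<gamma> \<gamma>'(1) g(2)[of _ n]
      by (intro integral_abs_bound_integral) (auto simp: abs_mult mult.commute[of "\<bar>\<gamma> _ - \<gamma>' _\<bar>"] intro!: mult_right_mono)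
    also have "\<dots> \<le> B * \<epsilon>" using \<gamma>'(2) B by (simp add: mult_left_mono)
    finally show "norm ((LINT x|M. \<gamma> x * g n x) - 0) < r" using n0[OF n] e(2) by simp
  qed
qed

lemma J_all: assumes "g \<in> bm" "\<And>x. x \<in> {a..b} \<Longrightarrow> x \<in> S" shows "J S g = J {a..b} g"
  unfolding J_def using assms(2) by (intro Bochner_Integration.integral_cong) (auto simp: indicator_def)

text \<open>Convergence of the primitives is convergence on half-lines, which generate the Borel
  sets and are stable under intersection. The good sets are closed under complements and, by the
  uniform bound, under countable disjoint unions, since the tail of a union has small
  measure.\<close>

lemma weakly_null_borel:
  assumes g: "\<And>n. g n \<in> bm" "\<And>n x. x \<in> {a..b} \<Longrightarrow> \<bar>g n x\<bar> \<le> B"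
    and lim: "(\<lambda>n. pn (g n)) \<longlonglongrightarrow> 0" and A: "A \<in> sets borel"
  shows "(\<lambda>n. J A (g n)) \<longlonglongrightarrow> 0"
proof -
  have bl: "S \<in> sets lebesgue" if "S \<in> sets borel" for S :: "real set" using that by simp
  have prim: "(\<lambda>n. J {a..x} (g n)) \<longlonglongrightarrow> 0" if "x \<in> {a..b}" for x
  proof (rule Lim_null_comparison[OF _ lim])
    show "\<forall>\<^sub>F n in sequentially. norm (J {a..x} (g n)) \<le> pn (g n)"
      using pn_upper[OF g(1) that] by simp
  qed
  have all: "(\<lambda>n. J UNIV (g n)) \<longlonglongrightarrow> 0" using prim[of b] ab J_all[OF g(1), of UNIV] by simp
  have sb: "sets borel = sigma_sets UNIV (range (\<lambda>x::real. {..x}))" by (subst borel_eq_atMost) simp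
  have "Int_stable (range (\<lambda>x::real. {..x}))" by (auto simp: Int_stable_def)
  moreover have "range (\<lambda>x::real. {..x}) \<subseteq> Pow UNIV" by simp
  moreover have "A \<in> sigma_sets UNIV (range (\<lambda>x::real. {..x}))" using A unfolding sb .
  ultimately show ?thesis
  proof (induction rule: sigma_sets_induct_disjoint)
    case (basic A)
    then obtain x where A: "A = {..x}" by blast
    consider "x < a" | "x \<in> {a..b}" | "x > b" by fastforce
    then show ?case
    proof cases
      case 1
      then have "J A (g n) = 0" for n unfolding J_def A by (intro integral_eq_zero_AE AE_I2) auto
      then show ?thesis by simp
    next
      case 2
      have "J A (g n) = J {a..x} (g n)" for n
        unfolding J_def A by (intro Bochner_Integration.integral_cong) (auto simp: indicator_def)
      then show ?thesis using prim[OF 2] by simp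
    next
      case 3
      then have "J A (g n) = J {a..b} (g n)" for n using A by (intro J_all g) auto
      then show ?thesis using prim[of b] ab by simp
    qed
  next
    case empty
    show ?case by (simp add: J_def)
  next
    case (compl A)
    then have Al: "A \<in> sets lebesgue" unfolding sb[symmetric] by (intro bl)
    have "J (UNIV - A) (g n) = J UNIV (g n) - J A (g n)" for n
      using J_Un[of A "UNIV - A" "g n"] Al g(1) by (simp add: sets.Diff[of UNIV])
    then show ?case using tendsto_diff[OF all compl.IH] by simp
  next
    case (union A)
    have Al: "A i \<in> sets lebesgue" for i using union(2) unfolding sb[symmetric] by (intro bl) auto
    have iI: "integrable M (indicat_real S)" if "S \<in> sets lebesgue" for S using bm_integrable[OF bm_ind[OF that]] .
    have "(\<lambda>n. LINT x|M. indicator (\<Union>i. A i) x * g n x) \<longlonglongrightarrow> 0"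
    proof (rule pairing_closure[OF g])
      show "integrable M (indicat_real (\<Union>i. A i))" using Al by (intro iI) auto
      fix \<epsilon> :: real assume e: "\<epsilon> > 0"
      define T where "T k = (\<Union>i. A i) - (\<Union>i<k. A i)" for k :: nat
      have Tl: "T k \<in> sets lebesgue" for k unfolding T_def using Al by auto
      have "(\<lambda>k. measure M ({a..b} \<inter> T k)) \<longlonglongrightarrow> measure M (\<Inter>k. {a..b} \<inter> T k)"
        using Tl by (intro M.finite_Lim_measure_decseq) (auto simp: T_def decseq_def sets_restrict_space)
      moreover have "(\<Inter>k. {a..b} \<inter> T k) = {}" unfolding T_def by auto
      ultimately have "(\<lambda>k. measure M ({a..b} \<inter> T k)) \<longlonglongrightarrow> 0" by simp
      from LIMSEQ_D[OF this e] obtain k where k: "measure M ({a..b} \<inter> T k) \<le> \<epsilon>" by (force intro: less_imp_le)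
      have 1: "(LINT x|M. \<bar>indicat_real (\<Union>i. A i) x - indicator (\<Union>i<k. A i) x\<bar>) = (LINT x|M. indicat_real (T k) x)"
        by (intro Bochner_Integration.integral_cong) (auto simp: T_def indicator_def)
      have 2: "(LINT x|M. indicat_real (T k) x) = measure M ({a..b} \<inter> T k)"
      proof -
        have "T k \<inter> space M = {a..b} \<inter> T k" by auto
        then show ?thesis using Bochner_Integration.integral_indicator[of M "T k"] by metis
      qed
      have 3: "J (\<Union>i<k. A i) (g n) = (\<Sum>i<k. J (A i) (g n))" for k n
      proof (induction k)
        case (Suc k)
        have "A i \<inter> A k = {}" if "i < k" for i
          using disjoint_family_onD[OF union(1), of i k] that by simp
        then have "(\<Union>i<k. A i) \<inter> A k = {}" by blast
        then have "J ((\<Union>i<k. A i) \<union> A k) (g n) = J (\<Union>i<k. A i) (g n) + J (A k) (g n)"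
          using Al g(1) by (intro J_Un) auto
        then show ?case using Suc by (simp add: lessThan_Suc Un_commute)
      qed (simp add: J_def)
      have "(\<lambda>n. J (\<Union>i<k. A i) (g n)) \<longlonglongrightarrow> 0"
        unfolding 3 using tendsto_sum[of "{..<k}" "\<lambda>i n. J (A i) (g n)" "\<lambda>_. 0"] union.IH by simp
      then show "\<exists>\<gamma>'. integrable M \<gamma>' \<and> (LINT x|M. \<bar>indicat_real (\<Union>i. A i) x - \<gamma>' x\<bar>) \<le> \<epsilon> \<and> (\<lambda>n. LINT x|M. \<gamma>' x * g n x) \<longlonglongrightarrow> 0"
      proof (intro exI[of _ "indicator (\<Union>i<k. A i)"] conjI)
        show "integrable M (indicat_real (\<Union>i<k. A i))" using Al by (intro iI) auto
        show "(LINT x|M. \<bar>indicat_real (\<Union>i. A i) x - indicator (\<Union>i<k. A i) x\<bar>) \<le> \<epsilon>"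
          unfolding 1 2 by (rule k)
      qed (simp add: J_def)
    qed
    then show ?case by (simp add: J_def)
  qed
qed

text \<open>On bounded sequences convergence in \<open>pn\<close> implies weak convergence. A
  Lebesgue set differs from a Borel set by a null set; linearity and closure in the mean extend the
  result from indicators to all integrable functions.\<close>

theorem weakly_null:
  assumes g: "\<And>n. g n \<in> bm" "\<And>n x. x \<in> {a..b} \<Longrightarrow> \<bar>g n x\<bar> \<le> B"
    and lim: "(\<lambda>n. pn (g n)) \<longlonglongrightarrow> 0" and \<gamma>: "integrable M (\<gamma> :: real \<Rightarrow> real)"
  shows "(\<lambda>n. LINT x|M. \<gamma> x * g n x) \<longlonglongrightarrow> 0"
  using \<gamma>
proof (induct rule: integrable_induct)
  case (base A c)
  then have "A \<in> sets lebesgue" by (simp add: sets_restrict_space_iff)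
  note Ale = this
  obtain A' N N' where "A = A' \<union> N" "N \<subseteq> N'" "N' \<in> null_sets lborel" "A' \<in> sets lborel"
    using sets_completionE[OF Ale] by metis
  then have A': "A' \<in> sets borel" "negligible N" "A = A' \<union> N"
    using negligible_subset[of N' N] by (auto simp: negligible_iff_null_sets null_sets_completionI)
  have Al: "A' \<in> sets lebesgue" using A'(1) by simp
  have Jeq: "J A (g n) = J A' (g n)" for n
    using A' Al Ale by (intro J_cong_negligible g) (auto intro: negligible_subset)
  have "(\<lambda>n. J A' (g n)) \<longlonglongrightarrow> 0"
    by (rule weakly_null_borel[OF g lim A'(1)])
  then have "(\<lambda>n. c * J A (g n)) \<longlonglongrightarrow> 0" unfolding Jeq by (rule tendsto_mult_right_zero)
  then show ?case unfolding J_def by (simp add: mult_ac)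
next
  case (add u v)
  have int: "integrable M (\<lambda>x. \<delta> x * g n x)" if "integrable M \<delta>" for \<delta> :: "real \<Rightarrow> real" and n
  proof (rule Bochner_Integration.integrable_bound[of _ "\<lambda>x. B * \<delta> x"])
    have B: "0 \<le> B" using g(2)[of a 0] ab by (meson abs_ge_zero atLeastAtMost_iff order.refl order.strict_implies_order order_trans)
    show "AE x in M. norm (\<delta> x * g n x) \<le> norm (B * \<delta> x)"
      using g(2)[of _ n] B by (auto intro!: AE_I2 mult_right_mono simp: abs_mult mult.commute[of "\<bar>\<delta> _\<bar>"])
  qed (use that bm_measurable[OF g(1)] in auto)
  have "(LINT x|M. (u x + v x) * g n x) = (LINT x|M. u x * g n x) + (LINT x|M. v x * g n x)" for n
    using int[OF add.hyps(1)] int[OF add.hyps(3)] by (simp add: distrib_right)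
  then show ?case using tendsto_add[OF add.hyps(2) add.hyps(4)] by simp
next
  case (lim u s)
  show ?case
  proof (rule pairing_closure[OF g lim.hyps(5)])
    fix \<epsilon> :: real assume e: "\<epsilon> > 0"
    have "(\<lambda>i. LINT x|M. \<bar>u x - s i x\<bar>) \<longlonglongrightarrow> (LINT x|M. 0)"
    proof (rule integral_dominated_convergence[where w="\<lambda>x. 3 * \<bar>u x\<bar>"])
      show "AE x in M. (\<lambda>i. \<bar>u x - s i x\<bar>) \<longlonglongrightarrow> 0"
      proof (rule AE_I2)
        fix x assume "x \<in> space M"
        from tendsto_diff[OF tendsto_const[of "u x"] lim.hyps(3)[OF this]]
        show "(\<lambda>i. \<bar>u x - s i x\<bar>) \<longlonglongrightarrow> 0" by (auto intro: tendsto_rabs_zero)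
      qed
      show "AE x in M. norm \<bar>u x - s i x\<bar> \<le> 3 * \<bar>u x\<bar>" for i
      proof (rule AE_I2)
        fix x assume "x \<in> space M"
        from lim.hyps(4)[OF this, of i] show "norm \<bar>u x - s i x\<bar> \<le> 3 * \<bar>u x\<bar>" by simp
      qed
    qed (use lim.hyps(1,5) in \<open>auto intro: borel_measurable_integrable\<close>)
    then obtain i where "(LINT x|M. \<bar>u x - s i x\<bar>) \<le> \<epsilon>"
      using LIMSEQ_D[of "\<lambda>i. LINT x|M. \<bar>u x - s i x\<bar>" 0 \<epsilon>] e by (force intro: less_imp_le)
    then show "\<exists>\<gamma>'. integrable M \<gamma>' \<and> (LINT x|M. \<bar>u x - \<gamma>' x\<bar>) \<le> \<epsilon> \<and> (\<lambda>n. LINT x|M. \<gamma>' x * g n x) \<longlonglongrightarrow> 0"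
      using lim.hyps(1,2) by blast
  qed
qed

corollary weakly_null_measure:
  assumes N: "sets N = sets M" "finite_measure N" "absolutely_continuous M N"
    and g: "\<And>n. g n \<in> bm" "\<And>n x. x \<in> {a..b} \<Longrightarrow> \<bar>g n x\<bar> \<le> B"
    and lim: "(\<lambda>n. pn (g n)) \<longlonglongrightarrow> 0" and u: "u \<in> bm"
  shows "(\<lambda>n. LINT x|N. u x * g n x) \<longlonglongrightarrow> 0"
proof -
  obtain \<gamma> where \<gamma>: "integrable M \<gamma>" "\<And>x. 0 \<le> \<gamma> x"
    "\<And>h. h \<in> borel_measurable M \<Longrightarrow> (LINT x|N. h x) = (LINT x|M. \<gamma> x * h x :: real)"
    using density_real[OF N] by metis
  have eq: "(LINT x|N. u x * g n x) = (LINT x|M. (u x * \<gamma> x) * g n x)" for n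
    using bm_measurable[OF bm_mult[OF u g(1)]] by (subst \<gamma>(3)) (auto simp: mult_ac)
  obtain C where C: "\<And>x. x \<in> {a..b} \<Longrightarrow> \<bar>u x\<bar> \<le> C" "C > 0" using bmE[OF u] by metis
  have "integrable M (\<lambda>x. u x * \<gamma> x)"
  proof (rule Bochner_Integration.integrable_bound[of _ "\<lambda>x. C * \<gamma> x"])
    show "AE x in M. norm (u x * \<gamma> x) \<le> norm (C * \<gamma> x)"
      using C \<gamma>(2) by (auto intro!: AE_I2 mult_right_mono simp: abs_mult)
  qed (use \<gamma>(1) bm_measurable[OF u] in auto)
  then show ?thesis unfolding eq using weakly_null[OF g lim, where \<gamma> = "\<lambda>x. u x * \<gamma> x"] by blast
qed

text \<open>Were there no such \<delta>, a sequence of counterexamples with norms at most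
  \<open>1 / Suc n\<close> would contradict \<open>weakly_null_measure\<close>.\<close>

lemma weakly_null_uniform:
  assumes N: "sets N = sets M" "finite_measure N" "absolutely_continuous M N" and A: "A \<in> sets M" and e: "\<epsilon> > 0"
  obtains \<delta> where "\<delta> > 0"
    "\<And>g. \<lbrakk>g \<in> bm; \<And>x. x \<in> {a..b} \<Longrightarrow> \<bar>g x\<bar> \<le> B; pn g \<le> \<delta>\<rbrakk> \<Longrightarrow> \<bar>LINT x|N. indicator A x * g x\<bar> \<le> \<epsilon>"
proof (rule ccontr)
  assume *: "\<not> thesis"
  have "\<exists>g. g \<in> bm \<and> (\<forall>x\<in>{a..b}. \<bar>g x\<bar> \<le> B) \<and> pn g \<le> 1 / Suc n \<and> \<not> \<bar>LINT x|N. indicator A x * g x\<bar> \<le> \<epsilon>" for n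
  proof (rule ccontr)
    assume "\<nexists>g. g \<in> bm \<and> (\<forall>x\<in>{a..b}. \<bar>g x\<bar> \<le> B) \<and> pn g \<le> 1 / Suc n \<and> \<not> \<bar>LINT x|N. indicator A x * g x\<bar> \<le> \<epsilon>"
    then have thesis by (intro that[of "1 / Suc n"]) auto
    then show False using * by blast
  qed
  then obtain g where g: "\<And>n. g n \<in> bm" "\<And>n x. x \<in> {a..b} \<Longrightarrow> \<bar>g n x\<bar> \<le> B" "\<And>n. pn (g n) \<le> 1 / Suc n"
    "\<And>n. \<not> \<bar>LINT x|N. indicator A x * g n x\<bar> \<le> \<epsilon>" by metis
  have "(\<lambda>n. pn (g n)) \<longlonglongrightarrow> 0"
  proof (rule Lim_null_comparison[OF _ LIMSEQ_inverse_real_of_nat])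
    show "\<forall>\<^sub>F n in sequentially. norm (pn (g n)) \<le> inverse (real (Suc n))"
      using g(3) pn_nonneg[OF g(1)] by (intro always_eventually allI) (simp add: inverse_eq_divide)
  qed
  from weakly_null_measure[OF N g(1,2) this bm_ind[of A]] A have "(\<lambda>n. LINT x|N. indicator A x * g n x) \<longlonglongrightarrow> 0"
    by (simp add: sets_restrict_space_iff)
  from LIMSEQ_D[OF this e] show False using g(4) by (force intro: less_imp_le)
qed

lemma absolutely_continuous_refl: "absolutely_continuous M M" by (simp add: absolutely_continuous_def)

lemma prim_lipschitz:
  assumes g: "g \<in> bm" "\<And>x. x \<in> {a..b} \<Longrightarrow> \<bar>g x\<bar> \<le> B" and xy: "x \<in> {a..b}" "y \<in> {a..b}"
  shows "\<bar>J {a..x} g - J {a..y} g\<bar> \<le> B * \<bar>x - y\<bar>"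
proof -
  have *: "\<bar>J {a..y} g - J {a..x} g\<bar> \<le> B * (y - x)" if "x \<in> {a..b}" "y \<in> {a..b}" "x \<le> y" for x y
  proof -
    have "\<bar>J {x..y} g\<bar> \<le> B * measure lebesgue ({a..b} \<inter> {x..y})" using g by (intro J_bound) auto
    also have "{a..b} \<inter> {x..y} = {x..y}" using that by auto
    finally show ?thesis using J_diff_prim[of x y g] that g(1) by simp
  qed
  show ?thesis
  proof (cases "x \<le> y")
    case True
    then show ?thesis using *[OF xy] by (simp add: abs_minus_commute)
  next
    case False
    then show ?thesis using *[OF xy(2,1)] by simp
  qed
qed

lemma bm_clip: assumes "g \<in> borel_measurable M" "0 \<le> B" shows "(\<lambda>x. max (- B) (min B (g x))) \<in> bm"
  by (rule bmI[of _ B]) (use assms in auto)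

text \<open>Weak sequential compactness of bounded sets: the primitives are equi-Lipschitz, and a uniform limit
  of them is again a primitive, the density of the limiting set function.\<close>
theorem pn_compact:
  assumes g: "\<And>n. g n \<in> bm" "\<And>n x. x \<in> {a..b} \<Longrightarrow> \<bar>g n x\<bar> \<le> B"
  obtains k h where "strict_mono (k :: nat \<Rightarrow> nat)" "h \<in> bm" "\<And>x. x \<in> {a..b} \<Longrightarrow> \<bar>h x\<bar> \<le> B"
    "(\<lambda>n. pn (\<lambda>x. g (k n) x - h x)) \<longlonglongrightarrow> 0"
proof -
  have B: "0 \<le> B" using g(2)[of a 0] ab by (meson abs_ge_zero atLeastAtMost_iff order.refl order.strict_implies_order order_trans)
  obtain G and k :: "nat \<Rightarrow> nat" where k: "strict_mono k"
    and G: "\<And>e. 0 < e \<Longrightarrow> \<exists>N. \<forall>n x. n \<ge> N \<and> x \<in> {a..b} \<longrightarrow> norm (J {a..x} (g (k n)) - G x) < e"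
  proof (rule Arzela_Ascoli[of "{a..b}" "\<lambda>n x. J {a..x} (g n)" "B * (b - a)"])
    show "norm (J {a..x} (g n)) \<le> B * (b - a)" if "x \<in> {a..b}" for n x
      using pn_upper[OF g(1) that] pn_bound[OF g(1) g(2), of n] by (metis order_trans real_norm_def)
    fix x e :: real assume x: "x \<in> {a..b}" and e: "0 < e"
    show "\<exists>d. 0 < d \<and> (\<forall>n y. y \<in> {a..b} \<and> norm (x - y) < d \<longrightarrow> norm (J {a..x} (g n) - J {a..y} (g n)) < e)"
    proof (intro exI[of _ "e / (B + 1)"] conjI allI impI)
      show "0 < e / (B + 1)" using e B by simp
      fix n :: nat and y :: real assume y: "y \<in> {a..b} \<and> norm (x - y) < e / (B + 1)"
      have "\<bar>J {a..x} (g n) - J {a..y} (g n)\<bar> \<le> B * \<bar>x - y\<bar>"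
        by (rule prim_lipschitz) (use g x y in auto)
      also have "\<dots> \<le> (B + 1) * \<bar>x - y\<bar>" by (simp add: mult_right_mono)
      also have "\<dots> < e" using y B by (simp add: field_simps)
      finally show "norm (J {a..x} (g n) - J {a..y} (g n)) < e" by simp
    qed
  qed auto
  have cau: "pn (\<lambda>x. g (k n) x - g (k m) x) \<le> 2 * e"
    if N: "\<forall>n x. n \<ge> N \<and> x \<in> {a..b} \<longrightarrow> norm (J {a..x} (g (k n)) - G x) < e" and nm: "n \<ge> N" "m \<ge> N" for n m N e
  proof (rule pn_least)
    fix x assume x: "x \<in> {a..b}"
    have "\<bar>J {a..x} (g (k n)) - G x\<bar> < e" "\<bar>J {a..x} (g (k m)) - G x\<bar> < e" using N nm x by auto
    then show "\<bar>J {a..x} (\<lambda>x. g (k n) x - g (k m) x)\<bar> \<le> 2 * e"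
      using J_diff[OF _ g(1) g(1), of "{a..x}" "k n" "k m"] by auto
  qed
  \<comment> \<open>Uniform convergence of the primitives makes the sequence Cauchy for
    \<open>pn\<close>; \<open>weakly_null_uniform\<close> transfers this to the integral over any
    measurable set.\<close>
  have conv: "convergent (\<lambda>n. J A (g (k n)))" if A: "A \<in> sets M" for A
  proof -
    have Al: "A \<in> sets lebesgue" using A by (simp add: sets_restrict_space_iff)
    have "Cauchy (\<lambda>n. J A (g (k n)))"
    proof (rule CauchyI)
      fix e :: real assume e: "0 < e"
      then have "e / 2 > 0" by simp
      from weakly_null_uniform[OF refl M.finite_measure_axioms absolutely_continuous_refl A this, of "2 * B"]
      obtain \<delta> where d: "\<delta> > 0" "\<And>g. \<lbrakk>g \<in> bm; \<And>x. x \<in> {a..b} \<Longrightarrow> \<bar>g x\<bar> \<le> 2 * B; pn g \<le> \<delta>\<rbrakk> \<Longrightarrow> \<bar>LINT x|M. indicator A x * g x\<bar> \<le> e / 2"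
        by blast
      obtain N where N: "\<forall>n x. n \<ge> N \<and> x \<in> {a..b} \<longrightarrow> norm (J {a..x} (g (k n)) - G x) < \<delta> / 2"
        using G[of "\<delta> / 2"] d(1) by auto
      show "\<exists>N. \<forall>m\<ge>N. \<forall>n\<ge>N. norm (J A (g (k m)) - J A (g (k n))) < e"
      proof (intro exI allI impI)
        fix m n assume mn: "m \<ge> N" "n \<ge> N"
        have "\<bar>LINT x|M. indicator A x * (g (k m) x - g (k n) x)\<bar> \<le> e / 2"
        proof (rule d(2))
          show "(\<lambda>x. g (k m) x - g (k n) x) \<in> bm" by (intro bm_diff g)
          show "\<bar>g (k m) x - g (k n) x\<bar> \<le> 2 * B" if "x \<in> {a..b}" for x
            using g(2)[OF that, of "k m"] g(2)[OF that, of "k n"] by linarith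
          show "pn (\<lambda>x. g (k m) x - g (k n) x) \<le> \<delta>" using cau[OF N mn] by simp
        qed
        then have "\<bar>J A (\<lambda>x. g (k m) x - g (k n) x)\<bar> \<le> e / 2" by (simp add: J_def)
        then show "norm (J A (g (k m)) - J A (g (k n))) < e" using J_diff[OF Al g(1) g(1)] e by simp
      qed
    qed
    then show ?thesis by (rule Cauchy_convergent)
  qed
  define j where "j A = lim (\<lambda>n. J A (g (k n)))" for A
  have j: "(\<lambda>n. J A (g (k n))) \<longlonglongrightarrow> j A" if "A \<in> sets M" for A
    using conv[OF that] unfolding j_def by (simp add: convergent_LIMSEQ_iff)
  have Ml: "A \<in> sets lebesgue" "measure lebesgue ({a..b} \<inter> A) = measure M A" if "A \<in> sets M" for A
  proof -
    show A: "A \<in> sets lebesgue" using that by (simp add: sets_restrict_space_iff)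
    have "A \<subseteq> {a..b}" using sets.sets_into_space[OF that] by simp
    then show "measure lebesgue ({a..b} \<inter> A) = measure M A" using measure_M[OF A] by (simp add: Int_absorb1)
  qed
  have jb: "\<bar>j A\<bar> \<le> B * measure M A" if A: "A \<in> sets M" for A
  proof -
    have "\<bar>J A (g (k n))\<bar> \<le> B * measure M A" for n using J_bound[OF Ml(1)[OF A] g(1) g(2)] Ml(2)[OF A] by simp
    then show ?thesis by (intro LIMSEQ_le_const2[OF tendsto_rabs[OF j[OF A]]]) auto
  qed
  have jU: "j (A \<union> A') = j A + j A'" if A: "A \<in> sets M" "A' \<in> sets M" "A \<inter> A' = {}" for A A'
  proof -
    have "(\<lambda>n. J (A \<union> A') (g (k n))) \<longlonglongrightarrow> j A + j A'"
      using tendsto_add[OF j[OF A(1)] j[OF A(2)]] J_Un[OF Ml(1)[OF A(1)] Ml(1)[OF A(2)] g(1) A(3)] by simp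
    then show ?thesis using j[of "A \<union> A'"] A by (auto intro: LIMSEQ_unique)
  qed
  \<comment> \<open>Adding \<open>B\<close> times Lebesgue measure makes the limiting set function
    nonnegative; \<open>B\<close> is subtracted from the density afterwards.\<close>
  define \<nu> where "\<nu> A = j A + B * measure M A" for A
  obtain N where N: "sets N = sets M" "finite_measure N" "\<And>A. A \<in> sets M \<Longrightarrow> measure N A = \<nu> A" "absolutely_continuous M N"
  proof (rule bounded_additive_measure[of \<nu> "2 * B"])
    show "0 \<le> \<nu> A" "\<nu> A \<le> 2 * B * measure M A" if "A \<in> sets M" for A
      using jb[OF that] by (auto simp: \<nu>_def)
    show "\<nu> (A \<union> A') = \<nu> A + \<nu> A'" if "A \<in> sets M" "A' \<in> sets M" "A \<inter> A' = {}" for A A'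
      using jU[OF that] M.finite_measure_Union[OF that] by (simp add: \<nu>_def algebra_simps)
  qed (rule that)
  obtain \<gamma> where \<gamma>: "integrable M \<gamma>" "\<And>x. 0 \<le> \<gamma> x"
    "\<And>h. h \<in> borel_measurable M \<Longrightarrow> (LINT x|N. h x) = (LINT x|M. \<gamma> x * h x :: real)"
    using density_real[OF N(1,2,4)] by metis
  interpret N: finite_measure N by fact
  have JN: "(LINT x|M. indicator A x * (\<gamma> x - B)) = j A" if A: "A \<in> sets M" for A
  proof -
    have "(LINT x|M. indicator A x * (\<gamma> x - B)) = (LINT x|M. indicator A x * \<gamma> x) - (LINT x|M. B * indicator A x)"
    proof -
      have "integrable M (\<lambda>x. indicator A x * \<gamma> x)" using integrable_mult_indicator[OF A \<gamma>(1)] by simp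
      moreover have "integrable M (\<lambda>x. B * indicator A x)" by (intro bm_integrable bm_cmult bm_ind Ml(1)[OF A])
      ultimately show ?thesis
        using Bochner_Integration.integral_diff[of M "\<lambda>x. indicator A x * \<gamma> x" "\<lambda>x. B * indicator A x"]
        by (simp add: algebra_simps)
    qed
    also have "(LINT x|M. indicator A x * \<gamma> x) = (LINT x|N. indicator A x)"
      using A by (subst \<gamma>(3)) (auto simp: mult.commute)
    also have "\<dots> = \<nu> A" using A N(1,3) sets.sets_into_space[OF A] sets_eq_imp_space_eq[OF N(1)] by (simp add: Int_absorb2)
    also have "(LINT x|M. B * indicator A x) = B * measure M A" using sets.sets_into_space[OF A] by (simp add: Int_absorb2)
    finally show ?thesis by (simp add: \<nu>_def)
  qed
  define u where "u x = \<gamma> x - B" for x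
  have ui: "integrable M u" unfolding u_def using \<gamma>(1) by simp
  have ub1: "AE x in M. u x \<le> B"
    using M.AE_le_of_set_integral_le[OF ui, of B] JN jb by (metis (no_types, lifting) abs_le_D1 u_def Bochner_Integration.integral_cong)
  have ub2: "AE x in M. - u x \<le> B"
  proof (rule M.AE_le_of_set_integral_le)
    show "integrable M (\<lambda>x. - u x)" using ui by simp
    fix A assume A: "A \<in> sets M"
    have "(LINT x|M. indicator A x * u x) = j A" using JN[OF A] by (simp only: u_def)
    then have "(LINT x|M. indicator A x * - u x) = - j A" by simp
    then show "(LINT x|M. indicator A x * - u x) \<le> B * measure M A" using jb[OF A] by linarith
  qed
  \<comment> \<open>The density is bounded by \<open>B\<close> only almost everywhere; clipping
    makes the bound hold at every point, as \<open>bm\<close> asks.\<close>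
  define h where "h x = max (- B) (min B (u x))" for x
  have h: "h \<in> bm" unfolding h_def using ui B by (intro bm_clip) auto
  have hu: "AE x in M. h x = u x" using ub1 ub2 by eventually_elim (auto simp: h_def)
  have Jh: "J {a..x} h = j {a..x}" if "x \<in> {a..b}" for x
  proof -
    have A: "{a..x} \<in> sets M" using that by (auto simp: sets_restrict_space_iff)
    have "J {a..x} h = (LINT y|M. indicator {a..x} y * u y)"
      unfolding J_def using hu A bm_measurable[OF h] ui by (intro integral_cong_AE) auto
    then show ?thesis using JN[OF A] by (simp add: u_def)
  qed
  have Gj: "G x = j {a..x}" if x: "x \<in> {a..b}" for x
  proof -
    have "(\<lambda>n. J {a..x} (g (k n))) \<longlonglongrightarrow> G x"
      by (rule LIMSEQ_I) (use G x in blast)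
    moreover have "{a..x} \<in> sets M" using x by (auto simp: sets_restrict_space_iff)
    ultimately show ?thesis using j LIMSEQ_unique by blast
  qed
  have "(\<lambda>n. pn (\<lambda>x. g (k n) x - h x)) \<longlonglongrightarrow> 0"
  proof (rule LIMSEQ_I)
    fix r :: real assume "0 < r"
    then obtain N where N: "\<And>n x. n \<ge> N \<and> x \<in> {a..b} \<Longrightarrow> norm (J {a..x} (g (k n)) - G x) < r / 2"
      using G[of "r / 2"] by auto
    have "pn (\<lambda>x. g (k n) x - h x) \<le> r / 2" if n: "n \<ge> N" for n
    proof (rule pn_least)
      fix x assume x: "x \<in> {a..b}"
      have "J {a..x} (\<lambda>x. g (k n) x - h x) = J {a..x} (g (k n)) - G x"
        using J_diff[OF _ g(1) h] Jh[OF x] Gj[OF x] by simp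
      then show "\<bar>J {a..x} (\<lambda>x. g (k n) x - h x)\<bar> \<le> r / 2" using N[of n x] n x by simp
    qed
    then show "\<exists>N. \<forall>n\<ge>N. norm (pn (\<lambda>x. g (k n) x - h x) - 0) < r"
      using \<open>0 < r\<close> pn_nonneg[OF bm_diff[OF g(1) h]] by (intro exI[of _ N]) fastforce
  qed
  moreover have "\<bar>h x\<bar> \<le> B" for x unfolding h_def using B by auto
  ultimately show ?thesis using that k h by blast
qed

text \<open>Total boundedness as a colouring with finitely many colours such that functions of the
  same colour are close; in this form it serves both the pigeonhole principle and the choice of
  representatives. The colour records the primitive on a grid, rounded to multiples of
  \<open>d\<close>; the Lipschitz bound covers the gaps.\<close>

lemma pn_net:
  assumes B: "B \<ge> 0" and e: "\<epsilon> > 0"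
  obtains lab :: "(real \<Rightarrow> real) \<Rightarrow> nat \<Rightarrow> int" where
    "finite (lab ` {g \<in> bm. \<forall>x\<in>{a..b}. \<bar>g x\<bar> \<le> B})"
    "\<And>g h. \<lbrakk>g \<in> bm; h \<in> bm; \<And>x. x \<in> {a..b} \<Longrightarrow> \<bar>g x\<bar> \<le> B; \<And>x. x \<in> {a..b} \<Longrightarrow> \<bar>h x\<bar> \<le> B; lab g = lab h\<rbrakk>
       \<Longrightarrow> pn (\<lambda>x. g x - h x) \<le> \<epsilon>"
proof -
  \<comment> \<open>Two Lipschitz errors and one rounding error, each at most \<open>d\<close>, stay
    below \<epsilon>.\<close>
  define d where "d = \<epsilon> / 4"
  have d: "d > 0" using e by (simp add: d_def)
  obtain m :: nat where m: "B * (b - a) / d < real m" using reals_Archimedean2 by blast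
  have "0 \<le> B * (b - a) / d" using B ab d by simp
  then have m0: "m > 0" using m by (cases m) auto
  define s where "s = (b - a) / real m"
  have s: "s > 0" "B * s \<le> d" using m0 ab m d by (auto simp: s_def field_simps)
  define t where "t i = a + real i * s" for i :: nat
  have tm: "t i \<in> {a..b}" if "i \<le> m" for i
  proof -
    have "real i * s \<le> real m * s" using that s by (intro mult_right_mono) auto
    also have "\<dots> = b - a" using m0 by (simp add: s_def)
    finally show ?thesis using s by (simp add: t_def)
  qed
  \<comment> \<open>The value 0 beyond the grid keeps the set of labels finite.\<close>
  define lab where "lab g = (\<lambda>i. if i \<le> m then \<lfloor>J {a..t i} g / d\<rfloor> else 0)" for g
  define R where "R = \<lceil>B * (b - a) / d\<rceil> + 1"
  show ?thesis
  proof (rule that)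
    have "lab ` {g \<in> bm. \<forall>x\<in>{a..b}. \<bar>g x\<bar> \<le> B} \<subseteq> {l. \<forall>i. (i \<in> {..m} \<longrightarrow> l i \<in> {-R..R}) \<and> (i \<notin> {..m} \<longrightarrow> l i = 0)}"
    proof (intro image_subsetI CollectI allI conjI impI)
      fix g i assume "g \<in> {g \<in> bm. \<forall>x\<in>{a..b}. \<bar>g x\<bar> \<le> B}" and i: "i \<in> {..m}"
      then have g: "g \<in> bm" "\<forall>x\<in>{a..b}. \<bar>g x\<bar> \<le> B" by auto
      have "\<bar>J {a..t i} g\<bar> \<le> B * (b - a)"
        using pn_upper[OF g(1) tm, of i] pn_bound[OF g(1), of B] g(2) i by auto
      then have q: "\<bar>J {a..t i} g / d\<bar> \<le> B * (b - a) / d" using d by (simp add: divide_right_mono abs_divide)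
      have "B * (b - a) / d \<le> of_int R" unfolding R_def by linarith
      then have "of_int (- R) \<le> J {a..t i} g / d" "J {a..t i} g / d \<le> of_int R" using q by linarith+
      then have "- R \<le> \<lfloor>J {a..t i} g / d\<rfloor>" "\<lfloor>J {a..t i} g / d\<rfloor> \<le> R" by linarith+
      then show "lab g i \<in> {-R..R}" using i by (simp add: lab_def)
    qed (auto simp: lab_def)
    then show "finite (lab ` {g \<in> bm. \<forall>x\<in>{a..b}. \<bar>g x\<bar> \<le> B})"
      by (rule finite_subset) (intro finite_set_of_finite_funs, auto)
    fix g h assume g: "g \<in> bm" "\<And>x. x \<in> {a..b} \<Longrightarrow> \<bar>g x\<bar> \<le> B" and h: "h \<in> bm" "\<And>x. x \<in> {a..b} \<Longrightarrow> \<bar>h x\<bar> \<le> B"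
      and eq: "lab g = lab h"
    show "pn (\<lambda>x. g x - h x) \<le> \<epsilon>"
    proof (rule pn_least)
      fix x assume x: "x \<in> {a..b}"
      define i where "i = nat \<lfloor>(x - a) / s\<rfloor>"
      have q0: "0 \<le> (x - a) / s" using x s by simp
      have i1: "real i \<le> (x - a) / s" "(x - a) / s < real i + 1" using q0 by (auto simp: i_def)
      have "(x - a) / s \<le> (b - a) / s" using x s by (simp add: divide_right_mono)
      also have "\<dots> = real m" using ab m0 by (simp add: s_def)
      finally have im: "i \<le> m" using i1(1) by linarith
      have xt: "0 \<le> x - t i" "x - t i \<le> s" using i1 s by (auto simp: t_def field_simps)
      have lip: "\<bar>J {a..x} u - J {a..t i} u\<bar> \<le> d" if u: "u \<in> bm" "\<And>x. x \<in> {a..b} \<Longrightarrow> \<bar>u x\<bar> \<le> B" for u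
      proof -
        have "\<bar>J {a..x} u - J {a..t i} u\<bar> \<le> B * \<bar>x - t i\<bar>" by (rule prim_lipschitz[OF u x tm[OF im]])
        also have "\<dots> \<le> B * s" using xt B by (intro mult_left_mono) auto
        finally show ?thesis using s by linarith
      qed
      have "\<lfloor>J {a..t i} g / d\<rfloor> = \<lfloor>J {a..t i} h / d\<rfloor>" using fun_cong[OF eq, of i] im by (simp add: lab_def)
      then have "\<bar>J {a..t i} g / d - J {a..t i} h / d\<bar> \<le> 1" by linarith
      then have "\<bar>J {a..t i} g - J {a..t i} h\<bar> / d \<le> 1" using d by (simp add: diff_divide_distrib[symmetric] abs_divide)
      then have "\<bar>J {a..t i} g - J {a..t i} h\<bar> \<le> d" using d by simp
      then have "\<bar>J {a..x} g - J {a..x} h\<bar> \<le> 3 * d" using lip[OF g] lip[OF h] by linarith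
      then show "\<bar>J {a..x} (\<lambda>x. g x - h x)\<bar> \<le> \<epsilon>" using J_diff[OF _ g(1) h(1), of "{a..x}"] d by (simp add: d_def)
    qed
  qed
qed

text \<open>Domination bounds the density by \<open>K\<close> almost everywhere; clipping makes the
  bound hold everywhere, so that the density lies in \<open>bm\<close> and \<open>pn_compact\<close>
  applies to sequences of such densities.\<close>

lemma bounded_density:
  assumes nu: "\<And>A. A \<in> sets M \<Longrightarrow> 0 \<le> \<nu> A" "\<And>A. A \<in> sets M \<Longrightarrow> \<nu> A \<le> K * measure M A" and K: "0 \<le> K"
    and add: "\<And>A B. \<lbrakk>A \<in> sets M; B \<in> sets M; A \<inter> B = {}\<rbrakk> \<Longrightarrow> \<nu> (A \<union> B) = \<nu> A + \<nu> B"
  obtains D where "D \<in> bm" "\<And>x. \<bar>D x\<bar> \<le> K" "\<And>A. A \<in> sets M \<Longrightarrow> (LINT x|M. indicator A x * D x) = \<nu> A"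
proof -
  obtain N where N: "sets N = sets M" "finite_measure N" "\<And>A. A \<in> sets M \<Longrightarrow> measure N A = \<nu> A" "absolutely_continuous M N"
  proof (rule bounded_additive_measure[of \<nu> K])
    show "0 \<le> \<nu> A" "\<nu> A \<le> K * measure M A" if "A \<in> sets M" for A using nu[OF that] by blast+
    show "\<nu> (A \<union> B) = \<nu> A + \<nu> B" if "A \<in> sets M" "B \<in> sets M" "A \<inter> B = {}" for A B by (rule add[OF that])
  qed (rule that)
  obtain \<gamma> where \<gamma>: "integrable M \<gamma>" "\<And>x. 0 \<le> \<gamma> x"
    "\<And>h. h \<in> borel_measurable M \<Longrightarrow> (LINT x|N. h x) = (LINT x|M. \<gamma> x * h x :: real)"
    using density_real[OF N(1,2,4)] by metis
  have JN: "(LINT x|M. indicator A x * \<gamma> x) = \<nu> A" if A: "A \<in> sets M" for A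
  proof -
    have "(LINT x|M. indicator A x * \<gamma> x) = (LINT x|N. indicator A x)"
      using A by (subst \<gamma>(3)) (auto simp: mult.commute)
    also have "\<dots> = \<nu> A" using A N(1,3) sets.sets_into_space[OF A] sets_eq_imp_space_eq[OF N(1)] by (simp add: Int_absorb2)
    finally show ?thesis .
  qed
  have ub: "AE x in M. \<gamma> x \<le> K"
    using JN nu(2) by (intro M.AE_le_of_set_integral_le \<gamma>) auto
  define D where "D x = max (- K) (min K (\<gamma> x))" for x
  have "D x = \<gamma> x" if "\<gamma> x \<le> K" for x using \<gamma>(2)[of x] K that by (simp add: D_def)
  then have Dg: "AE x in M. D x = \<gamma> x" using ub by (auto elim!: AE_mp)
  have Db: "D \<in> bm" unfolding D_def using \<gamma>(1) K by (intro bm_clip) auto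
  have "(LINT x|M. indicator A x * D x) = \<nu> A" if A: "A \<in> sets M" for A
  proof -
    have "(LINT x|M. indicator A x * D x) = (LINT x|M. indicator A x * \<gamma> x)"
      using Dg A bm_measurable[OF Db] \<gamma>(1) by (intro integral_cong_AE) auto
    then show ?thesis using JN[OF A] by simp
  qed
  moreover have "\<bar>D x\<bar> \<le> K" for x using K by (auto simp: D_def)
  ultimately show ?thesis using that Db by blast
qed

lemma continuous_on_bm: assumes "continuous_on {a..b} (g :: real \<Rightarrow> real)" shows "g \<in> bm"
proof -
  have "bounded (g ` {a..b})" using assms by (intro compact_imp_bounded compact_continuous_image) auto
  then obtain B where "\<And>x. x \<in> {a..b} \<Longrightarrow> \<bar>g x\<bar> \<le> B" unfolding bounded_iff by (metis imageI real_norm_def)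
  moreover have "g \<in> borel_measurable M" using assms by (intro continuous_imp_measurable_on_sets_lebesgue) auto
  ultimately show ?thesis by (rule bmI[rotated])
qed

end

text \<open>These are the test functions inserted into the hypothesis on \<open>Phi1\<close>. On
  [a,b] the indicator is nonincreasing, so every variation sum telescopes to at most 1.\<close>

lemma indicator_Icc_BV:
  "(\<lambda>x. complex_of_real (indicator {a..t} x)) \<in> BV a b"
  unfolding BV_def has_bounded_variation_on_interval_def mem_Collect_eq
proof (intro exI[of _ 1] allI impI)
  fix n :: nat and s :: "nat \<Rightarrow> real"
  assume s: "(\<forall>i\<le>n. s i \<in> {a..b}) \<and> (\<forall>i<n. s i \<le> s (Suc i))"
  let ?g = "\<lambda>x. indicat_real {a..t} x"
  have "(\<Sum>i<n. norm (complex_of_real (?g (s (Suc i))) - complex_of_real (?g (s i)))) = (\<Sum>i<n. ?g (s i) - ?g (s (Suc i)))"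
  proof (rule sum.cong[OF refl])
    fix i assume i: "i \<in> {..<n}"
    have "a \<le> s i" "s i \<le> s (Suc i)" using s i by auto
    then have "?g (s (Suc i)) \<le> ?g (s i)" by (auto simp: indicator_def)
    then show "norm (complex_of_real (?g (s (Suc i))) - complex_of_real (?g (s i))) = ?g (s i) - ?g (s (Suc i))"
      unfolding of_real_diff[symmetric] norm_of_real by simp
  qed
  also have "\<dots> = ?g (s 0) - ?g (s n)" by (rule sum_lessThan_telescope')
  also have "\<dots> \<le> 1" by (simp add: indicator_def)
  finally show "(\<Sum>i<n. norm (complex_of_real (?g (s (Suc i))) - complex_of_real (?g (s i)))) \<le> 1" .
qed

text \<open>The terms decay exponentially while being Lipschitz with a common constant; cutting the series at
  the index where the two bounds cross produces the logarithm.\<close>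
lemma log_Lipschitz_on_suminf:
  fixes T :: "real \<Rightarrow> nat \<Rightarrow> complex"
  assumes \<rho>: "0 < \<rho>" "\<rho> < 1" and c: "0 \<le> c" and L: "0 \<le> L"
    and decay: "\<And>k x. x \<in> S \<Longrightarrow> norm (T x k) \<le> c * \<rho> ^ k"
    and lip: "\<And>k x y. \<lbrakk>x \<in> S; y \<in> S\<rbrakk> \<Longrightarrow> norm (T x k - T y k) \<le> L * \<bar>x - y\<bar>"
  shows "\<And>x. x \<in> S \<Longrightarrow> summable (T x)" and "log_Lipschitz_on S (\<lambda>x. \<Sum>k. T x k)"
proof -
  have geo: "summable (\<lambda>k. c * \<rho> ^ k)" using \<rho> by (intro summable_mult summable_geometric) auto
  show sumT: "summable (T x)" if "x \<in> S" for x
    by (rule summable_comparison_test'[OF geo, of 0]) (use decay[OF that] in auto)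
  define l where "l = - ln \<rho>"
  have l: "l > 0" using \<rho> by (simp add: l_def)
  define K where "K = L / l + L + 2 * c / (1 - \<rho>) + 1"
  have c1: "0 \<le> 2 * c / (1 - \<rho>)" "0 \<le> L / l" using c \<rho> L l by auto
  have K: "K > 0" using c1 L by (simp add: K_def)
  show "log_Lipschitz_on S (\<lambda>x. \<Sum>k. T x k)"
    unfolding log_Lipschitz_on_def
  proof (intro exI[of _ K] conjI K ballI impI)
    fix x y assume x: "x \<in> S" and y: "y \<in> S" and ne: "x \<noteq> y"
    define r where "r = \<bar>x - y\<bar>"
    have r: "r > 0" using ne by (simp add: r_def)
    \<comment> \<open>With this cut \<open>\<rho> ^ n \<le> r\<close>, so the tail is at most a
      multiple of \<open>r\<close>, while the \<open>n\<close> initial terms contribute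
      \<open>n * L * r\<close>, the logarithmic part. The absolute value of the logarithm also
      covers \<open>r > 1\<close>.\<close>
    define n where "n = nat \<lceil>\<bar>ln r\<bar> / l\<rceil>"
    have q: "0 \<le> \<bar>ln r\<bar> / l" using l by simp
    have n1: "real n \<le> \<bar>ln r\<bar> / l + 1" and n2: "\<bar>ln r\<bar> / l \<le> real n" using q unfolding n_def by linarith+
    have "\<rho> ^ n = exp (real n * ln \<rho>)" using \<rho> by (simp add: exp_of_nat_mult)
    also have "\<dots> \<le> exp (ln r)"
    proof -
      have "\<bar>ln r\<bar> \<le> real n * l" using n2 l by (simp add: field_simps)
      then show ?thesis by (simp add: l_def abs_le_iff)
    qed
    finally have rn: "\<rho> ^ n \<le> r" using r by simp
    let ?D = "\<lambda>k. T x k - T y k"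
    have sD: "summable ?D" by (intro summable_diff sumT x y)
    have D: "norm (?D k) \<le> 2 * c * \<rho> ^ k" for k
      using norm_triangle_ineq4[of "T x k" "T y k"] decay[OF x, of k] decay[OF y, of k] by linarith
    have "(\<Sum>k. T x k) - (\<Sum>k. T y k) = (\<Sum>k. ?D k)" by (rule suminf_diff[OF sumT[OF x] sumT[OF y]])
    also have "\<dots> = (\<Sum>k. ?D (k + n)) + (\<Sum>k<n. ?D k)" by (rule suminf_split_initial_segment[OF sD])
    finally have "norm ((\<Sum>k. T x k) - (\<Sum>k. T y k)) \<le> norm (\<Sum>k. ?D (k + n)) + norm (\<Sum>k<n. ?D k)"
      by (simp add: norm_triangle_ineq)
    also have "\<dots> \<le> 2 * c * r / (1 - \<rho>) + (\<bar>ln r\<bar> / l + 1) * (L * r)"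
    proof (rule add_mono)
      have "norm (\<Sum>k. ?D (k + n)) \<le> (\<Sum>k. 2 * c * \<rho> ^ n * \<rho> ^ k)"
      proof (rule norm_suminf_le)
        show "summable (\<lambda>k. 2 * c * \<rho> ^ n * \<rho> ^ k)" using \<rho> by (intro summable_mult summable_geometric) auto
        show "norm (?D (k + n)) \<le> 2 * c * \<rho> ^ n * \<rho> ^ k" for k using D[of "k + n"] by (simp add: power_add mult_ac)
      qed
      also have "\<dots> = 2 * c * \<rho> ^ n * (1 / (1 - \<rho>))"
        using \<rho> by (subst suminf_mult) (auto simp: suminf_geometric)
      also have "\<dots> = 2 * c * \<rho> ^ n / (1 - \<rho>)" by simp
      also have "\<dots> \<le> 2 * c * r / (1 - \<rho>)"
        using rn c \<rho> by (intro divide_right_mono mult_left_mono) auto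
      finally show "norm (\<Sum>k. ?D (k + n)) \<le> 2 * c * r / (1 - \<rho>)" .
      have "norm (\<Sum>k<n. ?D k) \<le> (\<Sum>k<n. L * r)"
        unfolding r_def by (rule order_trans[OF norm_sum]) (intro sum_mono lip x y)
      also have "\<dots> = real n * (L * r)" by simp
      also have "\<dots> \<le> (\<bar>ln r\<bar> / l + 1) * (L * r)" using n1 L r by (intro mult_right_mono) auto
      finally show "norm (\<Sum>k<n. ?D k) \<le> (\<bar>ln r\<bar> / l + 1) * (L * r)" .
    qed
    also have "\<dots> = r * (2 * c / (1 - \<rho>) + L + (L / l) * \<bar>ln r\<bar>)" by (simp add: algebra_simps)
    also have "\<dots> \<le> r * (K * (1 + \<bar>ln r\<bar>))"
    proof (rule mult_left_mono)
      have "2 * c / (1 - \<rho>) + L \<le> K" "L / l \<le> K" using c1 L by (auto simp: K_def)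
      moreover have "(L / l) * \<bar>ln r\<bar> \<le> K * \<bar>ln r\<bar>" using calculation(2) by (intro mult_right_mono) auto
      ultimately show "2 * c / (1 - \<rho>) + L + (L / l) * \<bar>ln r\<bar> \<le> K * (1 + \<bar>ln r\<bar>)" by (simp add: algebra_simps)
    qed (use r in auto)
    finally show "norm ((\<Sum>k. T x k) - (\<Sum>k. T y k)) \<le> K * \<bar>x - y\<bar> * (1 + \<bar>ln \<bar>x - y\<bar>\<bar>)"
      unfolding r_def[symmetric] by (simp add: mult_ac)
  qed
qed

section \<open>Invariant measures and recurrence\<close>

text \<open>From here on the map enters only through measurability, nonsingularity and the
  splitting; branches and cylinders are forgotten. That \<open>C\<close> does not depend on
  \<open>n\<close> is essential, as limits along the iterates are taken.\<close>

locale dual_LY = interval_map +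
  fixes C :: real and e :: "nat \<Rightarrow> real"
  assumes C0: "C > 0" and e0: "e \<longlonglongrightarrow> 0"
    and LY: "g \<in> bm \<Longrightarrow> \<exists>h1\<in>bm. \<exists>h2\<in>bm. (\<forall>x. g ((f ^^ n) x) = h1 x + h2 x) \<and>
       pn h1 \<le> e n * pn g \<and> (\<forall>x\<in>{a..b}. \<bar>h2 x\<bar> \<le> C * pn g)"
begin

lemma LYE:
  assumes "g \<in> bm"
  obtains h1 h2 where "\<And>n. h1 n \<in> bm" "\<And>n. h2 n \<in> bm" "\<And>n x. g ((f ^^ n) x) = h1 n x + h2 n x"
    "\<And>n. pn (h1 n) \<le> e n * pn g" "\<And>n x. x \<in> {a..b} \<Longrightarrow> \<bar>h2 n x\<bar> \<le> C * pn g"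
  using LY[OF assms] by metis

text \<open>\<open>e\<close> is bounded because it converges, and the sup bound on \<open>h2\<close>
  gives \<open>C * pn g * (b - a)\<close> for its primitive. The summand 1 makes the constant at
  least 1.\<close>

lemma power_bound: "\<exists>K\<ge>1. \<forall>n. \<forall>g\<in>bm. pn (\<lambda>x. g ((f ^^ n) x)) \<le> K * pn g"
proof -
  have "Bseq e" using e0 by (rule Bseq_cmult_iff[THEN iffD1, OF _ ] convergent_imp_Bseq[OF convergentI])+
  then obtain E where E: "E > 0" "\<And>n. \<bar>e n\<bar> \<le> E" by (auto simp: Bseq_def)
  show ?thesis
  proof (intro exI[of _ "E + C * (b - a) + 1"] conjI allI ballI)
    have "0 \<le> C * (b - a)" using C0 ab by simp
    then show "1 \<le> E + C * (b - a) + 1" using E(1) by linarith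
    fix n g assume g: "g \<in> bm"
    obtain h1 h2 where h: "h1 \<in> bm" "h2 \<in> bm" "\<And>x. g ((f ^^ n) x) = h1 x + h2 x"
      "pn h1 \<le> e n * pn g" "\<And>x. x \<in> {a..b} \<Longrightarrow> \<bar>h2 x\<bar> \<le> C * pn g" using LY[OF g, of n] by blast
    have "pn (\<lambda>x. g ((f ^^ n) x)) \<le> pn h1 + pn h2" unfolding h(3) by (rule pn_add[OF h(1,2)])
    moreover have "pn h2 \<le> C * pn g * (b - a)" by (rule pn_bound[OF h(2,5)])
    moreover have "e n * pn g \<le> E * pn g" using E(2)[of n] pn_nonneg[OF g] by (intro mult_right_mono) auto
    ultimately show "pn (\<lambda>x. g ((f ^^ n) x)) \<le> (E + C * (b - a) + 1) * pn g"
      using h(4) pn_nonneg[OF g] by (simp add: algebra_simps)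
  qed
qed

section \<open>Invariant measures and recurrent functions\<close>

text \<open>Finite measures rather than probabilities: the limit of the averaged push-forwards keeps
  the total mass of Lebesgue measure.\<close>

definition invariant :: "real measure \<Rightarrow> bool" where
  "invariant N \<longleftrightarrow> sets N = sets M \<and> finite_measure N \<and> absolutely_continuous M N \<and> distr N N f = N"

lemma invariantD:
  assumes "invariant N"
  shows "sets N = sets M" "finite_measure N" "absolutely_continuous M N" "distr N N f = N" "space N = {a..b}"
  using assms sets_eq_imp_space_eq[of N M] by (auto simp: invariant_def)

lemma invariant_measurable:
  assumes "invariant N" "g \<in> borel_measurable M" shows "g \<in> borel_measurable N"
  using assms(2) measurable_cong_sets[OF invariantD(1)[OF assms(1)] refl] by blast

lemma invariant_integrable: "\<lbrakk>invariant N; g \<in> bm\<rbrakk> \<Longrightarrow> integrable N g"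
  using bm_integrable_measure invariantD by blast

lemma invariant_integral1:
  assumes N: "invariant N" and g: "g \<in> borel_measurable M"
  shows "(LINT x|N. g (f x)) = (LINT x|N. g x :: real)"
proof -
  note s = invariantD(1)[OF N]
  have fm: "f \<in> N \<rightarrow>\<^sub>M N" using f_meas measurable_cong_sets[OF s s] by blast
  have "(LINT x|N. g x) = (LINT x|distr N N f. g x)" using invariantD(4)[OF N] by simp
  also have "\<dots> = (LINT x|N. g (f x))"
    by (rule integral_distr[OF fm invariant_measurable[OF N g]])
  finally show ?thesis ..
qed

lemma invariant_integral:
  assumes N: "invariant N" and g: "g \<in> bm"
  shows "(LINT x|N. g ((f ^^ n) x)) = (LINT x|N. g x)"
proof (induction n)
  case (Suc n)
  have "(LINT x|N. g ((f ^^ Suc n) x)) = (LINT x|N. g ((f ^^ n) (f x)))"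
    by (simp add: funpow_Suc_right del: funpow.simps)
  also have "\<dots> = (LINT x|N. g ((f ^^ n) x))"
    by (rule invariant_integral1[OF N bm_measurable[OF bm_comp[OF g]]])
  finally show ?case using Suc by simp
qed simp

lemma AE_comp_invariant:
  assumes N: "invariant N" and Q: "AE x in N. Q x"
  shows "AE x in N. Q ((f ^^ n) x)"
  using Q
proof (induction n arbitrary: Q)
  case (Suc n)
  note s = invariantD(1)[OF N]
  have fm: "f \<in> N \<rightarrow>\<^sub>M N" using f_meas measurable_cong_sets[OF s s] by blast
  have "AE x in distr N N f. Q ((f ^^ n) x)"
    unfolding invariantD(4)[OF N] by (rule Suc.IH[OF Suc.prems])
  then have "AE x in N. Q ((f ^^ n) (f x))"
    using AE_distrD[OF fm] by blast
  then show ?case by (simp add: funpow_Suc_right del: funpow.simps)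
qed simp

text \<open>Return in the mean with respect to \<open>N\<close> along the times \<open>d k\<close>;
  that these tend to infinity is a separate hypothesis where it matters.\<close>

definition recurrent :: "real measure \<Rightarrow> (nat \<Rightarrow> nat) \<Rightarrow> (real \<Rightarrow> real) \<Rightarrow> bool" where
  "recurrent N d g \<longleftrightarrow> (\<lambda>k. LINT x|N. \<bar>g ((f ^^ d k) x) - g x\<bar>) \<longlonglongrightarrow> 0"

text \<open>Recurrence replaces \<open>g\<close> by \<open>g \<circ> f ^^ d k\<close>, which splits
  as \<open>h1 + h2\<close>. Over any set the integral of \<open>h1\<close> tends to zero, and
  \<open>h2\<close> is at most \<open>C * pn g\<close>. So on recurrent functions the weak norm
  dominates the essential supremum, the reverse of the usual order.\<close>

lemma recurrent_le_pn1:
  assumes N: "invariant N" and g: "g \<in> bm" and d: "filterlim d at_top sequentially" and r: "recurrent N d g"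
  shows "AE x in N. g x \<le> C * pn g"
proof -
  interpret N: finite_measure N by (rule invariantD(2)[OF N])
  note s = invariantD(1)[OF N] and sp = invariantD(5)[OF N]
  note int = invariant_integrable[OF N]
  obtain h1 h2 where h: "\<And>n. h1 n \<in> bm" "\<And>n. h2 n \<in> bm" "\<And>n x. g ((f ^^ n) x) = h1 n x + h2 n x"
    "\<And>n. pn (h1 n) \<le> e n * pn g" "\<And>n x. x \<in> {a..b} \<Longrightarrow> \<bar>h2 n x\<bar> \<le> C * pn g" using LYE[OF g] by metis
  obtain B where B: "B > 0" "\<And>x. x \<in> {a..b} \<Longrightarrow> \<bar>g x\<bar> \<le> B" using bmE[OF g] by blast
  have h1B: "\<bar>h1 n x\<bar> \<le> B + C * pn g" if x: "x \<in> {a..b}" for n x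
    using h(3)[of n x] h(5)[OF x, of n] B(2)[OF fn_in[OF x, of n]] by linarith
  have pl: "(\<lambda>k. pn (h1 (d k))) \<longlonglongrightarrow> 0"
  proof (rule Lim_null_comparison)
    show "\<forall>\<^sub>F k in sequentially. norm (pn (h1 (d k))) \<le> e (d k) * pn g"
      using h(4) pn_nonneg[OF h(1)] by (intro always_eventually allI) simp
    have "(\<lambda>k. e (d k)) \<longlonglongrightarrow> 0" by (rule filterlim_compose[OF e0 d])
    then show "(\<lambda>k. e (d k) * pn g) \<longlonglongrightarrow> 0" by (rule tendsto_mult_left_zero)
  qed
  show ?thesis
  proof (rule N.AE_le_of_set_integral_le[OF int[OF g]])
    fix A assume "A \<in> sets N"
    then have A: "A \<in> sets M" and Al: "A \<in> sets lebesgue" using s by (auto simp: sets_restrict_space_iff)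
    have i: "indicat_real A \<in> bm" by (rule bm_ind[OF Al])
    let ?R = "\<lambda>k. (LINT x|N. indicator A x * h1 (d k) x) + C * pn g * measure N A + (LINT x|N. \<bar>g ((f ^^ d k) x) - g x\<bar>)"
    have wl: "(\<lambda>k. LINT x|N. indicator A x * h1 (d k) x) \<longlonglongrightarrow> 0"
      by (rule weakly_null_measure[OF invariantD(1-3)[OF N] h(1) h1B pl i])
    have "?R \<longlonglongrightarrow> 0 + C * pn g * measure N A + 0"
      by (intro tendsto_add tendsto_const wl r[unfolded recurrent_def])
    moreover have "(LINT x|N. indicator A x * g x) \<le> ?R k" for k
    proof -
      have ia: "integrable N (\<lambda>x. indicator A x * h1 (d k) x)" by (intro int bm_mult i h)
      have ib: "integrable N (\<lambda>x. C * pn g * indicator A x)" by (intro int bm_cmult i)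
      have ic: "integrable N (\<lambda>x. \<bar>g ((f ^^ d k) x) - g x\<bar>)" by (intro int bm_abs bm_diff bm_comp g)
      have "(LINT x|N. indicator A x * g x) \<le> (LINT x|N. (indicator A x * h1 (d k) x + C * pn g * indicator A x) + \<bar>g ((f ^^ d k) x) - g x\<bar>)"
      proof (rule integral_mono)
        show "integrable N (\<lambda>x. indicator A x * g x)" by (intro int bm_mult i g)
        show "integrable N (\<lambda>x. (indicator A x * h1 (d k) x + C * pn g * indicator A x) + \<bar>g ((f ^^ d k) x) - g x\<bar>)"
          by (intro Bochner_Integration.integrable_add ia ib ic)
        fix x assume "x \<in> space N"
        then have "\<bar>h2 (d k) x\<bar> \<le> C * pn g" using sp h(5) by simp
        then show "indicator A x * g x \<le> (indicator A x * h1 (d k) x + C * pn g * indicator A x) + \<bar>g ((f ^^ d k) x) - g x\<bar>"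
          using h(3)[of "d k" x] by (auto simp: indicator_def)
      qed
      also have "\<dots> = ?R k"
        using ia ib ic A s sets.sets_into_space[OF A]
        by (simp add: Bochner_Integration.integral_add sp Int_absorb2)
      finally show ?thesis .
    qed
    ultimately show "(LINT x|N. indicator A x * g x) \<le> C * pn g * measure N A"
      using LIMSEQ_le_const by fastforce
  qed
qed

lemma recurrent_cmult:
  assumes "recurrent N d g" shows "recurrent N d (\<lambda>x. k * g x)"
proof -
  have "\<bar>k * u - k * v\<bar> = \<bar>k\<bar> * \<bar>u - v\<bar>" for u v :: real
    by (simp add: abs_mult[symmetric] right_diff_distrib)
  then have "(LINT x|N. \<bar>k * g ((f ^^ d i) x) - k * g x\<bar>) = \<bar>k\<bar> * (LINT x|N. \<bar>g ((f ^^ d i) x) - g x\<bar>)" for i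
    by simp
  then show ?thesis using assms unfolding recurrent_def by (simp add: tendsto_mult_right_zero)
qed

lemma recurrent_le_pn:
  assumes N: "invariant N" and g: "g \<in> bm" and d: "filterlim d at_top sequentially" and r: "recurrent N d g"
  shows "AE x in N. \<bar>g x\<bar> \<le> C * pn g"
proof -
  have 1: "AE x in N. - 1 * g x \<le> C * pn (\<lambda>x. - 1 * g x)"
    by (rule recurrent_le_pn1[OF N bm_cmult[OF g] d recurrent_cmult[OF r]])
  have "pn (\<lambda>x. - 1 * g x) \<le> pn g" using pn_cmult[OF g, of "-1"] by simp
  then have 2: "C * pn (\<lambda>x. - 1 * g x) \<le> C * pn g" using C0 by simp
  show ?thesis using 1 recurrent_le_pn1[OF assms] by eventually_elim (use 2 in linarith)
qed

text \<open>The same splitting with invariance of the integral in place of recurrence. Applied to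
  indicators it shows that invariant probabilities have densities bounded by
  \<open>C\<close>.\<close>

lemma invariant_le_pn:
  assumes N: "invariant N" and p: "measure N {a..b} = 1" and g: "g \<in> bm"
  shows "\<bar>LINT x|N. g x\<bar> \<le> C * pn g"
proof -
  interpret N: finite_measure N by (rule invariantD(2)[OF N])
  note int = invariant_integrable[OF N]
  obtain h1 h2 where h: "\<And>n. h1 n \<in> bm" "\<And>n. h2 n \<in> bm" "\<And>n x. g ((f ^^ n) x) = h1 n x + h2 n x"
    "\<And>n. pn (h1 n) \<le> e n * pn g" "\<And>n x. x \<in> {a..b} \<Longrightarrow> \<bar>h2 n x\<bar> \<le> C * pn g" using LYE[OF g] by metis
  obtain B where B: "B > 0" "\<And>x. x \<in> {a..b} \<Longrightarrow> \<bar>g x\<bar> \<le> B" using bmE[OF g] by blast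
  have h1B: "\<bar>h1 n x\<bar> \<le> B + C * pn g" if x: "x \<in> {a..b}" for n x
    using h(3)[of n x] h(5)[OF x, of n] B(2)[OF fn_in[OF x, of n]] by linarith
  have pl: "(\<lambda>k. pn (h1 k)) \<longlonglongrightarrow> 0"
  proof (rule Lim_null_comparison)
    show "\<forall>\<^sub>F k in sequentially. norm (pn (h1 k)) \<le> e k * pn g"
      using h(4) pn_nonneg[OF h(1)] by (intro always_eventually allI) simp
    show "(\<lambda>k. e k * pn g) \<longlonglongrightarrow> 0" by (rule tendsto_mult_left_zero[OF e0])
  qed
  have "(\<lambda>n. LINT x|N. 1 * h1 n x) \<longlonglongrightarrow> 0"
    by (rule weakly_null_measure[OF invariantD(1-3)[OF N] h(1) h1B pl bm_const])
  then have "(\<lambda>n. \<bar>LINT x|N. h1 n x\<bar> + C * pn g) \<longlonglongrightarrow> 0 + C * pn g"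
    by (intro tendsto_add tendsto_rabs_zero) auto
  moreover have "\<bar>LINT x|N. g x\<bar> \<le> \<bar>LINT x|N. h1 n x\<bar> + C * pn g" for n
  proof -
    have "(LINT x|N. g x) = (LINT x|N. h1 n x) + (LINT x|N. h2 n x)"
      using invariant_integral[OF N g, of n] int[OF h(1), of n] int[OF h(2), of n] by (simp add: h(3))
    moreover have "\<bar>LINT x|N. h2 n x\<bar> \<le> (LINT x|N. C * pn g)"
      using h(5) invariantD(5)[OF N] by (intro integral_abs_bound_integral int h bm_const) auto
    moreover have "(LINT x|N. C * pn g) = C * pn g" using p invariantD(5)[OF N] by simp
    ultimately show ?thesis by linarith
  qed
  ultimately show ?thesis using LIMSEQ_le_const by fastforce
qed

text \<open>Iterates commute and \<open>N\<close> is invariant, so the integrals in the definition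
  of recurrence do not change.\<close>

lemma recurrent_comp:
  assumes N: "invariant N" and g: "g \<in> bm" and r: "recurrent N d g"
  shows "recurrent N d (\<lambda>x. g ((f ^^ i) x))"
proof -
  have "(LINT x|N. \<bar>g ((f ^^ i) ((f ^^ d k) x)) - g ((f ^^ i) x)\<bar>) = (LINT x|N. \<bar>g ((f ^^ d k) x) - g x\<bar>)" for k
  proof -
    have "(f ^^ i) ((f ^^ d k) x) = (f ^^ d k) ((f ^^ i) x)" for x
      by (metis add.commute comp_apply funpow_add)
    then show ?thesis
      using invariant_integral[OF N bm_abs[OF bm_diff[OF bm_comp[OF g, of "d k"] g]], of i] by simp
  qed
  then show ?thesis using r by (simp add: recurrent_def)
qed

lemma recurrent_diff:
  assumes N: "invariant N" and g: "g \<in> bm" "h \<in> bm" and r: "recurrent N d g" "recurrent N d h"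
  shows "recurrent N d (\<lambda>x. g x - h x)"
  unfolding recurrent_def
proof (rule Lim_null_comparison)
  note int = invariant_integrable[OF N]
  show "(\<lambda>k. (LINT x|N. \<bar>g ((f ^^ d k) x) - g x\<bar>) + (LINT x|N. \<bar>h ((f ^^ d k) x) - h x\<bar>)) \<longlonglongrightarrow> 0"
    using tendsto_add[OF r[unfolded recurrent_def]] by simp
  have le: "(LINT x|N. \<bar>g ((f ^^ d k) x) - h ((f ^^ d k) x) - (g x - h x)\<bar>)
      \<le> (LINT x|N. \<bar>g ((f ^^ d k) x) - g x\<bar> + \<bar>h ((f ^^ d k) x) - h x\<bar>)" for k
    by (intro integral_mono int bm_abs bm_add bm_diff bm_comp g) linarith
  have "\<bar>LINT x|N. \<bar>g ((f ^^ d k) x) - h ((f ^^ d k) x) - (g x - h x)\<bar>\<bar>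
      \<le> (LINT x|N. \<bar>g ((f ^^ d k) x) - g x\<bar>) + (LINT x|N. \<bar>h ((f ^^ d k) x) - h x\<bar>)" for k
    using le[of k] Bochner_Integration.integral_add[OF int[OF bm_abs[OF bm_diff[OF bm_comp[OF g(1), of "d k"] g(1)]]]
        int[OF bm_abs[OF bm_diff[OF bm_comp[OF g(2), of "d k"] g(2)]]]]
    by (simp add: Bochner_Integration.integral_nonneg)
  then show "\<forall>\<^sub>F k in sequentially. norm (LINT x|N. \<bar>g ((f ^^ d k) x) - h ((f ^^ d k) x) - (g x - h x)\<bar>)
      \<le> (LINT x|N. \<bar>g ((f ^^ d k) x) - g x\<bar>) + (LINT x|N. \<bar>h ((f ^^ d k) x) - h x\<bar>)" by simp
qed

lemma recurrent_lipschitz: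
  assumes N: "invariant N" and g: "g \<in> bm" "(\<lambda>x. F (g x)) \<in> bm" and F: "\<And>s t. \<bar>F s - F t\<bar> \<le> L * \<bar>s - t :: real\<bar>"
    and r: "recurrent N d g"
  shows "recurrent N d (\<lambda>x. F (g x))"
  unfolding recurrent_def
proof (rule Lim_null_comparison)
  note int = invariant_integrable[OF N]
  show "(\<lambda>k. L * (LINT x|N. \<bar>g ((f ^^ d k) x) - g x\<bar>)) \<longlonglongrightarrow> 0"
    using tendsto_mult_right_zero[OF r[unfolded recurrent_def]] .
  have "(LINT x|N. \<bar>F (g ((f ^^ d k) x)) - F (g x)\<bar>) \<le> (LINT x|N. L * \<bar>g ((f ^^ d k) x) - g x\<bar>)" for k
    by (intro integral_mono int bm_abs bm_diff bm_comp[OF g(1)] bm_comp[OF g(2)] bm_cmult g F)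
  then show "\<forall>\<^sub>F k in sequentially. norm (LINT x|N. \<bar>F (g ((f ^^ d k) x)) - F (g x)\<bar>) \<le> L * (LINT x|N. \<bar>g ((f ^^ d k) x) - g x\<bar>)"
    by (simp add: Bochner_Integration.integral_nonneg)
qed

lemma recurrent_closed:
  assumes N: "invariant N" and g: "g \<in> bm" "\<And>i. u i \<in> bm" and r: "\<And>i. recurrent N d (u i)"
    and lim: "(\<lambda>i. LINT x|N. \<bar>g x - u i x\<bar>) \<longlonglongrightarrow> 0"
  shows "recurrent N d g"
  unfolding recurrent_def
proof (rule LIMSEQ_I)
  note int = invariant_integrable[OF N]
  fix t :: real assume t: "0 < t"
  then have t3: "0 < t / 3" by simp
  obtain i where i: "(LINT x|N. \<bar>g x - u i x\<bar>) < t / 3"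
    using LIMSEQ_D[OF lim t3] by fastforce
  obtain k0 where k0: "\<And>k. k \<ge> k0 \<Longrightarrow> (LINT x|N. \<bar>u i ((f ^^ d k) x) - u i x\<bar>) < t / 3"
    using LIMSEQ_D[OF r[of i, unfolded recurrent_def] t3] by fastforce
  show "\<exists>k0. \<forall>k\<ge>k0. norm ((LINT x|N. \<bar>g ((f ^^ d k) x) - g x\<bar>) - 0) < t"
  proof (intro exI allI impI)
    fix k assume k: "k \<ge> k0"
    let ?v = "\<lambda>x. \<bar>g x - u i x\<bar>"
    have v: "?v \<in> bm" by (intro bm_abs bm_diff g)
    have "(LINT x|N. \<bar>g ((f ^^ d k) x) - g x\<bar>)
       \<le> (LINT x|N. ?v ((f ^^ d k) x) + (\<bar>u i ((f ^^ d k) x) - u i x\<bar> + ?v x))"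
      by (intro integral_mono int bm_add bm_comp[OF v] bm_abs bm_diff bm_comp[OF g(1)] bm_comp[OF g(2)] g) linarith
    also have "\<dots> = (LINT x|N. ?v ((f ^^ d k) x)) + ((LINT x|N. \<bar>u i ((f ^^ d k) x) - u i x\<bar>) + (LINT x|N. ?v x))"
      using int[OF bm_comp[OF v, of "d k"]] int[OF v] int[OF bm_abs[OF bm_diff[OF bm_comp[OF g(2)[of i], of "d k"] g(2)[of i]]]]
      by simp
    also have "(LINT x|N. ?v ((f ^^ d k) x)) = (LINT x|N. ?v x)" by (rule invariant_integral[OF N v])
    finally show "norm ((LINT x|N. \<bar>g ((f ^^ d k) x) - g x\<bar>) - 0) < t"
      using i k0[OF k] by (simp add: Bochner_Integration.integral_nonneg)
  qed
qed

text \<open>Recurrence passes to Lipschitz functions of \<open>g\<close> and to limits in the mean;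
  the indicator is the limit of increasingly steep ramps that rise from 0 to 1 just above the level
  \<open>t\<close>.\<close>

lemma recurrent_level_set:
  assumes N: "invariant N" and g: "g \<in> bm" and r: "recurrent N d g"
  shows "recurrent N d (indicator {x \<in> {a..b}. t < g x})"
proof (rule recurrent_closed[OF N, where u = "\<lambda>i x. min 1 (real i * max 0 (g x - t))"])
  note int = invariant_integrable[OF N] and sp = invariantD(5)[OF N]
  interpret N: finite_measure N by (rule invariantD(2)[OF N])
  have "{x \<in> space M. t < g x} \<in> sets M" using bm_measurable[OF g] by measurable
  then have "{x \<in> {a..b}. t < g x} \<in> sets M" by simp
  then show I: "indicator {x \<in> {a..b}. t < g x} \<in> bm" by (intro bm_ind) (simp add: sets_restrict_space_iff)
  show u: "(\<lambda>x. min 1 (real i * max 0 (g x - t))) \<in> bm" for i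
    by (rule bmI[of _ 1]) (use bm_measurable[OF g] in auto)
  show "recurrent N d (\<lambda>x. min 1 (real i * max 0 (g x - t)))" for i
  proof (rule recurrent_lipschitz[OF N g u _ r, where L = "real i"])
    fix s s' :: real
    have "\<bar>min 1 (real i * max 0 (s - t)) - min 1 (real i * max 0 (s' - t))\<bar> \<le> \<bar>real i * max 0 (s - t) - real i * max 0 (s' - t)\<bar>"
      by linarith
    also have "\<dots> = real i * \<bar>max 0 (s - t) - max 0 (s' - t)\<bar>" by (simp add: abs_mult right_diff_distrib[symmetric])
    also have "\<dots> \<le> real i * \<bar>s - s'\<bar>" by (intro mult_left_mono) auto
    finally show "\<bar>min 1 (real i * max 0 (s - t)) - min 1 (real i * max 0 (s' - t))\<bar> \<le> real i * \<bar>s - s'\<bar>" .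
  qed
  have "(\<lambda>i. LINT x|N. \<bar>indicator {x \<in> {a..b}. t < g x} x - min 1 (real i * max 0 (g x - t))\<bar>) \<longlonglongrightarrow> (LINT x|N. 0)"
  proof (rule integral_dominated_convergence[where w="\<lambda>_. 1"])
    show "(\<lambda>x. \<bar>indicator {x \<in> {a..b}. t < g x} x - min 1 (real i * max 0 (g x - t))\<bar>) \<in> borel_measurable N" for i
      by (intro borel_measurable_integrable int bm_abs bm_diff I u)
    show "AE x in N. norm \<bar>indicator {x \<in> {a..b}. t < g x} x - min 1 (real i * max 0 (g x - t))\<bar> \<le> 1" for i
      by (intro AE_I2) (auto simp: indicator_def)
    show "AE x in N. (\<lambda>i. \<bar>indicator {x \<in> {a..b}. t < g x} x - min 1 (real i * max 0 (g x - t))\<bar>) \<longlonglongrightarrow> 0"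
    proof (rule AE_I2)
      fix x assume x: "x \<in> space N"
      show "(\<lambda>i. \<bar>indicator {x \<in> {a..b}. t < g x} x - min 1 (real i * max 0 (g x - t))\<bar>) \<longlonglongrightarrow> 0"
      proof (cases "t < g x")
        case True
        obtain i0 :: nat where i0: "1 / (g x - t) < real i0" using reals_Archimedean2 by blast
        have "\<bar>indicator {x \<in> {a..b}. t < g x} x - min 1 (real i * max 0 (g x - t))\<bar> = 0" if "i \<ge> i0" for i
        proof -
          have "1 / (g x - t) \<le> real i" using i0 that by linarith
          then have "1 \<le> real i * max 0 (g x - t)" using True by (simp add: divide_simps mult.commute)
          then show ?thesis using True x sp by simp
        qed
        then show ?thesis by (intro tendsto_eventually) (auto simp: eventually_sequentially)
      qed simp
    qed
  qed auto
  then show "(\<lambda>i. LINT x|N. \<bar>indicator {x \<in> {a..b}. t < g x} x - min 1 (real i * max 0 (g x - t))\<bar>) \<longlonglongrightarrow> 0" by simp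
qed

text \<open>An isometry turns weak recurrence into strong recurrence:
  \<open>\<parallel>Uh - h\<parallel>\<^sup>2 = 2\<parallel>h\<parallel>\<^sup>2 - 2\<langle>h, Uh\<rangle>\<close> in the Hilbert space of the invariant measure.\<close>
lemma recurrentI:
  assumes N: "invariant N" and h: "h \<in> bm" and lim: "(\<lambda>k. pn (\<lambda>x. h ((f ^^ d k) x) - h x)) \<longlonglongrightarrow> 0"
  shows "recurrent N d h"
  unfolding recurrent_def
proof (rule LIMSEQ_I)
  note int = invariant_integrable[OF N]
  interpret N: finite_measure N by (rule invariantD(2)[OF N])
  obtain B where B: "B > 0" "\<And>x. x \<in> {a..b} \<Longrightarrow> \<bar>h x\<bar> \<le> B" using bmE[OF h] by blast
  let ?g = "\<lambda>k x. h ((f ^^ d k) x) - h x"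
  have g: "?g k \<in> bm" for k by (intro bm_diff bm_comp h)
  have gB: "\<bar>?g k x\<bar> \<le> 2 * B" if "x \<in> {a..b}" for k x
    using B(2)[OF that] B(2)[OF fn_in[OF that, of "d k"]] by linarith
  have w: "(\<lambda>k. LINT x|N. h x * ?g k x) \<longlonglongrightarrow> 0"
    by (rule weakly_null_measure[OF invariantD(1-3)[OF N] g gB lim h])
  have sq: "(LINT x|N. ?g k x * ?g k x) = - 2 * (LINT x|N. h x * ?g k x)" for k
  proof -
    have hh: "(\<lambda>x. h x * h x) \<in> bm" by (intro bm_mult h)
    have "(LINT x|N. ?g k x * ?g k x) = (LINT x|N. (h ((f ^^ d k) x) * h ((f ^^ d k) x) - h x * h x) + (- 2) * (h x * ?g k x))"
      by (intro Bochner_Integration.integral_cong) (auto simp: algebra_simps)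
    also have "\<dots> = (LINT x|N. h ((f ^^ d k) x) * h ((f ^^ d k) x)) - (LINT x|N. h x * h x) + (LINT x|N. (- 2) * (h x * ?g k x))"
      using int[OF bm_comp[OF hh, of "d k"]] int[OF hh] int[OF bm_cmult[OF bm_mult[OF h g[of k]], of "-2"]]
      by (subst Bochner_Integration.integral_add) (auto simp: Bochner_Integration.integral_diff)
    also have "(LINT x|N. h ((f ^^ d k) x) * h ((f ^^ d k) x)) = (LINT x|N. h x * h x)"
      using invariant_integral[OF N hh, of "d k"] .
    finally show ?thesis by simp
  qed
  have sq0: "(\<lambda>k. LINT x|N. ?g k x * ?g k x) \<longlonglongrightarrow> 0"
    unfolding sq using tendsto_mult_right_zero[OF w] .
  fix t :: real assume t: "0 < t"
  define m where "m = measure N (space N)"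
  have m: "m \<ge> 0" by (simp add: m_def)
  define \<epsilon> where "\<epsilon> = t / (2 * (m + 1))"
  have \<epsilon>: "\<epsilon> > 0" "\<epsilon> * m < t / 2 \<or> \<epsilon> * m \<le> t / 2" using t m by (auto simp: \<epsilon>_def field_simps)
  have "0 < t * \<epsilon> / 2" using t \<epsilon> by simp
  from LIMSEQ_D[OF sq0 this] obtain k0 where k0: "\<And>k. k \<ge> k0 \<Longrightarrow> (LINT x|N. ?g k x * ?g k x) < t * \<epsilon> / 2"
    by fastforce
  show "\<exists>k0. \<forall>k\<ge>k0. norm ((LINT x|N. \<bar>?g k x\<bar>) - 0) < t"
  proof (intro exI allI impI)
    fix k assume k: "k \<ge> k0"
    \<comment> \<open>Passes from squares to absolute values: the constant \<epsilon> costs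
      \<open>\<epsilon> * m\<close> because the measure is finite, and the quadratic term is small
      for large \<open>k\<close>.\<close>
    have pt: "\<bar>s\<bar> \<le> \<epsilon> + (1 / \<epsilon>) * (s * s)" for s :: real
    proof (cases "\<bar>s\<bar> \<le> \<epsilon>")
      case True
      have "0 \<le> (1 / \<epsilon>) * (s * s)" using \<epsilon>(1) by simp
      then show ?thesis using True by linarith
    next
      case False
      then have "\<epsilon> * \<bar>s\<bar> \<le> \<bar>s\<bar> * \<bar>s\<bar>" by (intro mult_right_mono) auto
      then have "\<bar>s\<bar> \<le> (1 / \<epsilon>) * (s * s)" using \<epsilon>(1) by (simp add: field_simps)
      then show ?thesis using \<epsilon>(1) by linarith
    qed
    have "(LINT x|N. \<bar>?g k x\<bar>) \<le> (LINT x|N. \<epsilon> + (1 / \<epsilon>) * (?g k x * ?g k x))"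
      by (intro integral_mono int bm_abs bm_add bm_const bm_cmult bm_mult g pt)
    also have "\<dots> = \<epsilon> * m + (1 / \<epsilon>) * (LINT x|N. ?g k x * ?g k x)"
      using int[OF bm_cmult[OF bm_mult[OF g[of k] g[of k]], of "1 / \<epsilon>"]] int[OF bm_const[of \<epsilon>]]
      by (subst Bochner_Integration.integral_add) (auto simp: m_def)
    also have "\<dots> < t / 2 + (1 / \<epsilon>) * (t * \<epsilon> / 2)"
      using k0[OF k] \<epsilon> by (intro add_le_less_mono mult_strict_left_mono) auto
    also have "\<dots> = t" using \<epsilon>(1) by simp
    finally show "norm ((LINT x|N. \<bar>?g k x\<bar>) - 0) < t" by (simp add: Bochner_Integration.integral_nonneg)
  qed
qed

section \<open>An invariant measure that controls the transient part\<close>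

text \<open>The measure of the preimage is the value at \<open>b\<close> of a primitive, hence
  bounded by \<open>pn\<close>, and the power bound brings it back to time zero. Thus all
  push-forwards of Lebesgue measure have densities bounded by \<open>K\<close>.\<close>

lemma measure_fn_vimage_le:
  assumes K: "\<And>n g. g \<in> bm \<Longrightarrow> pn (\<lambda>x. g ((f ^^ n) x)) \<le> K * pn g" "1 \<le> K" and A: "A \<in> sets M"
  shows "measure M ((f ^^ n) -` A \<inter> {a..b}) \<le> K * measure M A"
proof -
  have Al: "A \<in> sets lebesgue" using A by (simp add: sets_restrict_space_iff)
  have Ai: "A \<subseteq> {a..b}" using sets.sets_into_space[OF A] by simp
  let ?u = "\<lambda>x. indicat_real A ((f ^^ n) x)"
  have u: "?u \<in> bm" by (rule bm_comp[OF bm_ind[OF Al]])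
  have "measure M ((f ^^ n) -` A \<inter> {a..b}) = (LINT x|M. indicator ((f ^^ n) -` A \<inter> {a..b}) x)"
    by simp
  also have "\<dots> = J {a..b} ?u"
    unfolding J_def by (intro Bochner_Integration.integral_cong) (auto simp: indicator_def)
  also have "\<dots> \<le> pn ?u" using pn_upper[OF u, of b] ab by simp
  also have "\<dots> \<le> K * pn (indicat_real A)" by (rule K(1)[OF bm_ind[OF Al]])
  also have "\<dots> \<le> K * measure M A"
    using pn_ind_le[OF Al] measure_M[OF Al] K(2) Ai by (intro mult_left_mono) (auto simp: Int_absorb1)
  finally show ?thesis .
qed

text \<open>A weak limit of the averaged push-forwards of Lebesgue measure; it sees every invariant set that
  Lebesgue measure sees.\<close>
lemma invariant_exists:
  obtains N where "invariant N" "\<And>Z. \<lbrakk>Z \<in> sets M; f -` Z \<inter> {a..b} = Z\<rbrakk> \<Longrightarrow> measure N Z = measure M Z"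
proof -
  obtain K where K: "1 \<le> K" "\<And>n g. g \<in> bm \<Longrightarrow> pn (\<lambda>x. g ((f ^^ n) x)) \<le> K * pn g" using power_bound by blast
  define pre where "pre A j = (f ^^ j) -` A \<inter> {a..b}" for A j
  have preM: "pre A j \<in> sets M" if "A \<in> sets M" for A j unfolding pre_def by (rule fn_vimage[OF that])
  have preK: "measure M (pre A j) \<le> K * measure M A" if "A \<in> sets M" for A j
    unfolding pre_def by (rule measure_fn_vimage_le[OF K(2) K(1) that])
  \<comment> \<open>\<open>Suc n\<close> terms, so that no average divides by zero.\<close>
  define \<nu> where "\<nu> n A = (\<Sum>j<Suc n. measure M (pre A j)) / Suc n" for n :: nat and A
  have nu0: "0 \<le> \<nu> n A" for n A unfolding \<nu>_def by (intro divide_nonneg_nonneg sum_nonneg) auto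
  have nuK: "\<nu> n A \<le> K * measure M A" if "A \<in> sets M" for n A
  proof -
    have "(\<Sum>j<Suc n. measure M (pre A j)) \<le> (\<Sum>j<Suc n. K * measure M A)" by (intro sum_mono preK that)
    then show ?thesis by (simp add: \<nu>_def divide_simps mult.commute)
  qed
  have nuU: "\<nu> n (A \<union> B) = \<nu> n A + \<nu> n B" if "A \<in> sets M" "B \<in> sets M" "A \<inter> B = {}" for n A B
  proof -
    have "measure M (pre (A \<union> B) j) = measure M (pre A j) + measure M (pre B j)" for j
    proof -
      have "pre (A \<union> B) j = pre A j \<union> pre B j" "pre A j \<inter> pre B j = {}" using that(3) by (auto simp: pre_def)
      then show ?thesis using M.finite_measure_Union[OF preM[OF that(1)] preM[OF that(2)]] by simp
    qed
    then show ?thesis by (simp add: \<nu>_def sum.distrib add_divide_distrib)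
  qed
  have "\<exists>D. D \<in> bm \<and> (\<forall>x. \<bar>D x\<bar> \<le> K) \<and> (\<forall>A\<in>sets M. (LINT x|M. indicator A x * D x) = \<nu> n A)" for n
  proof (rule bounded_density[of "\<nu> n" K])
    show "0 \<le> \<nu> n A" "\<nu> n A \<le> K * measure M A" if "A \<in> sets M" for A using nu0 nuK[OF that] by auto
    show "0 \<le> K" using K(1) by linarith
    show "\<nu> n (A \<union> B) = \<nu> n A + \<nu> n B" if "A \<in> sets M" "B \<in> sets M" "A \<inter> B = {}" for A B by (rule nuU[OF that])
    fix D assume "D \<in> bm" "\<And>x. \<bar>D x\<bar> \<le> K" "\<And>A. A \<in> sets M \<Longrightarrow> (LINT x|M. indicator A x * D x) = \<nu> n A"
    then show ?thesis by blast
  qed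
  then obtain D where D: "\<And>n. D n \<in> bm" "\<And>n x. \<bar>D n x\<bar> \<le> K" "\<And>n A. A \<in> sets M \<Longrightarrow> (LINT x|M. indicator A x * D n x) = \<nu> n A"
    by metis
  \<comment> \<open>Compactness is applied to the densities of the averages; convergence on every
    measurable set follows from \<open>weakly_null_measure\<close>.\<close>
  obtain k :: "nat \<Rightarrow> nat" and E where k: "strict_mono k" and E: "E \<in> bm" "\<And>x. x \<in> {a..b} \<Longrightarrow> \<bar>E x\<bar> \<le> K"
    and lim: "(\<lambda>n. pn (\<lambda>x. D (k n) x - E x)) \<longlonglongrightarrow> 0"
    by (rule pn_compact[of D K, OF D(1) D(2)]) (rule that)
  define \<nu>\<^sub>0 where "\<nu>\<^sub>0 A = (LINT x|M. indicator A x * E x)" for A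
  have conv: "(\<lambda>n. \<nu> (k n) A) \<longlonglongrightarrow> \<nu>\<^sub>0 A" if A: "A \<in> sets M" for A
  proof -
    have Al: "A \<in> sets lebesgue" using A by (simp add: sets_restrict_space_iff)
    have b: "\<bar>D (k n) x - E x\<bar> \<le> 2 * K" if "x \<in> {a..b}" for n x using D(2)[of "k n" x] E(2)[OF that] by linarith
    have "(\<lambda>n. LINT x|M. indicator A x * (D (k n) x - E x)) \<longlonglongrightarrow> 0"
      by (rule weakly_null_measure[OF refl M.finite_measure_axioms absolutely_continuous_refl bm_diff[OF D(1) E(1)] b lim bm_ind[OF Al]])
    moreover have "(LINT x|M. indicator A x * (D (k n) x - E x)) = \<nu> (k n) A - \<nu>\<^sub>0 A" for n
      using J_diff[OF Al D(1)[of "k n"] E(1)] D(3)[OF A, of "k n"] by (simp add: J_def \<nu>\<^sub>0_def)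
    ultimately show ?thesis by (simp add: LIM_zero_iff)
  qed
  obtain N where N: "sets N = sets M" "finite_measure N" "\<And>A. A \<in> sets M \<Longrightarrow> measure N A = \<nu>\<^sub>0 A" "absolutely_continuous M N"
  proof (rule bounded_additive_measure[of \<nu>\<^sub>0 K])
    show "0 \<le> \<nu>\<^sub>0 A" if "A \<in> sets M" for A by (rule LIMSEQ_le_const[OF conv[OF that]]) (use nu0 in auto)
    show "\<nu>\<^sub>0 A \<le> K * measure M A" if "A \<in> sets M" for A by (rule LIMSEQ_le_const2[OF conv[OF that]]) (use nuK[OF that] in auto)
    show "\<nu>\<^sub>0 (A \<union> B) = \<nu>\<^sub>0 A + \<nu>\<^sub>0 B" if "A \<in> sets M" "B \<in> sets M" "A \<inter> B = {}" for A B
    proof (rule LIMSEQ_unique[OF conv])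
      show "(\<lambda>n. \<nu> (k n) (A \<union> B)) \<longlonglongrightarrow> \<nu>\<^sub>0 A + \<nu>\<^sub>0 B"
        unfolding nuU[OF that] by (intro tendsto_add conv that)
    qed (use that in auto)
  qed (rule that)
  have kinf: "filterlim k at_top sequentially" by (rule filterlim_subseq[OF k])
  have inv: "\<nu>\<^sub>0 (f -` A \<inter> {a..b}) = \<nu>\<^sub>0 A" if A: "A \<in> sets M" for A
  proof -
    have pS: "pre (f -` A \<inter> {a..b}) j = pre A (Suc j)" for j
      unfolding pre_def using fn_in by auto
    \<comment> \<open>Telescoping: the two averages differ only by the last and the first
      term.\<close>
    have eq: "\<nu> n (f -` A \<inter> {a..b}) - \<nu> n A = (measure M (pre A (Suc n)) - measure M (pre A 0)) / Suc n" for n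
      unfolding \<nu>_def pS diff_divide_distrib[symmetric]
      by (simp only: sum.lessThan_Suc_shift[of "\<lambda>j. measure M (pre A j)" n] sum.lessThan_Suc[of "\<lambda>j. measure M (pre A (Suc j))" n] add_diff_add) simp
    have b: "\<bar>\<nu> n (f -` A \<inter> {a..b}) - \<nu> n A\<bar> \<le> (2 * K * measure M A) * inverse (real (Suc n))" for n
    proof -
      have "\<bar>measure M (pre A (Suc n)) - measure M (pre A 0)\<bar> \<le> 2 * K * measure M A"
        using preK[OF A, of "Suc n"] preK[OF A, of 0] measure_nonneg[of M "pre A (Suc n)"] measure_nonneg[of M "pre A 0"]
        by linarith
      then show ?thesis unfolding eq abs_divide by (simp add: divide_inverse mult_right_mono)
    qed
    have "(\<lambda>n. \<nu> (k n) (f -` A \<inter> {a..b}) - \<nu> (k n) A) \<longlonglongrightarrow> 0"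
    proof (rule Lim_null_comparison)
      show "\<forall>\<^sub>F n in sequentially. norm (\<nu> (k n) (f -` A \<inter> {a..b}) - \<nu> (k n) A) \<le> (2 * K * measure M A) * inverse (real (Suc (k n)))"
        using b by simp
      show "(\<lambda>n. (2 * K * measure M A) * inverse (real (Suc (k n)))) \<longlonglongrightarrow> 0"
        by (rule tendsto_mult_right_zero[OF filterlim_compose[OF LIMSEQ_inverse_real_of_nat kinf]])
    qed
    moreover have "(\<lambda>n. \<nu> (k n) (f -` A \<inter> {a..b}) - \<nu> (k n) A) \<longlonglongrightarrow> \<nu>\<^sub>0 (f -` A \<inter> {a..b}) - \<nu>\<^sub>0 A"
      by (intro tendsto_diff conv f_vimage A)
    ultimately show ?thesis using LIMSEQ_unique by fastforce
  qed
  interpret N: finite_measure N by fact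
  have sp: "space N = {a..b}" using sets_eq_imp_space_eq[OF N(1)] by simp
  have fN: "f \<in> N \<rightarrow>\<^sub>M N" using f_meas measurable_cong_sets[OF N(1) N(1)] by blast
  have "distr N N f = N"
  proof (rule measure_eqI)
    fix A assume "A \<in> sets (distr N N f)"
    then have A: "A \<in> sets N" "A \<in> sets M" using N(1) by auto
    have "emeasure (distr N N f) A = emeasure N (f -` A \<inter> {a..b})" using emeasure_distr[OF fN A(1)] sp by simp
    also have "\<dots> = emeasure N A"
      using inv[OF A(2)] N(3)[OF A(2)] N(3)[OF f_vimage[OF A(2)]] by (simp add: N.emeasure_eq_measure)
    finally show "emeasure (distr N N f) A = emeasure N A" .
  qed simp
  then have "invariant N" unfolding invariant_def using N by blast
  moreover have "measure N Z = measure M Z" if Z: "Z \<in> sets M" "f -` Z \<inter> {a..b} = Z" for Z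
  proof -
    \<comment> \<open>A strictly invariant set has its Lebesgue measure in every average, and
      therefore in the limit.\<close>
    have "pre Z j = Z" for j
    proof (induction j)
      case 0
      show ?case using Z(2) by (auto simp: pre_def)
    next
      case (Suc j)
      have "pre Z (Suc j) = pre (f -` Z \<inter> {a..b}) j" unfolding pre_def using fn_in by auto
      then show ?case using Suc Z(2) by simp
    qed
    then have "\<nu> n Z = measure M Z" for n by (simp add: \<nu>_def)
    then have "(\<lambda>n. measure M Z) \<longlonglongrightarrow> \<nu>\<^sub>0 Z" using conv[OF Z(1)] by simp
    then have "\<nu>\<^sub>0 Z = measure M Z" using LIMSEQ_unique tendsto_const by blast
    then show ?thesis using N(3)[OF Z(1)] by simp
  qed
  ultimately show ?thesis using that by blast
qed

lemma invariant_measure: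
  assumes N: "invariant N" and A: "A \<in> sets M"
  shows "measure N ((f ^^ n) -` A \<inter> {a..b}) = measure N A"
proof -
  have Al: "A \<in> sets lebesgue" using A by (simp add: sets_restrict_space_iff)
  have sp: "space N = {a..b}" by (rule invariantD(5)[OF N])
  have "measure N ((f ^^ n) -` A \<inter> {a..b}) = (LINT x|N. indicator ((f ^^ n) -` A \<inter> {a..b}) x)"
    using sp by simp
  also have "\<dots> = (LINT x|N. indicator A ((f ^^ n) x))"
    using sp by (intro Bochner_Integration.integral_cong) (auto simp: indicator_def)
  also have "\<dots> = (LINT x|N. indicator A x)" by (rule invariant_integral[OF N bm_ind[OF Al]])
  also have "\<dots> = measure N A" using sets.sets_into_space[OF A] sp by (simp add: Int_absorb2)
  finally show ?thesis .
qed

text \<open>\<open>W'\<close> collects the points that ever reach the set where \<open>w\<close> is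
  nonzero; it is null for \<open>N\<close>. The sets of points still in \<open>W'\<close> at time
  \<open>n\<close> decrease to a strictly invariant set, null for \<open>N\<close> and so null for
  Lebesgue measure. Hence their Lebesgue measures tend to zero, and \<open>w \<circ> f ^^ n\<close>
  vanishes outside them.\<close>

lemma transient:
  assumes N: "invariant N" "\<And>Z. \<lbrakk>Z \<in> sets M; f -` Z \<inter> {a..b} = Z\<rbrakk> \<Longrightarrow> measure N Z = measure M Z"
    and w: "w \<in> bm" "AE x in N. w x = 0"
  shows "(\<lambda>n. pn (\<lambda>x. w ((f ^^ n) x))) \<longlonglongrightarrow> 0"
proof -
  interpret N: finite_measure N by (rule invariantD(2)[OF N(1)])
  note s = invariantD(1)[OF N(1)] and sp = invariantD(5)[OF N(1)]
  define W where "W = {x \<in> {a..b}. w x \<noteq> 0}"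
  have "{x \<in> space M. w x \<noteq> 0} \<in> sets M" using bm_measurable[OF w(1)] by measurable
  then have W: "W \<in> sets M" by (simp add: W_def)
  have "emeasure N W = 0"
    using AE_iff_measurable[of W N "\<lambda>x. w x = 0"] w(2) W s sp by (auto simp: W_def)
  then have W0: "measure N W = 0" by (simp add: measure_def)
  define W' where "W' = (\<Union>n. (f ^^ n) -` W \<inter> {a..b})"
  have W': "W' \<in> sets M" unfolding W'_def by (intro sets.countable_UN image_subsetI fn_vimage W)
  have "(f ^^ n) -` W \<inter> {a..b} \<in> null_sets N" for n
    using invariant_measure[OF N(1) W, of n] W0 fn_vimage[OF W, of n] s by (auto simp: null_sets_def N.emeasure_eq_measure)
  then have "W' \<in> null_sets N" unfolding W'_def by (intro null_sets_UN)
  then have W'0: "measure N W' = 0" by (simp add: measure_def null_sets_def)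
  define D where "D n = (f ^^ n) -` W' \<inter> {a..b}" for n
  have D: "D n \<in> sets M" for n unfolding D_def by (rule fn_vimage[OF W'])
  have step: "y \<in> W'" if y: "y \<in> {a..b}" "f y \<in> W'" for y
  proof -
    obtain n where "(f ^^ n) (f y) \<in> W" using y(2) by (auto simp: W'_def)
    then have "(f ^^ Suc n) y \<in> W" by (simp add: funpow_Suc_right del: funpow.simps)
    then show ?thesis using y(1) unfolding W'_def by blast
  qed
  have dec: "D (Suc n) \<subseteq> D n" for n
  proof
    fix x assume "x \<in> D (Suc n)"
    then have "x \<in> {a..b}" "f ((f ^^ n) x) \<in> W'" by (auto simp: D_def)
    then show "x \<in> D n" using step fn_in unfolding D_def by blast
  qed
  define Z where "Z = (\<Inter>n. D n)"
  have Z: "Z \<in> sets M" unfolding Z_def using D by (intro sets.countable_INT) auto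
  have fD: "x \<in> {a..b} \<Longrightarrow> f x \<in> D n \<longleftrightarrow> x \<in> D (Suc n)" for x n
    unfolding D_def using f_in by (auto simp: funpow_Suc_right simp del: funpow.simps)
  have Zinv: "f -` Z \<inter> {a..b} = Z"
  proof
    show "f -` Z \<inter> {a..b} \<subseteq> Z"
    proof
      fix x assume x: "x \<in> f -` Z \<inter> {a..b}"
      then have "x \<in> D (Suc n)" for n using fD[of x n] by (auto simp: Z_def)
      then have "x \<in> D n" for n using dec by blast
      then show "x \<in> Z" by (simp add: Z_def)
    qed
    show "Z \<subseteq> f -` Z \<inter> {a..b}"
    proof
      fix x assume x: "x \<in> Z"
      then have "x \<in> {a..b}" unfolding Z_def D_def by blast
      moreover have "f x \<in> D n" for n using fD[OF calculation, of n] x by (auto simp: Z_def)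
      ultimately show "x \<in> f -` Z \<inter> {a..b}" by (simp add: Z_def)
    qed
  qed
  have "D 0 \<subseteq> W'" by (auto simp: D_def)
  then have "Z \<subseteq> W'" unfolding Z_def by blast
  then have "measure N Z \<le> measure N W'" using W' s by (intro N.finite_measure_mono) auto
  then have "measure M Z = 0" using W'0 N(2)[OF Z Zinv] measure_nonneg[of N Z] by linarith
  then have Dlim: "(\<lambda>n. measure M (D n)) \<longlonglongrightarrow> 0"
    using M.finite_Lim_measure_decseq[of D] D dec by (auto simp: Z_def decseq_Suc_iff image_subset_iff)
  obtain B where B: "B > 0" "\<And>x. x \<in> {a..b} \<Longrightarrow> \<bar>w x\<bar> \<le> B" using bmE[OF w(1)] by blast
  have bd: "pn (\<lambda>x. w ((f ^^ n) x)) \<le> B * measure M (D n)" for n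
  proof (rule pn_least)
    fix x assume x: "x \<in> {a..b}"
    have Dl: "D n \<in> sets lebesgue" using D[of n] by (simp add: sets_restrict_space_iff)
    have Ds: "D n \<subseteq> {a..b}" by (auto simp: D_def)
    have "\<bar>J {a..x} (\<lambda>x. w ((f ^^ n) x))\<bar> \<le> (LINT y|M. B * indicator (D n) y)"
      unfolding J_def
    proof (intro integral_abs_bound_integral J_int bm_comp w bm_integrable bm_cmult bm_ind Dl)
      fix y assume "y \<in> space M"
      then have y: "y \<in> {a..b}" by simp
      show "\<bar>indicator {a..x} y * w ((f ^^ n) y)\<bar> \<le> B * indicator (D n) y"
      proof (cases "w ((f ^^ n) y) = 0")
        case False
        then have "(f ^^ n) y \<in> W" using fn_in[OF y] by (simp add: W_def)
        then have "(f ^^ n) y \<in> W'" unfolding W'_def using fn_in[OF y, of n] by (intro UN_I[of 0]) auto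
        then have "y \<in> D n" using y by (simp add: D_def)
        then show ?thesis using B(2)[OF fn_in[OF y, of n]] B(1) by (auto simp: indicator_def)
      qed (use B in auto)
    qed auto
    also have "\<dots> = B * measure M (D n)" using Ds by (simp add: Int_absorb2)
    finally show "\<bar>J {a..x} (\<lambda>x. w ((f ^^ n) x))\<bar> \<le> B * measure M (D n)" .
  qed
  show ?thesis
  proof (rule Lim_null_comparison[OF _ tendsto_mult_right_zero[OF Dlim]])
    show "\<forall>\<^sub>F n in sequentially. norm (pn (\<lambda>x. w ((f ^^ n) x))) \<le> B * measure M (D n)"
      using bd pn_nonneg[OF bm_comp[OF w(1)]] by simp
  qed
qed

text \<open>The functions \<open>1\<^sub>A \<circ> f ^^ i\<close> of a recurrent set \<open>A\<close> are separated in \<open>pn\<close> as long as they differ, while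
  they all lie in a totally bounded set: hence they are periodic, with a period bounded independently of \<open>A\<close>.\<close>
lemma recurrent_periodic:
  "\<exists>p\<ge>1. \<forall>N d h. invariant N \<longrightarrow> filterlim d at_top sequentially \<longrightarrow> h \<in> bm \<longrightarrow> recurrent N d h \<longrightarrow>
     (AE x in N. h ((f ^^ p) x) = h x)"
proof -
  \<comment> \<open>Two recurrent indicators at distance at most \<open>1 / (2 * C)\<close> differ
    by at most 1/2 almost everywhere, hence coincide there.\<close>
  have pos: "1 / (2 * C) > 0" using C0 by simp
  obtain lab :: "(real \<Rightarrow> real) \<Rightarrow> nat \<Rightarrow> int" where
    fin: "finite (lab ` {g \<in> bm. \<forall>x\<in>{a..b}. \<bar>g x\<bar> \<le> 1})" and
    sep: "\<And>g h. \<lbrakk>g \<in> bm; h \<in> bm; \<And>x. x \<in> {a..b} \<Longrightarrow> \<bar>g x\<bar> \<le> 1; \<And>x. x \<in> {a..b} \<Longrightarrow> \<bar>h x\<bar> \<le> 1; lab g = lab h\<rbrakk>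
       \<Longrightarrow> pn (\<lambda>x. g x - h x) \<le> 1 / (2 * C)"
  proof (rule pn_net[of 1 "1 / (2 * C)"])
    show "1 / (2 * C) > 0" by (rule pos)
    fix lab :: "(real \<Rightarrow> real) \<Rightarrow> nat \<Rightarrow> int"
    assume 1: "finite (lab ` {g \<in> bm. \<forall>x\<in>{a..b}. \<bar>g x\<bar> \<le> 1})"
      and 2: "\<And>g h. \<lbrakk>g \<in> bm; h \<in> bm; \<And>x. x \<in> {a..b} \<Longrightarrow> \<bar>g x\<bar> \<le> 1; \<And>x. x \<in> {a..b} \<Longrightarrow> \<bar>h x\<bar> \<le> 1; lab g = lab h\<rbrakk>
       \<Longrightarrow> pn (\<lambda>x. g x - h x) \<le> 1 / (2 * C)"
    show thesis by (rule that[OF 1 2])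
  qed simp
  define P where "P = card (lab ` {g \<in> bm. \<forall>x\<in>{a..b}. \<bar>g x\<bar> \<le> 1})"
  show ?thesis
  \<comment> \<open>With \<open>P\<close> labels the period of a single set is at most
    \<open>P\<close>, so it divides \<open>fact P\<close>, a number that depends neither on the set
    nor on \<open>N\<close>.\<close>
  proof (intro exI[of _ "fact P"] conjI allI impI)
    show "1 \<le> (fact P :: nat)" by (rule fact_ge_1)
    fix N d h
    assume N: "invariant N" and d: "filterlim d at_top sequentially" and h: "h \<in> bm" and r: "recurrent N d h"
    note int = invariant_integrable[OF N] and sp = invariantD(5)[OF N]
    have per: "AE x in N. indicat_real A ((f ^^ fact P) x) = indicator A x"
      if A: "indicat_real A \<in> bm" "recurrent N d (indicat_real A)" for A
    proof -
      define u where "u i = (\<lambda>x. indicat_real A ((f ^^ i) x))" for i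
      have u: "u i \<in> bm" for i unfolding u_def by (rule bm_comp[OF A(1)])
      have u1: "\<bar>u i x\<bar> \<le> 1" for i x by (simp add: u_def indicator_def)
      have ur: "recurrent N d (u i)" for i unfolding u_def by (rule recurrent_comp[OF N A])
      \<comment> \<open>Pigeonhole: \<open>Suc P\<close> translates share \<open>P\<close>
        labels.\<close>
      have "\<not> inj_on (\<lambda>i. lab (u i)) {..P}"
      proof
        assume "inj_on (\<lambda>i. lab (u i)) {..P}"
        then have "card ((\<lambda>i. lab (u i)) ` {..P}) = Suc P" by (simp add: card_image)
        moreover have "card ((\<lambda>i. lab (u i)) ` {..P}) \<le> P"
          unfolding P_def using u u1 by (intro card_mono[OF fin]) auto
        ultimately show False by simp
      qed
      then obtain i j where ij: "i < j" "j \<le> P" "lab (u i) = lab (u j)"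
        unfolding inj_on_def by (metis atMost_iff linorder_neqE_nat)
      define q where "q = j - i"
      have q: "1 \<le> q" "q \<le> P" "j = q + i" using ij by (auto simp: q_def)
      have "pn (\<lambda>x. u i x - u j x) \<le> 1 / (2 * C)" by (rule sep[OF u u u1 u1 ij(3)])
      then have le: "C * pn (\<lambda>x. u i x - u j x) \<le> 1 / 2" using C0 by (simp add: field_simps)
      have ae: "AE x in N. \<bar>u i x - u j x\<bar> \<le> C * pn (\<lambda>x. u i x - u j x)"
        by (rule recurrent_le_pn[OF N bm_diff[OF u u] d recurrent_diff[OF N u u ur ur]])
      have z0: "\<bar>u i x - u j x\<bar> = 0" if "\<bar>u i x - u j x\<bar> \<le> 1 / 2" for x
        using that by (cases "(f ^^ i) x \<in> A"; cases "(f ^^ j) x \<in> A") (auto simp: u_def)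
      have "AE x in N. \<bar>u i x - u j x\<bar> = 0"
        using ae by eventually_elim (use le z0 in force)
      then have "(LINT x|N. \<bar>u i x - u j x\<bar>) = (LINT x|N. 0)"
        using borel_measurable_integrable[OF int[OF bm_abs[OF bm_diff[OF u[of i] u[of j]]]]] by (intro integral_cong_AE) auto
      \<comment> \<open>Invariance of \<open>N\<close> strips off the \<open>i\<close> iterates
        common to both translates, leaving \<open>u 0\<close> and \<open>u q\<close>.\<close>
      moreover have "\<bar>u i x - u j x\<bar> = (\<lambda>x. \<bar>u 0 x - u q x\<bar>) ((f ^^ i) x)" for x
        unfolding u_def q(3) by (simp add: funpow_add)
      ultimately have "(LINT x|N. \<bar>u 0 x - u q x\<bar>) = 0"
        using invariant_integral[OF N bm_abs[OF bm_diff[OF u[of 0] u[of q]]], of i] by simp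
      then have z: "AE x in N. u q x = u 0 x"
        using integral_nonneg_eq_0_iff_AE[OF int[OF bm_abs[OF bm_diff[OF u[of 0] u[of q]]]]] by auto
      have "AE x in N. u (m * q) x = u 0 x" for m
      proof (induction m)
        case (Suc m)
        have "AE x in N. u q ((f ^^ (m * q)) x) = u 0 ((f ^^ (m * q)) x)" by (rule AE_comp_invariant[OF N z])
        moreover have "u q ((f ^^ (m * q)) x) = u (Suc m * q) x" "u 0 ((f ^^ (m * q)) x) = u (m * q) x" for x
          unfolding u_def by (simp_all add: funpow_add)
        ultimately show ?case using Suc by auto
      qed simp
      moreover obtain m where "fact P = m * q" using dvd_fact[OF q(1,2)] by (metis dvdE mult.commute)
      ultimately show ?thesis by (simp add: u_def)
    qed
    \<comment> \<open>A function is determined by its level sets at rational heights, and countably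
      many null sets may be united.\<close>
    have "AE x in N. \<forall>t\<in>\<rat>. indicat_real {x \<in> {a..b}. t < h x} ((f ^^ fact P) x) = indicator {x \<in> {a..b}. t < h x} x"
    proof (rule AE_ball_countable[THEN iffD2, OF countable_rat], intro ballI per)
      fix t :: real
      show "recurrent N d (indicator {x \<in> {a..b}. t < h x})" by (rule recurrent_level_set[OF N h r])
      have "{x \<in> space M. t < h x} \<in> sets M" using bm_measurable[OF h] by measurable
      then show "indicator {x \<in> {a..b}. t < h x} \<in> bm" by (intro bm_ind) (simp add: sets_restrict_space_iff)
    qed
    then show "AE x in N. h ((f ^^ fact P) x) = h x"
    proof (rule AE_mp, intro AE_I2 impI)
      fix x assume "x \<in> space N"
      then have x: "x \<in> {a..b}" using sp by simp
      assume *: "\<forall>t\<in>\<rat>. indicat_real {x \<in> {a..b}. t < h x} ((f ^^ fact P) x) = indicator {x \<in> {a..b}. t < h x} x"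
      have iff: "t < h ((f ^^ fact P) x) \<longleftrightarrow> t < h x" if "t \<in> \<rat>" for t
        using bspec[OF * that] x fn_in[OF x, of "fact P"] by (auto simp: indicator_def split: if_splits)
      show "h ((f ^^ fact P) x) = h x"
      proof (rule ccontr)
        assume "h ((f ^^ fact P) x) \<noteq> h x"
        then consider "h ((f ^^ fact P) x) < h x" | "h x < h ((f ^^ fact P) x)" by linarith
        then show False
        proof cases
          case 1
          then obtain t where "t \<in> \<rat>" "h ((f ^^ fact P) x) < t" "t < h x" using Rats_dense_in_real by blast
          then show False using iff[of t] by auto
        next
          case 2
          then obtain t where "t \<in> \<rat>" "t < h ((f ^^ fact P) x)" "h x < t" using Rats_dense_in_real by blast
          then show False using iff[of t] by auto
        qed
      qed
    qed
  qed
qed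

section \<open>Ergodic components\<close>

text \<open>Invariant sets of positive \<open>N\<close>-measure have Lebesgue measure at least
  \<open>1 / C\<close>, since their indicators are recurrent. Among those inside
  \<open>{w > t}\<close>, one is taken whose Lebesgue measure exceeds the infimum by less than
  \<open>1 / C\<close>: splitting it into two invariant parts of positive measure would bring one
  part below the infimum. So \<open>N\<close> conditioned on it is ergodic, and \<open>w > t\<close>
  holds there.\<close>

lemma ergodic_component:
  assumes N: "invariant N" and w: "w \<in> bm" "AE x in N. w (f x) = w x" and pos: "measure N {x \<in> {a..b}. t < w x} > 0"
  obtains \<mu> where "\<mu> \<in> ergodic_acips a b f" "invariant \<mu>" "t \<le> (LINT x|\<mu>. w x)"
proof -
  interpret N: finite_measure N by (rule invariantD(2)[OF N])
  note s = invariantD(1)[OF N] and sp = invariantD(5)[OF N] and int = invariant_integrable[OF N]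
  have Mab: "A \<subseteq> {a..b}" if "A \<in> sets M" for A using sets.sets_into_space[OF that] by simp
  have Ml: "A \<in> sets lebesgue" if "A \<in> sets M" for A using that by (simp add: sets_restrict_space_iff)
  define B0 where "B0 = {x \<in> {a..b}. t < w x}"
  have "{x \<in> space M. t < w x} \<in> sets M" using bm_measurable[OF w(1)] by measurable
  then have B0: "B0 \<in> sets M" by (simp add: B0_def)
  \<comment> \<open>Invariance modulo \<open>N\<close>-null sets, as \<open>w\<close> itself is
    invariant only almost everywhere.\<close>
  define Inv where "Inv B \<longleftrightarrow> B \<in> sets M \<and> (AE x in N. f x \<in> B \<longleftrightarrow> x \<in> B)" for B
  have InvB0: "Inv B0"
    unfolding Inv_def
  proof (intro conjI B0)
    show "AE x in N. f x \<in> B0 \<longleftrightarrow> x \<in> B0"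
      using w(2)
    proof (rule AE_mp, intro AE_I2 impI)
      fix x assume "x \<in> space N" "w (f x) = w x"
      then show "f x \<in> B0 \<longleftrightarrow> x \<in> B0" using f_in[of x] sp by (auto simp: B0_def)
    qed
  qed
  have Inv_big: "1 / C \<le> measure M B" if B: "Inv B" "measure N B > 0" for B
  proof -
    have BM: "B \<in> sets M" using B(1) by (simp add: Inv_def)
    have inv: "AE x in N. f x \<in> B \<longleftrightarrow> x \<in> B" using B(1) by (simp add: Inv_def)
    have i: "indicat_real B \<in> bm" by (rule bm_ind[OF Ml[OF BM]])
    have ae: "AE x in N. (f ^^ k) x \<in> B \<longleftrightarrow> x \<in> B" for k
    proof (induction k)
      case (Suc k)
      have "AE x in N. f ((f ^^ k) x) \<in> B \<longleftrightarrow> (f ^^ k) x \<in> B" by (rule AE_comp_invariant[OF N inv])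
      with Suc show ?case by eventually_elim simp
    qed simp
    have "(LINT x|N. \<bar>indicat_real B ((f ^^ k) x) - indicator B x\<bar>) = (LINT x|N. 0)" for k
    proof (rule integral_cong_AE)
      show "(\<lambda>x. \<bar>indicat_real B ((f ^^ k) x) - indicator B x\<bar>) \<in> borel_measurable N"
        by (intro borel_measurable_integrable int bm_abs bm_diff bm_comp i)
      show "AE x in N. \<bar>indicat_real B ((f ^^ k) x) - indicator B x\<bar> = 0"
        using ae[of k] by eventually_elim (simp add: indicator_def)
    qed simp
    then have "recurrent N (\<lambda>k. k) (indicat_real B)" by (simp add: recurrent_def)
    then have bound: "AE x in N. \<bar>indicat_real B x\<bar> \<le> C * pn (indicat_real B)"
      by (intro recurrent_le_pn[OF N i filterlim_ident])
    have "1 \<le> C * pn (indicat_real B)"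
    proof (rule ccontr)
      assume n: "\<not> 1 \<le> C * pn (indicat_real B)"
      have "AE x in N. x \<notin> B" using bound by eventually_elim (use n in \<open>auto simp: indicator_def split: if_splits\<close>)
      then have "B \<in> null_sets N" using BM s sp Mab[OF BM] by (subst (asm) AE_iff_null_sets[symmetric]) auto
      then show False using B(2) by (simp add: measure_def null_sets_def)
    qed
    also have "\<dots> \<le> C * measure M B"
      using pn_ind_le[OF Ml[OF BM]] measure_M[OF Ml[OF BM]] Mab[OF BM] C0 by (intro mult_left_mono) (auto simp: Int_absorb1)
    finally show ?thesis using C0 by (simp add: field_simps)
  qed
  define S where "S = {measure M B | B. Inv B \<and> B \<subseteq> B0 \<and> measure N B > 0}"
  have "measure M B0 \<in> S" unfolding S_def using InvB0 pos by (auto simp: B0_def)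
  then have Sne: "S \<noteq> {}" by blast
  have Sbd: "bdd_below S" by (rule bdd_belowI[of _ 0]) (auto simp: S_def)
  have "Inf S < Inf S + 1 / C" using C0 by simp
  then obtain m where "m \<in> S" "m < Inf S + 1 / C" using cInf_lessD[OF Sne] by blast
  then obtain B where B: "Inv B" "B \<subseteq> B0" "measure N B > 0" "measure M B < Inf S + 1 / C" by (auto simp: S_def)
  have BM: "B \<in> sets M" using B(1) by (simp add: Inv_def)
  define c where "c = measure N B"
  have c: "c > 0" using B(3) by (simp add: c_def)
  define \<mu> where "\<mu> = density N (\<lambda>x. ennreal (indicator B x / c))"
  have mB: "(\<lambda>x. indicator B x / c) \<in> borel_measurable N" using BM s by auto
  have s\<mu>: "sets \<mu> = sets M" by (simp add: \<mu>_def s)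
  have sp\<mu>: "space \<mu> = {a..b}" by (simp add: \<mu>_def sp)
  have em: "emeasure \<mu> A = ennreal (measure N (A \<inter> B) / c)" if A: "A \<in> sets M" for A
  proof -
    have AN: "A \<in> sets N" "B \<in> sets N" using A BM s by auto
    have "emeasure \<mu> A = (\<integral>\<^sup>+ x. ennreal (1 / c) * indicator (A \<inter> B) x \<partial>N)"
      unfolding \<mu>_def using AN mB by (subst emeasure_density) (auto intro!: nn_integral_cong simp: indicator_def)
    also have "\<dots> = ennreal (1 / c) * emeasure N (A \<inter> B)" using AN by (intro nn_integral_cmult_indicator) auto
    also have "\<dots> = ennreal (measure N (A \<inter> B) / c)"
      using c by (simp add: N.emeasure_eq_measure ennreal_mult[symmetric])
    finally show ?thesis .
  qed
  have prob: "emeasure \<mu> {a..b} = 1"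
    using em[of "{a..b}"] Mab[OF BM] c by (simp add: c_def Int_absorb1 sets_restrict_space_iff)
  have ps: "prob_space \<mu>" by (rule prob_spaceI) (simp add: sp\<mu> prob)
  have ac: "absolutely_continuous M \<mu>"
    unfolding absolutely_continuous_def
  proof
    fix A assume A: "A \<in> null_sets M"
    then have AM: "A \<in> sets M" by auto
    have "A \<in> null_sets N" using A invariantD(3)[OF N] unfolding absolutely_continuous_def by blast
    then have "measure N (A \<inter> B) = 0"
      using null_set_Int1[of A N B] BM s by (simp add: measure_def null_sets_def Int_commute)
    then show "A \<in> null_sets \<mu>" using em[OF AM] AM s\<mu> by (simp add: null_sets_def)
  qed
  have f\<mu>: "f \<in> \<mu> \<rightarrow>\<^sub>M \<mu>" using f_meas measurable_cong_sets[OF s\<mu> s\<mu>] by blast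
  have dist: "distr \<mu> \<mu> f = \<mu>"
  proof (rule measure_eqI)
    fix A assume "A \<in> sets (distr \<mu> \<mu> f)"
    then have A: "A \<in> sets \<mu>" "A \<in> sets M" using s\<mu> by auto
    have AB: "A \<inter> B \<in> sets M" using A BM by auto
    have "measure N (f -` A \<inter> {a..b} \<inter> B) = measure N ((f ^^ 1) -` (A \<inter> B) \<inter> {a..b})"
    proof (rule N.finite_measure_eq_AE)
      have "AE x in N. f x \<in> B \<longleftrightarrow> x \<in> B" using B(1) by (simp add: Inv_def)
      then show "AE x in N. x \<in> f -` A \<inter> {a..b} \<inter> B \<longleftrightarrow> x \<in> (f ^^ 1) -` (A \<inter> B) \<inter> {a..b}"
        by eventually_elim auto
      show "f -` A \<inter> {a..b} \<inter> B \<in> sets N" using f_vimage[OF A(2)] BM s by auto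
      show "(f ^^ 1) -` (A \<inter> B) \<inter> {a..b} \<in> sets N" using fn_vimage[OF AB, of 1] s by auto
    qed
    also have "\<dots> = measure N (A \<inter> B)" by (rule invariant_measure[OF N AB])
    finally have "emeasure \<mu> (f -` A \<inter> {a..b}) = emeasure \<mu> A" using em[OF A(2)] em[OF f_vimage[OF A(2)]] by simp
    then show "emeasure (distr \<mu> \<mu> f) A = emeasure \<mu> A" using emeasure_distr[OF f\<mu> A(1)] sp\<mu> by simp
  qed simp
  have erg: "emeasure \<mu> A = 0 \<or> emeasure \<mu> A = 1" if A: "A \<in> sets \<mu>" "f -` A \<inter> space \<mu> = A" for A
  proof -
    have AM: "A \<in> sets M" using A(1) s\<mu> by simp
    have fA: "f x \<in> A \<longleftrightarrow> x \<in> A" if "x \<in> {a..b}" for x using A(2) that sp\<mu> by auto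
    have invB: "AE x in N. f x \<in> B \<longleftrightarrow> x \<in> B" using B(1) by (simp add: Inv_def)
    have aeA: "AE x in N. f x \<in> A \<longleftrightarrow> x \<in> A" by (rule AE_I2) (simp only: sp fA)
    have "AE x in N. f x \<in> A \<inter> B \<longleftrightarrow> x \<in> A \<inter> B" using aeA invB by eventually_elim auto
    then have i1: "Inv (A \<inter> B)" unfolding Inv_def using AM BM by auto
    have "AE x in N. f x \<in> B - A \<longleftrightarrow> x \<in> B - A" using aeA invB by eventually_elim auto
    then have i2: "Inv (B - A)" unfolding Inv_def using AM BM by auto
    have dB: "(A \<inter> B) \<union> (B - A) = B" by blast
    have sum: "measure M ((A \<inter> B) \<union> (B - A)) = measure M (A \<inter> B) + measure M (B - A)"
      by (rule M.finite_measure_Union) (use AM BM in auto)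
    have "measure N ((A \<inter> B) \<union> (B - A)) = measure N (A \<inter> B) + measure N (B - A)"
      by (rule N.finite_measure_Union) (use AM BM s in auto)
    then have sumN: "c = measure N (A \<inter> B) + measure N (B - A)" unfolding dB c_def .
    have "measure N (A \<inter> B) = 0 \<or> measure N (B - A) = 0"
    proof (rule ccontr)
      assume "\<not> ?thesis"
      then have p: "measure N (A \<inter> B) > 0" "measure N (B - A) > 0" by (auto simp: zero_less_measure_iff)
      have "measure M (A \<inter> B) \<in> S" unfolding S_def using i1 p(1) B(2) by blast
      then have "Inf S \<le> measure M (A \<inter> B)" by (rule cInf_lower[OF _ Sbd])
      moreover have "1 / C \<le> measure M (B - A)" by (rule Inv_big[OF i2 p(2)])
      ultimately show False using sum[unfolded dB] B(4) by linarith
    qed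
    then show ?thesis
    proof
      assume "measure N (A \<inter> B) = 0"
      then show ?thesis using em[OF AM] by simp
    next
      assume "measure N (B - A) = 0"
      then show ?thesis using em[OF AM] sumN c by simp
    qed
  qed
  have "\<mu> \<in> ergodic_acips a b f"
    unfolding ergodic_acips_def using s\<mu> ps ac f\<mu> dist erg by blast
  moreover have "invariant \<mu>"
    unfolding invariant_def using s\<mu> ac dist prob_space.finite_measure[OF ps] by blast
  moreover have "t \<le> (LINT x|\<mu>. w x)"
  proof -
    have i: "indicat_real B \<in> bm" by (rule bm_ind[OF Ml[OF BM]])
    have "(LINT x|\<mu>. w x) = (LINT x|N. (indicator B x / c) * w x)"
      unfolding \<mu>_def using invariant_measurable[OF N bm_measurable[OF w(1)]] mB c
      by (subst integral_density) auto
    moreover have "(LINT x|N. (t / c) * indicator B x) \<le> (LINT x|N. (indicator B x / c) * w x)"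
    proof (rule integral_mono)
      show "integrable N (\<lambda>x. (t / c) * indicator B x)" by (intro int bm_cmult i)
      show "integrable N (\<lambda>x. (indicator B x / c) * w x)"
        using int[OF bm_cmult[OF bm_mult[OF i w(1)], of "1 / c"]] by simp
      fix x
      show "(t / c) * indicator B x \<le> (indicator B x / c) * w x"
        using B(2) c by (auto simp: indicator_def B0_def divide_right_mono)
    qed
    moreover have "(LINT x|N. (t / c) * indicator B x) = t"
      using c Mab[OF BM] sp by (simp add: c_def Int_absorb2)
    ultimately show ?thesis by simp
  qed
  ultimately show ?thesis using that by blast
qed

lemma ergodic_acips_invariant:
  "\<mu> \<in> ergodic_acips a b f \<Longrightarrow> invariant \<mu>"
  by (auto simp: ergodic_acips_def invariant_def prob_space.finite_measure)

text \<open>An accumulation point \<open>h\<close> of the orbit of \<phi> is recurrent, so it has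
  period \<open>p\<close> and its block sum \<open>A h\<close> is invariant. If \<open>A h\<close>
  were positive on a set of positive measure, some ergodic component would give it a positive
  integral, against the hypothesis on \<phi>; so \<open>A h\<close> vanishes \<open>N\<close>-almost
  everywhere and its orbit decays. As \<open>A h\<close> also returns to itself in norm, its norm is
  zero. The orbit of \<open>A \<phi>\<close> is therefore small along a subsequence, and by
  \<open>power_bound\<close> from some time on.\<close>

lemma Birkhoff_block_decay:
  "\<exists>p\<ge>1. \<forall>\<phi>\<in>bm. (\<forall>\<mu>\<in>ergodic_acips a b f. (LINT x|\<mu>. \<phi> x) = 0) \<longrightarrow>
     (\<lambda>n. pn (\<lambda>x. \<Sum>j<p. \<phi> ((f ^^ j) ((f ^^ n) x)))) \<longlonglongrightarrow> 0"
proof -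
  obtain N where N: "invariant N" "\<And>Z. \<lbrakk>Z \<in> sets M; f -` Z \<inter> {a..b} = Z\<rbrakk> \<Longrightarrow> measure N Z = measure M Z"
    using invariant_exists by metis
  interpret N: finite_measure N by (rule invariantD(2)[OF N(1)])
  note sp = invariantD(5)[OF N(1)] and sN = invariantD(1)[OF N(1)]
  obtain K where K: "1 \<le> K" "\<And>n g. g \<in> bm \<Longrightarrow> pn (\<lambda>x. g ((f ^^ n) x)) \<le> K * pn g" using power_bound by blast
  obtain p where p: "p \<ge> 1" "\<And>N d h. \<lbrakk>invariant N; filterlim d at_top sequentially; h \<in> bm; recurrent N d h\<rbrakk> \<Longrightarrow>
     (AE x in N. h ((f ^^ p) x) = h x)" using recurrent_periodic by blast
  define A where "A g x = (\<Sum>j<p. g ((f ^^ j) x))" for g :: "real \<Rightarrow> real" and x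
  have A: "A g \<in> bm" if "g \<in> bm" for g unfolding A_def by (intro bm_sum bm_comp that)
  have Apn: "pn (A g) \<le> real p * K * pn g" if g: "g \<in> bm" for g
  proof -
    have "pn (A g) \<le> (\<Sum>j<p. pn (\<lambda>x. g ((f ^^ j) x)))" unfolding A_def by (intro pn_sum bm_comp g) auto
    also have "\<dots> \<le> (\<Sum>j<p. K * pn g)" by (intro sum_mono K(2) g)
    finally show ?thesis by simp
  qed
  have comm: "(f ^^ j) ((f ^^ n) x) = (f ^^ n) ((f ^^ j) x)" for j n x by (metis add.commute comp_apply funpow_add)
  have nonpos: "AE x in N. A h x \<le> 0"
    if \<phi>: "\<phi> \<in> bm" "\<And>\<mu>. \<mu> \<in> ergodic_acips a b f \<Longrightarrow> (LINT x|\<mu>. \<phi> x) = 0"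
      and h: "h \<in> bm" "AE x in N. h ((f ^^ p) x) = h x" and lim: "(\<lambda>n. pn (\<lambda>x. \<phi> ((f ^^ k n) x) - h x)) \<longlonglongrightarrow> 0" for \<phi> h and k :: "nat \<Rightarrow> nat"
  proof (rule ccontr)
    assume *: "\<not> (AE x in N. A h x \<le> 0)"
    \<comment> \<open>Shifting the block by one step exchanges \<open>h x\<close> for
      \<open>h ((f ^^ p) x)\<close>.\<close>
    have inv: "AE x in N. A h (f x) = A h x"
      using h(2)
    proof eventually_elim
      fix x assume hp: "h ((f ^^ p) x) = h x"
      have "A h (f x) = (\<Sum>j<p. h ((f ^^ Suc j) x))" unfolding A_def by (simp add: funpow_Suc_right del: funpow.simps)
      also have "\<dots> = (\<Sum>j<Suc p. h ((f ^^ j) x)) - h x" unfolding sum.lessThan_Suc_shift by simp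
      also have "\<dots> = A h x" using hp by (simp add: A_def)
      finally show "A h (f x) = A h x" .
    qed
    have "\<exists>n::nat. measure N {x \<in> {a..b}. 1 / Suc n < A h x} > 0"
    proof (rule ccontr)
      assume "\<not> ?thesis"
      then have z: "measure N {x \<in> {a..b}. 1 / Suc n < A h x} = 0" for n :: nat by (simp add: zero_less_measure_iff)
      have "AE x in N. A h x \<le> 1 / Suc n" for n :: nat
      proof -
        have "{x \<in> space M. 1 / Suc n < A h x} \<in> sets M" using bm_measurable[OF A[OF h(1)]] by measurable
        then have "{x \<in> {a..b}. 1 / Suc n < A h x} \<in> null_sets N" using z[of n] sN by (simp add: null_sets_def N.emeasure_eq_measure)
        then show ?thesis by (rule AE_I') (auto simp: sp)
      qed
      then have "AE x in N. \<forall>n::nat. A h x \<le> 1 / Suc n" by (simp add: AE_all_countable)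
      then have "AE x in N. A h x \<le> 0"
      proof eventually_elim
        fix x assume le: "\<forall>n::nat. A h x \<le> 1 / Suc n"
        show "A h x \<le> 0"
          using LIMSEQ_le_const[OF LIMSEQ_inverse_real_of_nat, of "A h x"] le by (auto simp: inverse_eq_divide)
      qed
      then show False using * by blast
    qed
    then obtain n :: nat where pos: "measure N {x \<in> {a..b}. 1 / Suc n < A h x} > 0" by blast
    obtain \<mu> where \<mu>: "\<mu> \<in> ergodic_acips a b f" "invariant \<mu>" "1 / Suc n \<le> (LINT x|\<mu>. A h x)"
      by (rule ergodic_component[OF N(1) A[OF h(1)] inv pos]) (rule that)
    \<comment> \<open>By invariance of \<mu> the hypothesis on \<phi> holds for all translates; weak
      convergence will pass it on to \<open>h\<close>.\<close>
    have zero: "(LINT x|\<mu>. A (\<lambda>x. \<phi> ((f ^^ k n) x)) x) = 0" for n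
    proof -
      have "(LINT x|\<mu>. A (\<lambda>x. \<phi> ((f ^^ k n) x)) x) = (\<Sum>j<p. LINT x|\<mu>. \<phi> ((f ^^ k n) ((f ^^ j) x)))"
        unfolding A_def
      proof (rule Bochner_Integration.integral_sum)
        fix j
        show "integrable \<mu> (\<lambda>x. \<phi> ((f ^^ k n) ((f ^^ j) x)))"
          by (rule invariant_integrable[OF \<mu>(2) bm_comp[OF bm_comp[OF \<phi>(1)]]])
      qed
      also have "\<dots> = 0"
        using invariant_integral[OF \<mu>(2) bm_comp[OF \<phi>(1)]] invariant_integral[OF \<mu>(2) \<phi>(1)] \<phi>(2)[OF \<mu>(1)] by simp
      finally show ?thesis .
    qed
    obtain B where Bd: "B > 0" "\<And>x. x \<in> {a..b} \<Longrightarrow> \<bar>\<phi> x\<bar> \<le> B" using bmE[OF \<phi>(1)] by blast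
    obtain B' where B': "B' > 0" "\<And>x. x \<in> {a..b} \<Longrightarrow> \<bar>h x\<bar> \<le> B'" using bmE[OF h(1)] by blast
    let ?g = "\<lambda>n. A (\<lambda>x. \<phi> ((f ^^ k n) x) - h x)"
    have g: "?g n \<in> bm" for n by (intro A bm_diff bm_comp \<phi> h)
    have gB: "\<bar>?g n x\<bar> \<le> real p * (B + B')" if x: "x \<in> {a..b}" for n x
    proof -
      have "\<bar>?g n x\<bar> \<le> (\<Sum>j<p. \<bar>\<phi> ((f ^^ k n) ((f ^^ j) x)) - h ((f ^^ j) x)\<bar>)" unfolding A_def by (rule sum_abs)
      also have "\<dots> \<le> (\<Sum>j<p. B + B')"
      proof (rule sum_mono)
        fix j
        show "\<bar>\<phi> ((f ^^ k n) ((f ^^ j) x)) - h ((f ^^ j) x)\<bar> \<le> B + B'"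
          using Bd(2)[OF fn_in[OF fn_in[OF x, of j], of "k n"]] B'(2)[OF fn_in[OF x, of j]] by linarith
      qed
      finally show ?thesis by simp
    qed
    have gl: "(\<lambda>n. pn (?g n)) \<longlonglongrightarrow> 0"
    proof (rule Lim_null_comparison)
      show "\<forall>\<^sub>F n in sequentially. norm (pn (?g n)) \<le> real p * K * pn (\<lambda>x. \<phi> ((f ^^ k n) x) - h x)"
        using Apn[OF bm_diff[OF bm_comp[OF \<phi>(1)] h(1)]] pn_nonneg[OF g] by (intro always_eventually allI) simp
    qed (rule tendsto_mult_right_zero[OF lim])
    have "(\<lambda>n. LINT x|\<mu>. 1 * ?g n x) \<longlonglongrightarrow> 0"
      by (rule weakly_null_measure[OF invariantD(1-3)[OF \<mu>(2)] g gB gl bm_const])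
    moreover have "(LINT x|\<mu>. ?g n x) = - (LINT x|\<mu>. A h x)" for n
    proof -
      have "?g n x = A (\<lambda>x. \<phi> ((f ^^ k n) x)) x - A h x" for x by (simp add: A_def sum_subtractf)
      then have "(LINT x|\<mu>. ?g n x) = (LINT x|\<mu>. A (\<lambda>x. \<phi> ((f ^^ k n) x)) x) - (LINT x|\<mu>. A h x)"
        using invariant_integrable[OF \<mu>(2) A[OF bm_comp[OF \<phi>(1), of "k n"]]] invariant_integrable[OF \<mu>(2) A[OF h(1)]] by simp
      then show ?thesis using zero by simp
    qed
    ultimately have "(\<lambda>n::nat. - (LINT x|\<mu>. A h x)) \<longlonglongrightarrow> 0" by simp
    then have "(LINT x|\<mu>. A h x) = 0" using LIMSEQ_unique[OF tendsto_const] by fastforce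
    moreover have "0 < 1 / real (Suc n)" by simp
    ultimately show False using \<mu>(3) by linarith
  qed
  show ?thesis
  proof (intro exI[of _ p] conjI p(1) ballI impI)
    fix \<phi> assume \<phi>: "\<phi> \<in> bm" and z: "\<forall>\<mu>\<in>ergodic_acips a b f. (LINT x|\<mu>. \<phi> x) = 0"
    obtain B where Bd: "B > 0" "\<And>x. x \<in> {a..b} \<Longrightarrow> \<bar>\<phi> x\<bar> \<le> B" using bmE[OF \<phi>] by blast
    have u: "(\<lambda>x. \<phi> ((f ^^ n) x)) \<in> bm" "\<And>x. x \<in> {a..b} \<Longrightarrow> \<bar>\<phi> ((f ^^ n) x)\<bar> \<le> B" for n
      using bm_comp[OF \<phi>] Bd fn_in by blast+
    obtain k :: "nat \<Rightarrow> nat" and h where k: "strict_mono k" and h: "h \<in> bm" "\<And>x. x \<in> {a..b} \<Longrightarrow> \<bar>h x\<bar> \<le> B"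
      and lim: "(\<lambda>n. pn (\<lambda>x. \<phi> ((f ^^ k n) x) - h x)) \<longlonglongrightarrow> 0"
      by (rule pn_compact[of "\<lambda>n x. \<phi> ((f ^^ n) x)" B, OF u]) (assumption, rule that)
    have "\<exists>d\<ge>i. pn (\<lambda>x. h ((f ^^ d) x) - h x) \<le> (K + 1) * inverse (real (Suc i))" for i
    proof -
      have pi: "0 < inverse (real (Suc i))" by simp
      obtain n0 where n0: "\<And>n. n \<ge> n0 \<Longrightarrow> pn (\<lambda>x. \<phi> ((f ^^ k n) x) - h x) < inverse (real (Suc i))"
        using LIMSEQ_D[OF lim pi] by fastforce
      \<comment> \<open>The difference of two times at which the orbit is near \<open>h\<close>: an
        orbit that starts near \<open>h\<close> is back after \<open>d\<close> steps. As
        \<open>k\<close> is strictly increasing, \<open>d \<ge> i\<close>.\<close>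
      define d where "d = k (n0 + i) - k n0"
      have ki: "k n0 + i \<le> k (n0 + i)" for i
      proof (induction i)
        case (Suc i)
        have "k (n0 + i) < k (n0 + Suc i)" using k by (simp add: strict_mono_def)
        then show ?case using Suc by linarith
      qed simp
      have d: "d \<ge> i" "k n0 + d = k (n0 + i)" using ki[of i] by (auto simp: d_def)
      let ?r = "\<lambda>x. \<phi> ((f ^^ k n0) x) - h x"
      have r: "?r \<in> bm" by (intro bm_diff u h)
      have "pn (\<lambda>x. h ((f ^^ d) x) - h x) = pn (\<lambda>x. (\<phi> ((f ^^ k (n0 + i)) x) - h x) - ?r ((f ^^ d) x))"
        by (rule arg_cong[where f=pn]) (simp add: d(2)[symmetric] funpow_add)
      also have "\<dots> \<le> pn (\<lambda>x. \<phi> ((f ^^ k (n0 + i)) x) - h x) + pn (\<lambda>x. ?r ((f ^^ d) x))"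
        by (intro pn_diff bm_diff u h bm_comp[OF r])
      also have "\<dots> \<le> inverse (real (Suc i)) + K * inverse (real (Suc i))"
      proof (rule add_mono)
        show "pn (\<lambda>x. \<phi> ((f ^^ k (n0 + i)) x) - h x) \<le> inverse (real (Suc i))" using n0[of "n0 + i"] by simp
        have "K * pn ?r \<le> K * inverse (real (Suc i))" using K(1) n0[of n0] by (intro mult_left_mono) auto
        then show "pn (\<lambda>x. ?r ((f ^^ d) x)) \<le> K * inverse (real (Suc i))" using K(2)[OF r, of d] by linarith
      qed
      finally show ?thesis using d(1) by (intro exI[of _ d]) (auto simp: algebra_simps)
    qed
    then obtain d where d: "\<And>i. d i \<ge> i" "\<And>i. pn (\<lambda>x. h ((f ^^ d i) x) - h x) \<le> (K + 1) * inverse (real (Suc i))" by metis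
    have dinf: "filterlim d at_top sequentially"
      by (rule filterlim_at_top_mono[OF filterlim_ident]) (use d(1) in auto)
    have hl: "(\<lambda>i. pn (\<lambda>x. h ((f ^^ d i) x) - h x)) \<longlonglongrightarrow> 0"
    proof (rule Lim_null_comparison)
      show "\<forall>\<^sub>F i in sequentially. norm (pn (\<lambda>x. h ((f ^^ d i) x) - h x)) \<le> (K + 1) * inverse (real (Suc i))"
        using d(2) pn_nonneg[OF bm_diff[OF bm_comp[OF h(1)] h(1)]] by (intro always_eventually allI) simp
    qed (rule tendsto_mult_right_zero[OF LIMSEQ_inverse_real_of_nat])
    have hp: "AE x in N. h ((f ^^ p) x) = h x"
      by (rule p(2)[OF N(1) dinf h(1) recurrentI[OF N(1) h(1) hl]])
    have A0: "AE x in N. A h x \<le> 0"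
      by (rule nonpos[OF \<phi> _ h(1) hp lim]) (use z in blast)
    \<comment> \<open>The one-sided statement for \<open>- \<phi>\<close> and \<open>- h\<close>
      gives the opposite inequality.\<close>
    have A1: "AE x in N. A (\<lambda>x. - 1 * h x) x \<le> 0"
    proof (rule nonpos[of "\<lambda>x. - 1 * \<phi> x"])
      show "(\<lambda>x. - 1 * \<phi> x) \<in> bm" "(\<lambda>x. - 1 * h x) \<in> bm" using bm_cmult[OF \<phi>, of "-1"] bm_cmult[OF h(1), of "-1"] by auto
      show "(LINT x|\<mu>. - 1 * \<phi> x) = 0" if "\<mu> \<in> ergodic_acips a b f" for \<mu> using z that by simp
      show "AE x in N. - 1 * h ((f ^^ p) x) = - 1 * h x" using hp by simp
      have "(\<lambda>x. - 1 * \<phi> ((f ^^ k n) x) - - 1 * h x) = (\<lambda>x. h x - \<phi> ((f ^^ k n) x))" for n by auto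
      then show "(\<lambda>n. pn (\<lambda>x. - 1 * \<phi> ((f ^^ k n) x) - - 1 * h x)) \<longlonglongrightarrow> 0"
        using lim pn_diff_commute[of h] by simp
    qed
    have w0: "AE x in N. A h x = 0"
      using A0 A1 by eventually_elim (simp add: A_def sum_negf)
    have tr: "(\<lambda>n. pn (\<lambda>x. A h ((f ^^ n) x))) \<longlonglongrightarrow> 0" by (rule transient[OF N A[OF h(1)] w0])
    \<comment> \<open>\<open>A h\<close> is close to its translate by \<open>d i\<close> because
      \<open>h\<close> is, and the translate tends to zero.\<close>
    have "pn (A h) \<le> pn (\<lambda>x. A h ((f ^^ d i) x)) + real p * K * pn (\<lambda>x. h ((f ^^ d i) x) - h x)" for i
    proof -
      have "pn (A h) \<le> pn (\<lambda>x. A h ((f ^^ d i) x)) + pn (\<lambda>x. A h x - A h ((f ^^ d i) x))"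
        by (intro pn_triangle A bm_comp[OF A] h)
      also have "pn (\<lambda>x. A h x - A h ((f ^^ d i) x)) = pn (A (\<lambda>x. h ((f ^^ d i) x) - h x))"
        by (subst pn_diff_commute) (rule arg_cong[where f=pn], auto simp: A_def sum_subtractf comm[of _ "d i"])
      also have "\<dots> \<le> real p * K * pn (\<lambda>x. h ((f ^^ d i) x) - h x)" by (intro Apn bm_diff bm_comp h)
      finally show ?thesis by simp
    qed
    moreover have "(\<lambda>i. pn (\<lambda>x. A h ((f ^^ d i) x)) + real p * K * pn (\<lambda>x. h ((f ^^ d i) x) - h x)) \<longlonglongrightarrow> 0 + 0"
      by (intro tendsto_add filterlim_compose[OF tr dinf] tendsto_mult_right_zero hl)
    ultimately have "pn (A h) \<le> 0" using LIMSEQ_le_const by fastforce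
    have small: "pn (\<lambda>x. A \<phi> ((f ^^ k n) x)) \<le> real p * K * pn (\<lambda>x. \<phi> ((f ^^ k n) x) - h x)" for n
    proof -
      have "pn (\<lambda>x. A \<phi> ((f ^^ k n) x)) \<le> pn (A h) + pn (\<lambda>x. A \<phi> ((f ^^ k n) x) - A h x)"
        by (intro pn_triangle bm_comp[OF A] A \<phi> h)
      also have "(\<lambda>x. A \<phi> ((f ^^ k n) x) - A h x) = A (\<lambda>x. \<phi> ((f ^^ k n) x) - h x)"
        by (auto simp: A_def sum_subtractf comm[of _ "k n"])
      also have "pn \<dots> \<le> real p * K * pn (\<lambda>x. \<phi> ((f ^^ k n) x) - h x)" by (intro Apn bm_diff bm_comp h \<phi>)
      finally show ?thesis using \<open>pn (A h) \<le> 0\<close> by linarith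
    qed
    have "(\<lambda>n. pn (\<lambda>x. A \<phi> ((f ^^ n) x))) \<longlonglongrightarrow> 0"
    proof (rule LIMSEQ_I)
      fix r :: real assume r: "0 < r"
      have "(\<lambda>n. K * (real p * K * pn (\<lambda>x. \<phi> ((f ^^ k n) x) - h x))) \<longlonglongrightarrow> 0"
        by (intro tendsto_mult_right_zero lim)
      from LIMSEQ_D[OF this r] obtain n0 where
        "\<forall>n\<ge>n0. norm (K * (real p * K * pn (\<lambda>x. \<phi> ((f ^^ k n) x) - h x)) - 0) < r" by blast
      then have "norm (K * (real p * K * pn (\<lambda>x. \<phi> ((f ^^ k n0) x) - h x)) - 0) < r" by blast
      then have n0: "K * (real p * K * pn (\<lambda>x. \<phi> ((f ^^ k n0) x) - h x)) < r"
        unfolding real_norm_def diff_0_right by (rule order_le_less_trans[OF abs_ge_self])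
      have "pn (\<lambda>x. A \<phi> ((f ^^ n) x)) < r" if n: "n \<ge> k n0" for n
      proof -
        have eq: "(f ^^ n) x = (f ^^ k n0) ((f ^^ (n - k n0)) x)" for x
          using n by (metis comp_apply funpow_add le_add_diff_inverse)
        have "pn (\<lambda>x. A \<phi> ((f ^^ n) x)) \<le> K * pn (\<lambda>x. A \<phi> ((f ^^ k n0) x))"
          unfolding eq by (rule K(2)[OF bm_comp[OF A[OF \<phi>]]])
        also have "\<dots> \<le> K * (real p * K * pn (\<lambda>x. \<phi> ((f ^^ k n0) x) - h x))"
          using K(1) by (intro mult_left_mono small) auto
        finally show ?thesis using n0 by linarith
      qed
      then show "\<exists>n0. \<forall>n\<ge>n0. norm (pn (\<lambda>x. A \<phi> ((f ^^ n) x)) - 0) < r"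
        using pn_nonneg[OF bm_comp[OF A[OF \<phi>]]] by (intro exI[of _ "k n0"]) simp
    qed
    then show "(\<lambda>n. pn (\<lambda>x. \<Sum>j<p. \<phi> ((f ^^ j) ((f ^^ n) x)))) \<longlonglongrightarrow> 0" by (simp only: A_def)
  qed
qed

section \<open>Exponential decay\<close>

text \<open>Total boundedness makes the convergence uniform; the Lasota--Yorke splitting \<open>v \<circ> f ^^ N = h1 + h2\<close>
  then reduces the norm by a fixed factor, because \<open>h1\<close> is small and \<open>h2\<close> lies in a fixed ball and
  inherits from \<open>v\<close> an orbit that becomes small.\<close>
lemma uniform_contraction:
  "\<exists>L\<ge>1. \<forall>v\<in>bm. (\<lambda>n. pn (\<lambda>x. v ((f ^^ n) x))) \<longlonglongrightarrow> 0 \<longrightarrow> pn v \<le> 1 \<longrightarrow> pn (\<lambda>x. v ((f ^^ L) x)) \<le> 1 / 2"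
proof -
  obtain K where K: "1 \<le> K" "\<And>n g. g \<in> bm \<Longrightarrow> pn (\<lambda>x. g ((f ^^ n) x)) \<le> K * pn g" using power_bound by blast
  \<comment> \<open>Solved from the final estimate, whose total error
    \<open>\<delta> * (4 * K + 2 * K * K)\<close> is to equal 1/2.\<close>
  define \<delta> where "\<delta> = 1 / (2 * (4 * K + 2 * K * K))"
  have KK: "0 < 4 * K + 2 * K * K" using K(1) by (intro add_pos_nonneg) auto
  have d: "\<delta> > 0" "\<delta> * (4 * K + 2 * K * K) = 1 / 2"
    using KK by (simp add: \<delta>_def) (use KK in \<open>simp add: \<delta>_def\<close>)
  obtain N0 where N0: "\<And>n. n \<ge> N0 \<Longrightarrow> e n < \<delta>" using LIMSEQ_D[OF e0 d(1)] by fastforce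
  define N where "N = Suc N0"
  have eN: "e N \<le> \<delta>" using N0[of N] by (simp add: N_def)
  define S where "S = {g \<in> bm. \<forall>x\<in>{a..b}. \<bar>g x\<bar> \<le> C}"
  have "\<exists>lab :: (real \<Rightarrow> real) \<Rightarrow> nat \<Rightarrow> int. finite (lab ` S) \<and> (\<forall>g\<in>S. \<forall>h\<in>S. lab g = lab h \<longrightarrow> pn (\<lambda>x. g x - h x) \<le> \<delta>)"
  proof (rule pn_net[of C \<delta>])
    fix lab :: "(real \<Rightarrow> real) \<Rightarrow> nat \<Rightarrow> int"
    assume 1: "finite (lab ` {g \<in> bm. \<forall>x\<in>{a..b}. \<bar>g x\<bar> \<le> C})"
      and 2: "\<And>g h. \<lbrakk>g \<in> bm; h \<in> bm; \<And>x. x \<in> {a..b} \<Longrightarrow> \<bar>g x\<bar> \<le> C; \<And>x. x \<in> {a..b} \<Longrightarrow> \<bar>h x\<bar> \<le> C; lab g = lab h\<rbrakk>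
       \<Longrightarrow> pn (\<lambda>x. g x - h x) \<le> \<delta>"
    have "pn (\<lambda>x. g x - h x) \<le> \<delta>" if "g \<in> S" "h \<in> S" "lab g = lab h" for g h
      using that by (intro 2) (auto simp: S_def)
    then show ?thesis using 1 by (auto simp: S_def)
  qed (use C0 d in auto)
  then obtain lab :: "(real \<Rightarrow> real) \<Rightarrow> nat \<Rightarrow> int" where fin: "finite (lab ` S)"
    and sep: "\<And>g h. \<lbrakk>g \<in> S; h \<in> S; lab g = lab h\<rbrakk> \<Longrightarrow> pn (\<lambda>x. g x - h x) \<le> \<delta>" by blast
  define rep where "rep l = (SOME g. g \<in> S \<and> lab g = l)" for l
  have rep: "rep (lab g) \<in> S" "lab (rep (lab g)) = lab g" if "g \<in> S" for g
    using someI_ex[of "\<lambda>h. h \<in> S \<and> lab h = lab g"] that unfolding rep_def by blast+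
  have Sbm: "g \<in> bm" if "g \<in> S" for g using that by (simp add: S_def)
  \<comment> \<open>A representative need not have a decaying orbit itself. What can be bounded, by
    comparison with a nearby \<open>h2\<close>, is the infimum of the norm along its orbit;
    \<open>m\<close> selects a time that nearly attains it.\<close>
  define s where "s g = Inf (range (\<lambda>n. pn (\<lambda>x. g ((f ^^ n) x))))" for g
  have sle: "s g \<le> pn (\<lambda>x. g ((f ^^ n) x))" if "g \<in> bm" for g n
    unfolding s_def by (rule cInf_lower) (auto intro!: bdd_belowI[of _ 0] pn_nonneg bm_comp that)
  have "\<exists>m. pn (\<lambda>x. g ((f ^^ m) x)) < s g + \<delta>" for g
    using cInf_lessD[of "range (\<lambda>n. pn (\<lambda>x. g ((f ^^ n) x)))" "s g + \<delta>"] d(1) unfolding s_def by auto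
  then obtain m where m: "\<And>g. pn (\<lambda>x. g ((f ^^ m g) x)) < s g + \<delta>" by metis
  \<comment> \<open>A sum in place of a maximum: any common upper bound for the finitely many times
    will do.\<close>
  define n0 where "n0 = (\<Sum>l\<in>lab ` S. m (rep l))"
  have mn0: "m (rep (lab g)) \<le> n0" if "g \<in> S" for g
    unfolding n0_def by (rule member_le_sum[of "lab g" _ "\<lambda>l. m (rep l)"]) (use fin that in auto)
  show ?thesis
  proof (intro exI[of _ "N + n0"] conjI ballI impI)
    show "1 \<le> N + n0" by (simp add: N_def)
    fix v assume v: "v \<in> bm" and lim: "(\<lambda>n. pn (\<lambda>x. v ((f ^^ n) x))) \<longlonglongrightarrow> 0" and v1: "pn v \<le> 1"
    obtain h1 h2 where h: "h1 \<in> bm" "h2 \<in> bm" "\<And>x. v ((f ^^ N) x) = h1 x + h2 x"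
      "pn h1 \<le> e N * pn v" "\<And>x. x \<in> {a..b} \<Longrightarrow> \<bar>h2 x\<bar> \<le> C * pn v" using LY[OF v, of N] by blast
    have pv: "0 \<le> pn v" by (rule pn_nonneg[OF v])
    have "e N * pn v \<le> \<delta> * pn v" using eN pv by (rule mult_right_mono)
    also have "\<dots> \<le> \<delta> * 1" using v1 d by (intro mult_left_mono) auto
    finally have h1d: "pn h1 \<le> \<delta>" using h(4) by linarith
    have "C * pn v \<le> C * 1" using v1 C0 by (intro mult_left_mono) auto
    then have hS: "h2 \<in> S" unfolding S_def using h(2,5) by fastforce
    define r where "r = rep (lab h2)"
    have r: "r \<in> S" "lab r = lab h2" "m r \<le> n0" using rep[OF hS] mn0[OF hS] by (auto simp: r_def)
    have rb: "r \<in> bm" by (rule Sbm[OF r(1)])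
    have hr: "pn (\<lambda>x. h2 x - r x) \<le> \<delta>" by (rule sep[OF hS r(1)]) (simp add: r(2))
    have Khr: "pn (\<lambda>x. h2 ((f ^^ n) x) - r ((f ^^ n) x)) \<le> K * \<delta>" for n
      using K(2)[OF bm_diff[OF h(2) rb], of n] mult_left_mono[OF hr, of K] K(1) by linarith
    have Kh1: "pn (\<lambda>x. h1 ((f ^^ n) x)) \<le> K * \<delta>" for n
      using K(2)[OF h(1), of n] mult_left_mono[OF h1d, of K] K(1) by linarith
    have vN: "v ((f ^^ (N + n)) x) = h1 ((f ^^ n) x) + h2 ((f ^^ n) x)" for n x
      using h(3)[of "(f ^^ n) x"] by (simp add: funpow_add)
    \<comment> \<open>\<open>n1\<close> depends on \<open>v\<close>, but it serves only to bound
      \<open>s r\<close>, in which no time appears.\<close>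
    obtain n1 where n1: "\<And>n. n \<ge> n1 \<Longrightarrow> pn (\<lambda>x. v ((f ^^ n) x)) < \<delta>" using LIMSEQ_D[OF lim d(1)] by fastforce
    have h2small: "pn (\<lambda>x. h2 ((f ^^ n1) x)) \<le> \<delta> + K * \<delta>"
    proof -
      have "pn (\<lambda>x. h2 ((f ^^ n1) x)) = pn (\<lambda>x. v ((f ^^ (N + n1)) x) - h1 ((f ^^ n1) x))"
        by (simp add: vN)
      also have "\<dots> \<le> pn (\<lambda>x. v ((f ^^ (N + n1)) x)) + pn (\<lambda>x. h1 ((f ^^ n1) x))"
        by (intro pn_diff bm_comp v h)
      finally show ?thesis using n1[of "N + n1"] Kh1[of n1] by simp
    qed
    have "s r \<le> pn (\<lambda>x. r ((f ^^ n1) x))" by (rule sle[OF rb])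
    also have "\<dots> \<le> pn (\<lambda>x. h2 ((f ^^ n1) x)) + pn (\<lambda>x. r ((f ^^ n1) x) - h2 ((f ^^ n1) x))"
      by (intro pn_triangle bm_comp rb h)
    also have "\<dots> \<le> (\<delta> + K * \<delta>) + K * \<delta>"
      using h2small Khr[of n1] pn_diff_commute[of "\<lambda>x. r ((f ^^ n1) x)" "\<lambda>x. h2 ((f ^^ n1) x)"] by linarith
    finally have sr: "s r \<le> \<delta> + 2 * K * \<delta>" by simp
    have eq: "(f ^^ n0) x = (f ^^ m r) ((f ^^ (n0 - m r)) x)" for x
      using r(3) by (metis comp_apply funpow_add le_add_diff_inverse)
    have "pn (\<lambda>x. r ((f ^^ n0) x)) \<le> K * pn (\<lambda>x. r ((f ^^ m r) x))"
      unfolding eq by (rule K(2)[OF bm_comp[OF rb]])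
    also have "\<dots> \<le> K * (2 * \<delta> + 2 * K * \<delta>)" using m[of r] sr K(1) by (intro mult_left_mono) auto
    finally have rn0: "pn (\<lambda>x. r ((f ^^ n0) x)) \<le> K * (2 * \<delta> + 2 * K * \<delta>)" .
    have "pn (\<lambda>x. h2 ((f ^^ n0) x)) \<le> pn (\<lambda>x. r ((f ^^ n0) x)) + pn (\<lambda>x. h2 ((f ^^ n0) x) - r ((f ^^ n0) x))"
      by (intro pn_triangle bm_comp rb h)
    then have "pn (\<lambda>x. h2 ((f ^^ n0) x)) \<le> K * (2 * \<delta> + 2 * K * \<delta>) + K * \<delta>" using rn0 Khr[of n0] by linarith
    moreover have "pn (\<lambda>x. v ((f ^^ (N + n0)) x)) \<le> pn (\<lambda>x. h1 ((f ^^ n0) x)) + pn (\<lambda>x. h2 ((f ^^ n0) x))"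
      unfolding vN by (intro pn_add bm_comp h)
    ultimately have "pn (\<lambda>x. v ((f ^^ (N + n0)) x)) \<le> K * \<delta> + (K * (2 * \<delta> + 2 * K * \<delta>) + K * \<delta>)"
      using Kh1[of n0] by linarith
    also have "\<dots> = \<delta> * (4 * K + 2 * K * K)" by (simp add: algebra_simps)
    finally show "pn (\<lambda>x. v ((f ^^ (N + n0)) x)) \<le> 1 / 2" using d(2) by simp
  qed
qed

text \<open>Homogeneity removes the normalisation \<open>pn v \<le> 1\<close>, and translates of a
  function with decaying orbit again have decaying orbits, so the contraction by 1/2 over
  \<open>L\<close> steps can be repeated.\<close>

theorem exponential_decay:
  "\<exists>K \<rho>. 0 < K \<and> 0 < \<rho> \<and> \<rho> < 1 \<and> (\<forall>v\<in>bm. (\<lambda>n. pn (\<lambda>x. v ((f ^^ n) x))) \<longlonglongrightarrow> 0 \<longrightarrow>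
     (\<forall>n. pn (\<lambda>x. v ((f ^^ n) x)) \<le> K * \<rho> ^ n * pn v))"
proof -
  obtain K where K: "1 \<le> K" "\<And>n g. g \<in> bm \<Longrightarrow> pn (\<lambda>x. g ((f ^^ n) x)) \<le> K * pn g" using power_bound by blast
  obtain L where L: "L \<ge> 1" "\<And>v. \<lbrakk>v \<in> bm; (\<lambda>n. pn (\<lambda>x. v ((f ^^ n) x))) \<longlonglongrightarrow> 0; pn v \<le> 1\<rbrakk> \<Longrightarrow> pn (\<lambda>x. v ((f ^^ L) x)) \<le> 1 / 2"
    using uniform_contraction by blast
  have step: "pn (\<lambda>x. v ((f ^^ L) x)) \<le> 1 / 2 * pn v"
    if v: "v \<in> bm" "(\<lambda>n. pn (\<lambda>x. v ((f ^^ n) x))) \<longlonglongrightarrow> 0" for v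
  proof (cases "pn v = 0")
    case True
    then show ?thesis using K(2)[OF v(1), of L] by simp
  next
    case False
    then have p: "pn v > 0" using pn_nonneg[OF v(1)] by simp
    let ?v = "\<lambda>x. (1 / pn v) * v x"
    have "pn (\<lambda>x. ?v ((f ^^ L) x)) \<le> 1 / 2"
    proof (rule L(2))
      show "?v \<in> bm" by (intro bm_cmult v)
      show "pn ?v \<le> 1" using pn_cmult[OF v(1), of "1 / pn v"] p by simp
      show "(\<lambda>n. pn (\<lambda>x. ?v ((f ^^ n) x))) \<longlonglongrightarrow> 0"
      proof (rule Lim_null_comparison[OF _ tendsto_mult_right_zero[OF v(2), of "1 / pn v"]])
        show "\<forall>\<^sub>F n in sequentially. norm (pn (\<lambda>x. ?v ((f ^^ n) x))) \<le> 1 / pn v * pn (\<lambda>x. v ((f ^^ n) x))"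
        proof (intro always_eventually allI)
          fix n
          show "norm (pn (\<lambda>x. ?v ((f ^^ n) x))) \<le> 1 / pn v * pn (\<lambda>x. v ((f ^^ n) x))"
            using pn_cmult[OF bm_comp[OF v(1), of n], of "1 / pn v"] pn_nonneg[OF bm_cmult[OF bm_comp[OF v(1), of n], of "1 / pn v"]] p by simp
        qed
      qed
    qed
    moreover have "pn (\<lambda>x. v ((f ^^ L) x)) \<le> pn v * pn (\<lambda>x. ?v ((f ^^ L) x))"
      using pn_cmult[OF bm_cmult[OF bm_comp[OF v(1), of L], of "1 / pn v"], of "pn v"] p by simp
    moreover have "pn v * pn (\<lambda>x. ?v ((f ^^ L) x)) \<le> pn v * (1 / 2)" using calculation(1) p by (intro mult_left_mono) auto
    ultimately show ?thesis by linarith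
  qed
  have iter: "pn (\<lambda>x. v ((f ^^ (j * L)) x)) \<le> (1 / 2) ^ j * pn v"
    if v: "v \<in> bm" "(\<lambda>n. pn (\<lambda>x. v ((f ^^ n) x))) \<longlonglongrightarrow> 0" for v j
  proof (induction j)
    case (Suc j)
    let ?u = "\<lambda>x. v ((f ^^ (j * L)) x)"
    have "(\<lambda>n. pn (\<lambda>x. v ((f ^^ (n + j * L)) x))) \<longlonglongrightarrow> 0" by (rule LIMSEQ_ignore_initial_segment[OF v(2)])
    moreover have eq: "(f ^^ (n + j * L)) x = (f ^^ (j * L)) ((f ^^ n) x)" for n x
      using funpow_add[of "j * L" n f] by (simp add: add.commute)
    ultimately have "(\<lambda>n. pn (\<lambda>x. ?u ((f ^^ n) x))) \<longlonglongrightarrow> 0" by simp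
    then have "pn (\<lambda>x. ?u ((f ^^ L) x)) \<le> 1 / 2 * pn ?u" by (intro step bm_comp v)
    moreover have "?u ((f ^^ L) x) = v ((f ^^ (Suc j * L)) x)" for x using eq[of L x] by simp
    ultimately show ?case using Suc by simp
  qed simp
  \<comment> \<open>\<open>\<rho> ^ L = 1 / 2\<close>. As the remainder \<open>r\<close> is at most
    \<open>L\<close>, \<open>\<rho> ^ r\<close> is at least 1/2, which accounts for the factor 2 in
    \<open>2 * K\<close>.\<close>
  define \<rho> where "\<rho> = root L (1 / 2)"
  have L0: "L > 0" using L(1) by simp
  have lam: "0 < \<rho>" "\<rho> < 1" "\<rho> ^ L = 1 / 2"
    using L0 real_root_lt_1_iff[of L "1/2"] by (auto simp: \<rho>_def)
  show ?thesis
  proof (rule exI[of _ "2 * K"], rule exI[of _ \<rho>], intro conjI ballI impI allI lam)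
    show "0 < 2 * K" using K(1) by simp
    fix v n assume v: "v \<in> bm" "(\<lambda>n. pn (\<lambda>x. v ((f ^^ n) x))) \<longlonglongrightarrow> 0"
    define q where "q = n div L"
    define r where "r = n mod L"
    have n: "n = q * L + r" by (simp add: q_def r_def)
    have r: "r \<le> L" using L0 by (simp add: r_def less_imp_le)
    have "pn (\<lambda>x. v ((f ^^ n) x)) = pn (\<lambda>x. v ((f ^^ (q * L)) ((f ^^ r) x)))" unfolding n by (simp add: funpow_add)
    also have "\<dots> \<le> K * pn (\<lambda>x. v ((f ^^ (q * L)) x))" by (rule K(2)[OF bm_comp[OF v(1)]])
    also have "\<dots> \<le> K * ((1 / 2) ^ q * pn v)" using K(1) by (intro mult_left_mono iter v) auto
    also have "K * ((1 / 2) ^ q * pn v) \<le> K * ((2 * \<rho> ^ n) * pn v)"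
    proof (intro mult_left_mono mult_right_mono)
      have "1 / 2 \<le> \<rho> ^ r" using power_decreasing[OF r, of \<rho>] lam by simp
      then have "(\<rho> ^ L) ^ q * (1 / 2) \<le> (\<rho> ^ L) ^ q * \<rho> ^ r" using lam by (intro mult_left_mono) auto
      also have "\<dots> = \<rho> ^ n" unfolding n by (simp add: power_add power_mult[symmetric] mult.commute)
      finally show "(1 / 2) ^ q \<le> 2 * \<rho> ^ n" using lam(3) by simp
    qed (use K(1) pn_nonneg[OF v(1)] in auto)
    finally show "pn (\<lambda>x. v ((f ^^ n) x)) \<le> 2 * K * \<rho> ^ n * pn v" by (simp add: mult_ac)
  qed
qed

section \<open>Birkhoff averages and basins\<close>

lemma ergodic_acipsD:
  assumes "\<mu> \<in> ergodic_acips a b f"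
  shows "invariant \<mu>" "prob_space \<mu>"
    "\<And>A. \<lbrakk>A \<in> sets M; f -` A \<inter> {a..b} = A\<rbrakk> \<Longrightarrow> measure \<mu> A = 0 \<or> measure \<mu> A = 1"
proof -
  show i: "invariant \<mu>" by (rule ergodic_acips_invariant[OF assms])
  show p: "prob_space \<mu>" using assms by (simp add: ergodic_acips_def)
  fix A assume "A \<in> sets M" "f -` A \<inter> {a..b} = A"
  then have "emeasure \<mu> A = 0 \<or> emeasure \<mu> A = 1"
    using assms invariantD(1,5)[OF i] unfolding ergodic_acips_def by auto
  then show "measure \<mu> A = 0 \<or> measure \<mu> A = 1" by (auto simp: measure_def)
qed

text \<open>\<open>max_sum G n\<close> is the maximum of \<open>0\<close> and the first \<open>n\<close> Birkhoff sums of \<open>G\<close>.\<close>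
primrec max_sum :: "(real \<Rightarrow> real) \<Rightarrow> nat \<Rightarrow> real \<Rightarrow> real" where
  "max_sum G 0 x = 0"
| "max_sum G (Suc n) x = max 0 (G x + max_sum G n (f x))"

lemma max_sum_nonneg: "0 \<le> max_sum G n x" by (cases n) auto

lemma max_sum_mono: "max_sum G n x \<le> max_sum G (Suc n) x"
proof (induction n arbitrary: x)
  case (Suc n)
  have "max 0 (G x + max_sum G n (f x)) \<le> max 0 (G x + max_sum G (Suc n) (f x))"
    using Suc[of "f x"] by (intro max.mono) auto
  then show ?case by (simp only: max_sum.simps)
qed simp

lemma max_sum_mono': "m \<le> n \<Longrightarrow> max_sum G m x \<le> max_sum G n x"
  by (induction rule: inc_induct) (auto intro: order_trans[OF max_sum_mono] simp del: max_sum.simps)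

lemma max_sum_ge: "(\<Sum>k<n. G ((f ^^ k) x)) \<le> max_sum G n x"
proof (induction n arbitrary: x)
  case (Suc n)
  have "(\<Sum>k<Suc n. G ((f ^^ k) x)) = G x + (\<Sum>k<n. G ((f ^^ k) (f x)))"
    unfolding sum.lessThan_Suc_shift by (simp add: funpow_Suc_right del: funpow.simps(2))
  also have "\<dots> \<le> G x + max_sum G n (f x)" using Suc[of "f x"] by simp
  finally show ?case by simp
qed simp

lemma bm_max_sum: assumes "G \<in> bm" shows "max_sum G n \<in> bm"
proof (induction n)
  case 0
  show ?case using bm_const[of 0] by (simp add: max_sum.simps(1)[abs_def])
next
  case (Suc n)
  have u: "(\<lambda>x. G x + max_sum G n (f x)) \<in> bm" by (intro bm_add assms bm_comp1 Suc)
  have "(\<lambda>x. max 0 (G x + max_sum G n (f x))) = (\<lambda>x. 1 / 2 * ((G x + max_sum G n (f x)) + \<bar>G x + max_sum G n (f x)\<bar>))"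
    by (auto simp: max_def)
  moreover have "(\<lambda>x. 1 / 2 * ((G x + max_sum G n (f x)) + \<bar>G x + max_sum G n (f x)\<bar>)) \<in> bm"
    by (intro bm_cmult bm_add[OF u] bm_abs u)
  ultimately show ?case by (simp add: max_sum.simps(2)[abs_def])
qed

section \<open>The maximal inequality and Birkhoff's theorem\<close>

text \<open>Garsia's argument: where the maximum is positive, it is at most \<open>G x\<close> plus
  the maximum at \<open>f x\<close>; elsewhere it is zero. The difference of the two maxima
  integrates to zero by invariance.\<close>

lemma maximal_ergodic:
  assumes N: "invariant N" and G: "G \<in> bm"
  shows "0 \<le> (LINT x|N. indicator {x \<in> {a..b}. 0 < max_sum G n x} x * G x)"
proof (cases n)
  case (Suc m)
  note int = invariant_integrable[OF N] and sp = invariantD(5)[OF N]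
  let ?E = "{x \<in> {a..b}. 0 < max_sum G n x}"
  have F: "max_sum G n \<in> bm" by (rule bm_max_sum[OF G])
  have "{x \<in> space M. 0 < max_sum G n x} \<in> sets M" using bm_measurable[OF F] by measurable
  then have E: "indicat_real ?E \<in> bm" by (intro bm_ind) (simp add: sets_restrict_space_iff)
  have "(LINT x|N. max_sum G n x - max_sum G n (f x)) \<le> (LINT x|N. indicator ?E x * G x)"
  proof (rule integral_mono)
    show "integrable N (\<lambda>x. max_sum G n x - max_sum G n (f x))" by (intro int bm_diff F bm_comp1)
    show "integrable N (\<lambda>x. indicator ?E x * G x)" by (intro int bm_mult E G)
    fix x assume "x \<in> space N"
    show "max_sum G n x - max_sum G n (f x) \<le> indicator ?E x * G x"
    proof (cases "0 < max_sum G n x")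
      case True
      then have "max_sum G n x = G x + max_sum G m (f x)" unfolding Suc by (auto simp: max_def split: if_splits)
      moreover have "max_sum G m (f x) \<le> max_sum G n (f x)" unfolding Suc by (rule max_sum_mono)
      ultimately show ?thesis using True \<open>x \<in> space N\<close> sp by (simp add: indicator_def)
    next
      case False
      then show ?thesis using max_sum_nonneg[of G n x] max_sum_nonneg[of G n "f x"] by (simp add: indicator_def)
    qed
  qed
  moreover have "(LINT x|N. max_sum G n x - max_sum G n (f x)) = 0"
    using int[OF F] int[OF bm_comp1[OF F]] invariant_integral1[OF N bm_measurable[OF F]] by simp
  ultimately show ?thesis by simp
qed simp

definition avg :: "(real \<Rightarrow> real) \<Rightarrow> nat \<Rightarrow> real \<Rightarrow> real" where
  "avg g n x = (\<Sum>k<n. g ((f ^^ k) x)) / real n"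

lemma avg_measurable: "g \<in> bm \<Longrightarrow> avg g n \<in> borel_measurable M"
  unfolding avg_def by (intro borel_measurable_divide bm_measurable[OF bm_sum] bm_comp) auto

lemma avg_shift:
  assumes B: "\<And>x. x \<in> {a..b} \<Longrightarrow> \<bar>g x\<bar> \<le> B" and x: "x \<in> {a..b}"
  shows "\<bar>avg g n (f x) - avg g n x\<bar> \<le> 2 * B / real n"
proof -
  have "(\<Sum>k<n. g ((f ^^ k) (f x))) + g x = (\<Sum>k<Suc n. g ((f ^^ k) x))"
    unfolding sum.lessThan_Suc_shift by (simp add: funpow_Suc_right del: funpow.simps(2))
  then have eq: "(\<Sum>k<n. g ((f ^^ k) (f x))) - (\<Sum>k<n. g ((f ^^ k) x)) = g ((f ^^ n) x) - g x" by simp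
  have "\<bar>g ((f ^^ n) x) - g x\<bar> \<le> 2 * B" using B[OF x] B[OF fn_in[OF x, of n]] by linarith
  then have "\<bar>g ((f ^^ n) x) - g x\<bar> / real n \<le> 2 * B / real n" by (simp add: divide_right_mono)
  then show ?thesis unfolding avg_def diff_divide_distrib[symmetric] eq by (simp add: abs_divide)
qed

text \<open>\<open>A\<close> is the set where the upper limit of the averages is at least
  \<open>c\<close>. It is strictly invariant, so ergodicity makes it null or full. Were it full,
  almost every point would have a positive Birkhoff sum of \<open>G\<close>, the sets of the maximal
  inequality would exhaust the space, and the integral of \<open>G\<close>, which is
  \<open>- \<epsilon>\<close>, would be nonnegative.\<close>

lemma avg_eventually_le:
  assumes \<mu>: "\<mu> \<in> ergodic_acips a b f" and g: "g \<in> bm" and c: "(LINT x|\<mu>. g x) < c"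
  shows "AE x in \<mu>. \<exists>n0. \<forall>n\<ge>n0. avg g n x \<le> c"
proof -
  note N = ergodic_acipsD(1)[OF \<mu>]
  interpret p: prob_space \<mu> by (rule ergodic_acipsD(2)[OF \<mu>])
  note s = invariantD(1)[OF N] and sp = invariantD(5)[OF N] and int = invariant_integrable[OF N]
  obtain B where B: "B > 0" "\<And>x. x \<in> {a..b} \<Longrightarrow> \<bar>g x\<bar> \<le> B" using bmE[OF g] by blast
  \<comment> \<open>The slack \<open>1 / Suc m\<close> makes the condition exactly invariant, as
    ergodicity is stated for sets equal to their preimage: passing from \<open>x\<close> to
    \<open>f x\<close> changes the averages by at most \<open>2 * B / n\<close>, which the slack
    absorbs.\<close>
  define A where "A = {x \<in> {a..b}. \<forall>m n0. \<exists>n\<ge>n0. c - 1 / Suc m < avg g n x}"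
  have "{x \<in> space M. \<forall>m n0. \<exists>n\<ge>n0. c - 1 / Suc m < avg g n x} \<in> sets M"
    using avg_measurable[OF g] by measurable
  then have A: "A \<in> sets M" by (simp add: A_def)
  have tr: "\<forall>m n0. \<exists>n\<ge>n0. c - 1 / Suc m < avg g n y"
    if xy: "\<forall>m n0. \<exists>n\<ge>n0. c - 1 / Suc m < avg g n x" "\<And>n. \<bar>avg g n y - avg g n x\<bar> \<le> 2 * B / real n" for x y
  proof (intro allI)
    fix m n0 :: nat
    \<comment> \<open>As \<open>Suc (Suc (2 * m)) = 2 * Suc m\<close>, half of the slack is spent on
      the averages at \<open>x\<close>; \<open>n \<ge> 4 * B * Suc m\<close> fits the change of the
      averages into the other half.\<close>
    define n1 where "n1 = max n0 (Suc (nat \<lceil>4 * B * Suc m\<rceil>))"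
    obtain n where n: "n \<ge> n1" "c - 1 / Suc (Suc (2 * m)) < avg g n x" using xy(1) by blast
    have "4 * B * Suc m \<le> real n" "n > 0" "n \<ge> n0" using n(1) by (auto simp: n1_def) linarith
    then have "2 * B * (2 * Suc m) \<le> real n" by (simp add: algebra_simps)
    then have 1: "2 * B / real n \<le> 1 / (2 * real (Suc m))" using \<open>n > 0\<close> by (simp add: divide_simps)
    define u where "u = 1 / (2 * real (Suc m))"
    have 2: "1 / real (Suc (Suc (2 * m))) = u" unfolding u_def by simp
    have 3: "1 / real (Suc m) = 2 * u" unfolding u_def by (simp add: field_simps)
    have "c - 1 / Suc m < avg g n y"
      using n(2) xy(2)[of n] 1 unfolding 2 3 u_def[symmetric] by linarith
    then show "\<exists>n\<ge>n0. c - 1 / Suc m < avg g n y" using \<open>n \<ge> n0\<close> by blast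
  qed
  have Ainv: "f -` A \<inter> {a..b} = A"
  proof (intro set_eqI iffI)
    fix x assume x: "x \<in> f -` A \<inter> {a..b}"
    then have "\<forall>m n0. \<exists>n\<ge>n0. c - 1 / Suc m < avg g n (f x)" "x \<in> {a..b}" by (auto simp: A_def)
    moreover have "\<bar>avg g n x - avg g n (f x)\<bar> \<le> 2 * B / real n" for n
      using avg_shift[OF B(2), where x = x and n = n] x by (simp add: abs_minus_commute)
    ultimately show "x \<in> A" using tr[of "f x" x] by (simp add: A_def)
  next
    fix x assume x: "x \<in> A"
    then have "\<forall>m n0. \<exists>n\<ge>n0. c - 1 / Suc m < avg g n x" "x \<in> {a..b}" by (auto simp: A_def)
    moreover have "\<bar>avg g n (f x) - avg g n x\<bar> \<le> 2 * B / real n" for n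
      using avg_shift[OF B(2), where x = x and n = n] calculation(2) by simp
    ultimately show "x \<in> f -` A \<inter> {a..b}" using tr[of x "f x"] f_in[of x] by (simp add: A_def)
  qed
  have "measure \<mu> A \<noteq> 1"
  proof
    assume A1: "measure \<mu> A = 1"
    \<comment> \<open>Half of the gap: the integral of \<open>g\<close> plus \<epsilon> equals
      \<open>c - \<epsilon>\<close>, which leaves room for a slack below \<epsilon>.\<close>
    define \<epsilon> where "\<epsilon> = (c - (LINT x|\<mu>. g x)) / 2"
    have e: "\<epsilon> > 0" using c by (simp add: \<epsilon>_def)
    define G where "G x = g x - ((LINT x|\<mu>. g x) + \<epsilon>)" for x
    have G: "G \<in> bm" unfolding G_def by (intro bm_diff g bm_const)
    have iG: "(LINT x|\<mu>. G x) = - \<epsilon>" unfolding G_def using int[OF g] by (simp add: p.prob_space)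
    let ?E = "\<lambda>n. {x \<in> {a..b}. 0 < max_sum G n x}"
    obtain m :: nat where m: "1 / Suc m < \<epsilon>" using nat_approx_posE[OF e] by blast
    have AE_A: "AE x in \<mu>. x \<in> A" using A1 A s by (subst p.AE_in_set_eq_1) auto
    have inE: "\<exists>n. x \<in> ?E n" if x: "x \<in> A" for x
    proof -
      obtain n where n: "n \<ge> 1" "c - 1 / Suc m < avg g n x" using x unfolding A_def by blast
      have "(LINT x|\<mu>. g x) + \<epsilon> = c - \<epsilon>" by (simp add: \<epsilon>_def field_simps)
      then have "(LINT x|\<mu>. g x) + \<epsilon> < avg g n x" using n(2) m by linarith
      then have "real n * ((LINT x|\<mu>. g x) + \<epsilon>) < (\<Sum>k<n. g ((f ^^ k) x))"
        using n(1) by (simp add: avg_def field_simps)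
      then have "0 < (\<Sum>k<n. G ((f ^^ k) x))" by (simp add: G_def sum_subtractf)
      then have "0 < max_sum G n x" using max_sum_ge[of G x n] by linarith
      then show ?thesis using x by (auto simp: A_def)
    qed
    have "(\<lambda>n. LINT x|\<mu>. indicator (?E n) x * G x) \<longlonglongrightarrow> (LINT x|\<mu>. G x)"
    proof (rule integral_dominated_convergence[where w="\<lambda>x. \<bar>G x\<bar>"])
      show "G \<in> borel_measurable \<mu>" "integrable \<mu> (\<lambda>x. \<bar>G x\<bar>)" using int[OF G] by auto
      fix n
      have "{x \<in> space M. 0 < max_sum G n x} \<in> sets M" using bm_measurable[OF bm_max_sum[OF G]] by measurable
      then have E: "indicat_real (?E n) \<in> bm" by (intro bm_ind) (simp add: sets_restrict_space_iff)
      show "(\<lambda>x. indicator (?E n) x * G x) \<in> borel_measurable \<mu>"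
        by (intro borel_measurable_integrable int bm_mult E G)
      show "AE x in \<mu>. norm (indicator (?E n) x * G x) \<le> \<bar>G x\<bar>" by (intro AE_I2) (auto simp: indicator_def)
    next
      show "AE x in \<mu>. (\<lambda>n. indicator (?E n) x * G x) \<longlonglongrightarrow> G x"
        using AE_A
      proof eventually_elim
        fix x assume "x \<in> A"
        then obtain n1 where n1: "x \<in> ?E n1" using inE by blast
        have "indicator (?E n) x * G x = G x" if "n \<ge> n1" for n
          using n1 max_sum_mono'[OF that, of G x] by (auto simp: indicator_def)
        then show "(\<lambda>n. indicator (?E n) x * G x) \<longlonglongrightarrow> G x"
          by (intro tendsto_eventually) (auto simp: eventually_sequentially)
      qed
    qed
    then have "0 \<le> (LINT x|\<mu>. G x)"
      by (rule LIMSEQ_le_const) (use maximal_ergodic[OF N G] in auto)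
    then show False using iG e by simp
  qed
  then have "measure \<mu> A = 0" using ergodic_acipsD(3)[OF \<mu> A Ainv] by blast
  then have "A \<in> null_sets \<mu>" using A s by (simp add: null_sets_def p.emeasure_eq_measure)
  then have "AE x in \<mu>. x \<notin> A" by (rule AE_not_in)
  then show ?thesis
  proof (rule AE_mp, intro AE_I2 impI)
    fix x assume "x \<in> space \<mu>" "x \<notin> A"
    then obtain m n0 where "\<forall>n\<ge>n0. \<not> c - 1 / Suc m < avg g n x" using sp unfolding A_def by blast
    moreover have "c - 1 / real (Suc m) \<le> c" by simp
    ultimately show "\<exists>n0. \<forall>n\<ge>n0. avg g n x \<le> c" by (meson linorder_not_less order_trans)
  qed
qed

theorem Birkhoff:
  assumes \<mu>: "\<mu> \<in> ergodic_acips a b f" and g: "g \<in> bm"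
  shows "AE x in \<mu>. (\<lambda>n. avg g n x) \<longlonglongrightarrow> (LINT x|\<mu>. g x)"
proof -
  have 1: "AE x in \<mu>. \<forall>j::nat. \<exists>n0. \<forall>n\<ge>n0. avg g n x \<le> (LINT x|\<mu>. g x) + 1 / Suc j"
    unfolding AE_all_countable by (intro allI avg_eventually_le \<mu> g) simp
  have "AE x in \<mu>. \<forall>j::nat. \<exists>n0. \<forall>n\<ge>n0. avg (\<lambda>x. - 1 * g x) n x \<le> (LINT x|\<mu>. - 1 * g x) + 1 / Suc j"
    unfolding AE_all_countable by (intro allI avg_eventually_le \<mu> bm_cmult g) simp
  then have 2: "AE x in \<mu>. \<forall>j::nat. \<exists>n0. \<forall>n\<ge>n0. - avg g n x \<le> - (LINT x|\<mu>. g x) + 1 / Suc j"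
    by (simp add: avg_def sum_negf)
  show ?thesis
    using 1 2
  proof eventually_elim
    fix x
    assume a1: "\<forall>j::nat. \<exists>n0. \<forall>n\<ge>n0. avg g n x \<le> (LINT x|\<mu>. g x) + 1 / Suc j"
      and a2: "\<forall>j::nat. \<exists>n0. \<forall>n\<ge>n0. - avg g n x \<le> - (LINT x|\<mu>. g x) + 1 / Suc j"
    show "(\<lambda>n. avg g n x) \<longlonglongrightarrow> (LINT x|\<mu>. g x)"
    proof (rule LIMSEQ_I)
      fix r :: real assume "0 < r"
      then obtain j :: nat where j: "1 / Suc j < r" using nat_approx_posE by blast
      obtain n1 n2 where n1: "\<forall>n\<ge>n1. avg g n x \<le> (LINT x|\<mu>. g x) + 1 / Suc j"
        and n2: "\<forall>n\<ge>n2. - avg g n x \<le> - (LINT x|\<mu>. g x) + 1 / Suc j" using a1 a2 by blast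
      show "\<exists>n0. \<forall>n\<ge>n0. norm (avg g n x - (LINT x|\<mu>. g x)) < r"
      proof (intro exI allI impI)
        fix n assume "n \<ge> max n1 n2"
        then have "avg g n x \<le> (LINT x|\<mu>. g x) + 1 / Suc j" "- avg g n x \<le> - (LINT x|\<mu>. g x) + 1 / Suc j"
          using n1 n2 by auto
        then show "norm (avg g n x - (LINT x|\<mu>. g x)) < r" using j unfolding real_norm_def by linarith
      qed
    qed
  qed
qed

lemma continuous_on_bm_complex_integral:
  fixes g :: "real \<Rightarrow> complex"
  assumes N: "invariant N" and g: "continuous_on {a..b} g"
  shows "(LINT x|N. g x) = Complex (LINT x|N. Re (g x)) (LINT x|N. Im (g x))"
proof -
  have r: "integrable N (\<lambda>x. Re (g x))" "integrable N (\<lambda>x. Im (g x))"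
    using g by (auto intro!: invariant_integrable[OF N] continuous_on_bm continuous_intros)
  have "(LINT x|N. g x) = (LINT x|N. of_real (Re (g x)) + \<i> * of_real (Im (g x)))"
    by (simp add: complex_eq[symmetric])
  also have "\<dots> = of_real (LINT x|N. Re (g x)) + \<i> * of_real (LINT x|N. Im (g x))"
    using r by simp
  finally show ?thesis by (simp add: Complex_eq)
qed

section \<open>Basins described by moments\<close>

text \<open>Testing with the powers \<open>y ^ i\<close> leaves countably many conditions, so that
  measurability and full measure are accessible; polynomial approximation identifies the set with
  the basin in \<open>basin_eq_moment_basin\<close>.\<close>

definition moment_basin :: "real measure \<Rightarrow> real set" where
  "moment_basin \<mu> = {x \<in> {a..b}. \<forall>i::nat. (\<lambda>n. avg (\<lambda>y. y ^ i) n x) \<longlonglongrightarrow> (LINT y|\<mu>. y ^ i)}"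

lemma avg_continuous_limit:
  fixes g :: "real \<Rightarrow> real"
  assumes N: "invariant N" "prob_space N" and x: "x \<in> moment_basin N" and g: "continuous_on {a..b} g"
  shows "(\<lambda>n. avg g n x) \<longlonglongrightarrow> (LINT y|N. g y)"
proof (rule LIMSEQ_I)
  interpret p: prob_space N by fact
  note int = invariant_integrable[OF N(1)] and sp = invariantD(5)[OF N(1)]
  have xab: "x \<in> {a..b}" and mom: "\<And>i. (\<lambda>n. avg (\<lambda>y. y ^ i) n x) \<longlonglongrightarrow> (LINT y|N. y ^ i)"
    using x by (auto simp: moment_basin_def)
  fix r :: real assume r: "0 < r"
  then have r3: "0 < r / 3" by simp
  obtain q where q: "real_polynomial_function q" "\<And>y. y \<in> {a..b} \<Longrightarrow> \<bar>g y - q y\<bar> < r / 3"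
    using Stone_Weierstrass_real_polynomial_function[OF compact_Icc g r3] by blast
  obtain c m where qc: "q = (\<lambda>y. \<Sum>i\<le>(m::nat). c i * y ^ i)" using q(1) unfolding real_polynomial_function_iff_sum by blast
  have qb: "q \<in> bm" unfolding qc by (intro continuous_on_bm continuous_intros)
  have gb: "g \<in> bm" by (rule continuous_on_bm[OF g])
  have mb: "(\<lambda>y. y ^ i) \<in> bm" for i :: nat by (intro continuous_on_bm continuous_intros)
  have "avg q n x = (\<Sum>i\<le>m. c i * avg (\<lambda>y. y ^ i) n x)" for n
    unfolding avg_def qc sum_divide_distrib sum_distrib_left by (subst sum.swap) simp
  moreover have "(\<lambda>n. \<Sum>i\<le>m. c i * avg (\<lambda>y. y ^ i) n x) \<longlonglongrightarrow> (\<Sum>i\<le>m. c i * (LINT y|N. y ^ i))"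
    by (intro tendsto_intros mom)
  moreover have "(\<Sum>i\<le>m. c i * (LINT y|N. y ^ i)) = (LINT y|N. q y)"
    unfolding qc using int[OF bm_cmult[OF mb]] by (simp add: Bochner_Integration.integral_sum)
  ultimately have "(\<lambda>n. avg q n x) \<longlonglongrightarrow> (LINT y|N. q y)" by simp
  from LIMSEQ_D[OF this r3] obtain n0 where n0: "\<And>n. n \<ge> n0 \<Longrightarrow> \<bar>avg q n x - (LINT y|N. q y)\<bar> < r / 3"
    unfolding real_norm_def by blast
  have 1: "\<bar>avg g n x - avg q n x\<bar> \<le> r / 3" for n
  proof (cases "n = 0")
    case False
    have "\<bar>\<Sum>k<n. g ((f ^^ k) x) - q ((f ^^ k) x)\<bar> \<le> (\<Sum>k<n. r / 3)"
      by (rule order_trans[OF sum_abs]) (intro sum_mono less_imp_le q(2) fn_in xab)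
    then have "\<bar>\<Sum>k<n. g ((f ^^ k) x) - q ((f ^^ k) x)\<bar> / real n \<le> (real n * (r / 3)) / real n"
      by (intro divide_right_mono) auto
    then show ?thesis using False
      by (simp add: avg_def diff_divide_distrib[symmetric] sum_subtractf[symmetric] abs_divide)
  qed (use r in \<open>simp add: avg_def\<close>)
  have 2: "\<bar>(LINT y|N. g y) - (LINT y|N. q y)\<bar> \<le> r / 3"
  proof -
    have "\<bar>LINT y|N. g y - q y\<bar> \<le> (LINT y|N. r / 3)"
      using q(2) sp by (intro integral_abs_bound_integral int bm_diff gb qb bm_const) (auto intro: less_imp_le)
    then show ?thesis using int[OF gb] int[OF qb] by (simp add: p.prob_space)
  qed
  show "\<exists>n0. \<forall>n\<ge>n0. norm (avg g n x - (LINT y|N. g y)) < r"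
  proof (intro exI allI impI)
    fix n assume "n \<ge> n0"
    then show "norm (avg g n x - (LINT y|N. g y)) < r"
      using n0[of n] 1[of n] 2 unfolding real_norm_def by linarith
  qed
qed

lemma basin_eq_moment_basin:
  assumes N: "invariant N" "prob_space N"
  shows "basin a b f N = moment_basin N"
proof (intro set_eqI iffI)
  fix x assume x: "x \<in> basin a b f N"
  have "(\<lambda>n. avg (\<lambda>y. y ^ i) n x) \<longlonglongrightarrow> (LINT y|N. y ^ i)" for i :: nat
  proof -
    have "continuous_on {a..b} (\<lambda>y. complex_of_real (y ^ i))" by (intro continuous_intros)
    then have "(\<lambda>n. (\<Sum>k<n. complex_of_real (((f ^^ k) x) ^ i)) / of_nat n) \<longlonglongrightarrow> (LINT y|N. complex_of_real (y ^ i))"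
      using x unfolding basin_def by blast
    moreover have "(\<Sum>k<n. complex_of_real (((f ^^ k) x) ^ i)) / of_nat n = of_real (avg (\<lambda>y. y ^ i) n x)" for n
      by (simp add: avg_def)
    moreover have "(LINT y|N. complex_of_real (y ^ i)) = of_real (LINT y|N. y ^ i)"
      by (rule integral_complex_of_real)
    ultimately show ?thesis by (simp only: tendsto_of_real_iff)
  qed
  then show "x \<in> moment_basin N" using x by (simp add: moment_basin_def basin_def)
next
  fix x assume x: "x \<in> moment_basin N"
  show "x \<in> basin a b f N"
    unfolding basin_def
  proof (intro CollectI conjI allI impI)
    show "x \<in> {a..b}" using x by (simp add: moment_basin_def)
    fix g :: "real \<Rightarrow> complex" assume g: "continuous_on {a..b} g"
    have eq: "(\<Sum>k<n. g ((f ^^ k) x)) / of_nat n = Complex (avg (\<lambda>y. Re (g y)) n x) (avg (\<lambda>y. Im (g y)) n x)" for n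
      by (rule complex_eqI) (simp_all add: avg_def Re_divide_of_nat Im_divide_of_nat)
    show "(\<lambda>n. (\<Sum>k<n. g ((f ^^ k) x)) / of_nat n) \<longlonglongrightarrow> (LINT y|N. g y)"
      unfolding eq continuous_on_bm_complex_integral[OF N(1) g]
      by (intro tendsto_Complex avg_continuous_limit[OF N x] continuous_intros g)
  qed
qed

lemma moment_basin_sets: "moment_basin N \<in> sets M"
proof -
  have mb: "(\<lambda>y. y ^ i) \<in> bm" for i :: nat by (intro continuous_on_bm continuous_intros)
  \<comment> \<open>Convergence is rewritten with countable quantifiers only, so that the set of
    convergence is visibly measurable.\<close>
  have iff: "u \<longlonglongrightarrow> c \<longleftrightarrow> (\<forall>j::nat. \<exists>n0. \<forall>n\<ge>n0. \<bar>u n - c\<bar> < 1 / Suc j)" for u :: "nat \<Rightarrow> real" and c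
  proof
    assume u: "u \<longlonglongrightarrow> c"
    show "\<forall>j::nat. \<exists>n0. \<forall>n\<ge>n0. \<bar>u n - c\<bar> < 1 / Suc j"
      using LIMSEQ_D[OF u] by (auto simp del: of_nat_Suc)
  next
    assume u: "\<forall>j::nat. \<exists>n0. \<forall>n\<ge>n0. \<bar>u n - c\<bar> < 1 / Suc j"
    show "u \<longlonglongrightarrow> c"
    proof (rule LIMSEQ_I)
      fix r :: real assume "0 < r"
      then obtain j :: nat where j: "1 / Suc j < r" using nat_approx_posE by blast
      obtain n0 where "\<forall>n\<ge>n0. \<bar>u n - c\<bar> < 1 / Suc j" using u by blast
      then show "\<exists>n0. \<forall>n\<ge>n0. norm (u n - c) < r" using j by (auto intro!: exI[of _ n0] simp del: of_nat_Suc) 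
    qed
  qed
  have "{x \<in> space M. \<forall>i j::nat. \<exists>n0. \<forall>n\<ge>n0. \<bar>avg (\<lambda>y. y ^ i) n x - (LINT y|N. y ^ i)\<bar> < 1 / Suc j} \<in> sets M"
    using avg_measurable[OF mb] by measurable
  then show ?thesis by (simp add: moment_basin_def iff)
qed

lemma measure_moment_basin:
  assumes \<mu>: "\<mu> \<in> ergodic_acips a b f"
  shows "AE x in \<mu>. x \<in> moment_basin \<mu>" "measure \<mu> (moment_basin \<mu>) = 1"
proof -
  interpret p: prob_space \<mu> by (rule ergodic_acipsD(2)[OF \<mu>])
  note N = ergodic_acipsD(1)[OF \<mu>]
  have mb: "(\<lambda>y. y ^ i) \<in> bm" for i :: nat by (intro continuous_on_bm continuous_intros)
  have "AE x in \<mu>. \<forall>i::nat. (\<lambda>n. avg (\<lambda>y. y ^ i) n x) \<longlonglongrightarrow> (LINT y|\<mu>. y ^ i)"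
    unfolding AE_all_countable by (intro allI Birkhoff \<mu> mb)
  then show ae: "AE x in \<mu>. x \<in> moment_basin \<mu>"
    by (rule AE_mp) (auto intro!: AE_I2 simp: moment_basin_def invariantD(5)[OF N])
  show "measure \<mu> (moment_basin \<mu>) = 1"
    using ae moment_basin_sets[of \<mu>] invariantD(1)[OF N] by (subst p.AE_in_set_eq_1[symmetric]) auto
qed

text \<open>The bound by \<open>C\<close> is \<open>invariant_le_pn\<close> on indicators, whose
  norm is at most their Lebesgue measure.\<close>

lemma acip_density:
  assumes \<mu>: "\<mu> \<in> ergodic_acips a b f"
  obtains D where "D \<in> bm" "\<And>A. A \<in> sets M \<Longrightarrow> (LINT x|M. indicator A x * D x) = measure \<mu> A"
proof -
  interpret p: prob_space \<mu> by (rule ergodic_acipsD(2)[OF \<mu>])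
  note N = ergodic_acipsD(1)[OF \<mu>]
  note s = invariantD(1)[OF N] and sp = invariantD(5)[OF N]
  show ?thesis
  proof (rule bounded_density[of "measure \<mu>" C])
    show "measure \<mu> A \<le> C * measure M A" if A: "A \<in> sets M" for A
    proof -
      have Al: "A \<in> sets lebesgue" using A by (simp add: sets_restrict_space_iff)
      have Ai: "A \<subseteq> {a..b}" using sets.sets_into_space[OF A] by simp
      have "measure \<mu> A = (LINT x|\<mu>. indicator A x)" using Ai sp by (simp add: Int_absorb2)
      also have "\<dots> \<le> C * pn (indicat_real A)"
        using invariant_le_pn[OF N _ bm_ind[OF Al]] p.prob_space sp by simp
      also have "\<dots> \<le> C * measure M A"
        using pn_ind_le[OF Al] measure_M[OF Al] Ai C0 by (intro mult_left_mono) (auto simp: Int_absorb1)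
      finally show ?thesis .
    qed
    show "measure \<mu> (A \<union> B) = measure \<mu> A + measure \<mu> B" if "A \<in> sets M" "B \<in> sets M" "A \<inter> B = {}" for A B
      using that s by (intro p.finite_measure_Union) auto
    fix D assume D: "D \<in> bm" "\<And>A. A \<in> sets M \<Longrightarrow> (LINT x|M. indicator A x * D x) = measure \<mu> A"
    then show thesis using that by blast
  qed (use C0 in auto)
qed

text \<open>At a common point the averages of a continuous function converge to both integrals,
  which therefore agree. Ramps then give equal distribution functions, so the two densities have the
  same primitive; \<open>weakly_null_measure\<close> on a constant sequence turns this into equality
  on all measurable sets.\<close>

lemma moment_basin_disjoint:
  assumes \<mu>: "\<mu> \<in> ergodic_acips a b f" and \<nu>: "\<nu> \<in> ergodic_acips a b f"
    and x: "x \<in> moment_basin \<mu>" "x \<in> moment_basin \<nu>"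
  shows "\<mu> = \<nu>"
proof -
  interpret p: prob_space \<mu> by (rule ergodic_acipsD(2)[OF \<mu>])
  interpret q: prob_space \<nu> by (rule ergodic_acipsD(2)[OF \<nu>])
  note N = ergodic_acipsD(1)[OF \<mu>] and N' = ergodic_acipsD(1)[OF \<nu>]
  have int_eq: "(LINT y|\<mu>. g y) = (LINT y|\<nu>. g y)" if g: "continuous_on {a..b} g" for g :: "real \<Rightarrow> real"
    using LIMSEQ_unique[OF avg_continuous_limit[OF N p.prob_space_axioms x(1) g] avg_continuous_limit[OF N' q.prob_space_axioms x(2) g]] .
  have lim: "(\<lambda>j::nat. LINT y|N. max 0 (1 - real j * max 0 (y - t))) \<longlonglongrightarrow> measure N {a..t}"
    if N: "invariant N" and t: "t \<in> {a..b}" for N t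
  proof -
    interpret n: finite_measure N by (rule invariantD(2)[OF N])
    note sp = invariantD(5)[OF N]
    have "(\<lambda>j::nat. LINT y|N. max 0 (1 - real j * max 0 (y - t))) \<longlonglongrightarrow> (LINT y|N. indicator {a..t} y)"
    proof (rule integral_dominated_convergence[where w="\<lambda>_. 1"])
      have "indicat_real {a..t} \<in> borel_measurable M" by (intro ind_measurable) auto
      then show "indicat_real {a..t} \<in> borel_measurable N" by (rule invariant_measurable[OF N])
      show "(\<lambda>y. max 0 (1 - real j * max 0 (y - t))) \<in> borel_measurable N" for j
        by (intro borel_measurable_integrable invariant_integrable[OF N] continuous_on_bm continuous_intros)
      show "AE y in N. norm (max 0 (1 - real j * max 0 (y - t))) \<le> 1" for j by (intro AE_I2) auto
      show "AE y in N. (\<lambda>j. max 0 (1 - real j * max 0 (y - t))) \<longlonglongrightarrow> indicator {a..t} y"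
      proof (rule AE_I2)
        fix y assume y: "y \<in> space N"
        show "(\<lambda>j. max 0 (1 - real j * max 0 (y - t))) \<longlonglongrightarrow> indicator {a..t} y"
        proof (cases "y \<le> t")
          case True
          then show ?thesis using y sp by (simp add: indicator_def)
        next
          case False
          obtain j0 :: nat where j0: "1 / (y - t) < real j0" using reals_Archimedean2 by blast
          have "max 0 (1 - real j * max 0 (y - t)) = indicator {a..t} y" if "j \<ge> j0" for j
          proof -
            have "1 / (y - t) \<le> real j" using j0 that by linarith
            then have "1 \<le> real j * (y - t)" using False by (simp add: divide_simps)
            then show ?thesis using False by simp
          qed
          then show ?thesis by (intro tendsto_eventually) (auto simp: eventually_sequentially)
        qed
      qed
    qed auto
    moreover have "{a..t} \<inter> space N = {a..t}" using t sp by auto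
    then have "(LINT y|N. indicat_real {a..t} y) = measure N {a..t}"
      using Bochner_Integration.integral_indicator[of N "{a..t}"] by metis
    ultimately show ?thesis by metis
  qed
  have eq: "measure \<mu> {a..t} = measure \<nu> {a..t}" if t: "t \<in> {a..b}" for t
  proof (rule LIMSEQ_unique[OF lim[OF N t]])
    have "(LINT y|\<mu>. max 0 (1 - real j * max 0 (y - t))) = (LINT y|\<nu>. max 0 (1 - real j * max 0 (y - t)))" for j
      by (intro int_eq continuous_intros)
    then show "(\<lambda>j::nat. LINT y|\<mu>. max 0 (1 - real j * max 0 (y - t))) \<longlonglongrightarrow> measure \<nu> {a..t}"
      using lim[OF N' t] by simp
  qed
  obtain D where D: "D \<in> bm" "\<And>A. A \<in> sets M \<Longrightarrow> (LINT x|M. indicator A x * D x) = measure \<mu> A" by (rule acip_density[OF \<mu>]) (rule that)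
  obtain D' where D': "D' \<in> bm" "\<And>A. A \<in> sets M \<Longrightarrow> (LINT x|M. indicator A x * D' x) = measure \<nu> A" by (rule acip_density[OF \<nu>]) (rule that)
  let ?g = "\<lambda>x. D x - D' x"
  have g: "?g \<in> bm" by (intro bm_diff D D')
  obtain B where B: "B > 0" "\<And>x. x \<in> {a..b} \<Longrightarrow> \<bar>?g x\<bar> \<le> B" using bmE[OF g] by blast
  have "pn ?g \<le> 0"
  proof (rule pn_least)
    fix t assume t: "t \<in> {a..b}"
    have "{a..t} \<in> sets M" using t by (auto simp: sets_restrict_space_iff)
    then have "J {a..t} D = measure \<mu> {a..t}" "J {a..t} D' = measure \<nu> {a..t}" using D(2) D'(2) by (auto simp: J_def)
    then show "\<bar>J {a..t} ?g\<bar> \<le> 0" using J_diff[OF _ D(1) D'(1), of "{a..t}"] eq[OF t] by simp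
  qed
  then have "pn ?g = 0" using pn_nonneg[OF g] by simp
  then have p0: "(\<lambda>n::nat. pn ?g) \<longlonglongrightarrow> 0" by simp
  have "measure \<mu> A = measure \<nu> A" if A: "A \<in> sets M" for A
  proof -
    have Al: "A \<in> sets lebesgue" using A by (simp add: sets_restrict_space_iff)
    have "(\<lambda>n::nat. LINT x|M. indicator A x * ?g x) \<longlonglongrightarrow> 0"
      by (rule weakly_null_measure[OF refl M.finite_measure_axioms absolutely_continuous_refl g B(2) p0 bm_ind[OF Al]]) 
    then have "(LINT x|M. indicator A x * ?g x) = 0" using LIMSEQ_unique[OF tendsto_const] by fastforce
    then have "J A ?g = 0" by (simp add: J_def)
    then have "J A D = J A D'" using J_diff[OF Al D(1) D'(1)] by simp
    then show ?thesis using D(2)[OF A] D'(2)[OF A] by (simp add: J_def)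
  qed
  then show "\<mu> = \<nu>"
    using invariantD(1)[OF N] invariantD(1)[OF N'] by (intro measure_eqI) (auto simp: p.emeasure_eq_measure q.emeasure_eq_measure)
qed

lemma LINT_indicator_basin:
  assumes \<mu>: "\<mu> \<in> ergodic_acips a b f" and \<nu>: "\<nu> \<in> ergodic_acips a b f"
  shows "(LINT x|\<mu>. indicat_real (moment_basin \<nu>) x) = (if \<mu> = \<nu> then 1 else 0)"
proof -
  interpret p: prob_space \<mu> by (rule ergodic_acipsD(2)[OF \<mu>])
  have sub: "moment_basin \<nu> \<subseteq> space \<mu>"
    using invariantD(5)[OF ergodic_acipsD(1)[OF \<mu>]] by (auto simp: moment_basin_def)
  have "measure \<mu> (moment_basin \<nu>) = (if \<mu> = \<nu> then 1 else 0)"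
  proof (cases "\<mu> = \<nu>")
    case False
    have "AE x in \<mu>. x \<notin> moment_basin \<nu>"
      using measure_moment_basin(1)[OF \<mu>] by eventually_elim (use moment_basin_disjoint[OF \<mu> \<nu>] False in blast)
    then have "measure \<mu> (moment_basin \<nu>) = measure \<mu> {}"
      using moment_basin_sets[of \<nu>] invariantD(1)[OF ergodic_acipsD(1)[OF \<mu>]] by (intro p.finite_measure_eq_AE) auto
    then show ?thesis using False by simp
  qed (use measure_moment_basin(2)[OF \<mu>] in simp)
  then show ?thesis using sub by (simp add: Int_absorb2)
qed

lemma basin_indicator_bm: "indicat_real (moment_basin \<nu>) \<in> bm"
  using moment_basin_sets[of \<nu>] by (intro bm_ind) (simp add: sets_restrict_space_iff)

text \<open>The difference of two basin indicators has integral 1 against one of the two measures,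
  so by \<open>invariant_le_pn\<close> its norm is at least \<open>1 / C\<close>. Only finitely many
  functions bounded by 1 can be that far apart.\<close>

theorem finite_ergodic_acips: "finite (ergodic_acips a b f)"
proof -
  let ?i = "\<lambda>\<mu>. indicat_real (moment_basin \<mu>)"
  show ?thesis
  proof (rule pn_net[of 1 "1 / (2 * C)"])
    show "1 / (2 * C) > 0" using C0 by simp
    fix lab :: "(real \<Rightarrow> real) \<Rightarrow> nat \<Rightarrow> int"
    assume fin: "finite (lab ` {g \<in> bm. \<forall>x\<in>{a..b}. \<bar>g x\<bar> \<le> 1})"
      and sep: "\<And>g h. \<lbrakk>g \<in> bm; h \<in> bm; \<And>x. x \<in> {a..b} \<Longrightarrow> \<bar>g x\<bar> \<le> 1; \<And>x. x \<in> {a..b} \<Longrightarrow> \<bar>h x\<bar> \<le> 1; lab g = lab h\<rbrakk>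
       \<Longrightarrow> pn (\<lambda>x. g x - h x) \<le> 1 / (2 * C)"
    have "inj_on (\<lambda>\<mu>. lab (?i \<mu>)) (ergodic_acips a b f)"
    proof (rule inj_onI, rule ccontr)
      fix \<mu> \<nu> assume \<mu>: "\<mu> \<in> ergodic_acips a b f" and \<nu>: "\<nu> \<in> ergodic_acips a b f"
        and eq: "lab (?i \<mu>) = lab (?i \<nu>)" and ne: "\<mu> \<noteq> \<nu>"
      interpret p: prob_space \<mu> by (rule ergodic_acipsD(2)[OF \<mu>])
      note N = ergodic_acipsD(1)[OF \<mu>]
      have "pn (\<lambda>x. ?i \<mu> x - ?i \<nu> x) \<le> 1 / (2 * C)"
        by (rule sep[OF basin_indicator_bm basin_indicator_bm _ _ eq]) (auto simp: indicator_def)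
      then have "C * pn (\<lambda>x. ?i \<mu> x - ?i \<nu> x) \<le> 1 / 2" using C0 by (simp add: field_simps)
      moreover have "\<bar>LINT x|\<mu>. ?i \<mu> x - ?i \<nu> x\<bar> \<le> C * pn (\<lambda>x. ?i \<mu> x - ?i \<nu> x)"
        using p.prob_space invariantD(5)[OF N] by (intro invariant_le_pn[OF N] bm_diff basin_indicator_bm) auto
      moreover have "(LINT x|\<mu>. ?i \<mu> x - ?i \<nu> x) = (LINT x|\<mu>. ?i \<mu> x) - (LINT x|\<mu>. ?i \<nu> x)"
        by (intro Bochner_Integration.integral_diff invariant_integrable[OF N] basin_indicator_bm)
      ultimately show False using LINT_indicator_basin[OF \<mu> \<mu>] LINT_indicator_basin[OF \<mu> \<nu>] ne by simp
    qed
    moreover have "finite ((\<lambda>\<mu>. lab (?i \<mu>)) ` ergodic_acips a b f)"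
      by (rule finite_subset[OF _ fin]) (auto simp: basin_indicator_bm indicator_def)
    ultimately show "finite (ergodic_acips a b f)" by (simp add: finite_image_iff)
  qed simp
qed

section \<open>Log-Lipschitz regularity\<close>

text \<open>On an indicator of \<open>{a..t}\<close> the coefficient of each density becomes the
  primitive at \<open>t\<close> of a basin indicator, the quantity that \<open>pn\<close>
  measures.\<close>

lemma Phi1_indicator:
  "Phi1 a b f (\<lambda>x. complex_of_real (indicator {a..t} x)) x =
     of_real (\<Sum>\<mu>\<in>ergodic_acips a b f. J {a..t} (indicator (moment_basin \<mu>)) * enn2real (RN_deriv M \<mu> x))"
proof -
  have "(LINT y:basin a b f \<mu>|M. complex_of_real (indicator {a..t} y)) = of_real (J {a..t} (indicator (moment_basin \<mu>)))"
    if \<mu>: "\<mu> \<in> ergodic_acips a b f" for \<mu>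
  proof -
    have "(LINT y:basin a b f \<mu>|M. complex_of_real (indicator {a..t} y))
       = (LINT y|M. complex_of_real (indicator {a..t} y * indicator (moment_basin \<mu>) y))"
      unfolding set_lebesgue_integral_def basin_eq_moment_basin[OF ergodic_acipsD(1,2)[OF \<mu>]]
      by (intro Bochner_Integration.integral_cong) (auto simp: indicator_def)
    also have "\<dots> = of_real (J {a..t} (indicator (moment_basin \<mu>)))"
      unfolding J_def by (rule integral_complex_of_real)
    finally show ?thesis .
  qed
  then show ?thesis unfolding Phi1_def by simp
qed

text \<open>Testing with \<open>\<gamma> = 1\<^bsub>[a,t]\<^esub>\<close> for all \<open>t\<close> shows that
  \<open>\<Sum>\<^sub>\<mu> (\<integral>\<psi> d\<mu>) 1\<^bsub>basin \<mu>\<^esub>\<close> has vanishing primitive, hence vanishing integral for every \<open>\<mu>\<close>.\<close>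
lemma annihilates_ergodic_acips:
  assumes \<psi>: "\<psi> \<in> bm"
    and z: "\<And>t. t \<in> {a..b} \<Longrightarrow> (LINT x|M. \<psi> x * (\<Sum>\<mu>\<in>ergodic_acips a b f. J {a..t} (indicator (moment_basin \<mu>)) * enn2real (RN_deriv M \<mu> x))) = 0"
    and \<nu>: "\<nu> \<in> ergodic_acips a b f"
  shows "(LINT x|\<nu>. \<psi> x) = 0"
proof -
  let ?E = "ergodic_acips a b f"
  let ?i = "\<lambda>\<mu>. indicat_real (moment_basin \<mu>)"
  define I where "I \<mu> = (LINT x|\<mu>. \<psi> x)" for \<mu>
  define q where "q x = (\<Sum>\<mu>\<in>?E. I \<mu> * ?i \<mu> x)" for x
  have q: "q \<in> bm" unfolding q_def by (intro bm_sum bm_cmult basin_indicator_bm)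
  have "pn q \<le> 0"
  proof (rule pn_least)
    fix t assume t: "t \<in> {a..b}"
    obtain B where B: "B > 0" "\<And>x. x \<in> {a..b} \<Longrightarrow> \<bar>\<psi> x\<bar> \<le> B" using bmE[OF \<psi>] by blast
    have int: "integrable M (\<lambda>x. J {a..t} (?i \<mu>) * (enn2real (RN_deriv M \<mu> x) * \<psi> x))" if \<mu>: "\<mu> \<in> ?E" for \<mu>
    proof (rule Bochner_Integration.integrable_mult_right)
      have i: "integrable M (\<lambda>x. enn2real (RN_deriv M \<mu> x))"
        by (rule RN_deriv_integral_real(1)[OF invariantD(1-3)[OF ergodic_acipsD(1)[OF \<mu>]]])
      show "integrable M (\<lambda>x. enn2real (RN_deriv M \<mu> x) * \<psi> x)"
      proof (rule Bochner_Integration.integrable_bound[of _ "\<lambda>x. B * enn2real (RN_deriv M \<mu> x)"])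
        show "AE x in M. norm (enn2real (RN_deriv M \<mu> x) * \<psi> x) \<le> norm (B * enn2real (RN_deriv M \<mu> x))"
        proof (rule AE_I2)
          fix x assume "x \<in> space M"
          then have "\<bar>\<psi> x\<bar> \<le> B" using B(2) by simp
          then have "enn2real (RN_deriv M \<mu> x) * \<bar>\<psi> x\<bar> \<le> enn2real (RN_deriv M \<mu> x) * B" by (intro mult_left_mono) auto
          then show "norm (enn2real (RN_deriv M \<mu> x) * \<psi> x) \<le> norm (B * enn2real (RN_deriv M \<mu> x))"
            using B(1) by (simp add: abs_mult mult.commute)
        qed
      qed (use i bm_measurable[OF \<psi>] in auto)
    qed
    have "0 = (LINT x|M. (\<Sum>\<mu>\<in>?E. J {a..t} (?i \<mu>) * (enn2real (RN_deriv M \<mu> x) * \<psi> x)))"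
      using z[OF t] by (simp add: sum_distrib_left mult_ac)
    also have "\<dots> = (\<Sum>\<mu>\<in>?E. J {a..t} (?i \<mu>) * (LINT x|M. enn2real (RN_deriv M \<mu> x) * \<psi> x))"
      using int by (subst Bochner_Integration.integral_sum) auto
    also have "\<dots> = (\<Sum>\<mu>\<in>?E. J {a..t} (?i \<mu>) * I \<mu>)"
      unfolding I_def using RN_deriv_integral_real(2)[OF invariantD(1-3)[OF ergodic_acipsD(1)] bm_measurable[OF \<psi>]]
      by (intro sum.cong) auto
    also have "\<dots> = J {a..t} q"
      unfolding q_def by (subst J_sum) (auto intro: bm_cmult basin_indicator_bm simp: J_cmult mult.commute)
    finally show "\<bar>J {a..t} q\<bar> \<le> 0" by simp
  qed
  \<comment> \<open>Norm zero forces integral zero against every invariant probability; against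
    \<nu> the integral of \<open>q\<close> is \<open>I \<nu>\<close>, because the basins of the
    other measures are null for \<nu>.\<close>
  then have "pn q = 0" using pn_nonneg[OF q] by simp
  moreover have "\<bar>LINT x|\<nu>. q x\<bar> \<le> C * pn q"
    using prob_space.prob_space[OF ergodic_acipsD(2)[OF \<nu>]] invariantD(5)[OF ergodic_acipsD(1)[OF \<nu>]]
    by (intro invariant_le_pn ergodic_acipsD(1) \<nu> q) simp
  moreover have "(LINT x|\<nu>. q x) = I \<nu>"
  proof -
    have "(LINT x|\<nu>. q x) = (\<Sum>\<mu>\<in>?E. I \<mu> * (LINT x|\<nu>. ?i \<mu> x))"
      unfolding q_def
      using invariant_integrable[OF ergodic_acipsD(1)[OF \<nu>] bm_cmult[OF basin_indicator_bm]]
      by (subst Bochner_Integration.integral_sum) auto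
    also have "\<dots> = (\<Sum>\<mu>\<in>?E. if \<mu> = \<nu> then I \<nu> else 0)"
    proof (rule sum.cong[OF refl])
      fix \<mu> assume "\<mu> \<in> ?E"
      then show "I \<mu> * (LINT x|\<nu>. ?i \<mu> x) = (if \<mu> = \<nu> then I \<nu> else 0)"
        by (simp only: LINT_indicator_basin[OF \<nu>]) auto
    qed
    also have "\<dots> = I \<nu>" using finite_ergodic_acips \<nu> by simp
    finally show ?thesis .
  qed
  ultimately show ?thesis by (simp add: I_def)
qed

text \<open>The essentially bounded complex function is replaced by two everywhere bounded real
  ones. Each inherits the hypothesis because \<open>Phi1\<close> is real on the test functions, and
  the replacement persists along orbits because \<open>f\<close> is nonsingular.\<close>

lemma psi_log_Lipschitz:
  "\<exists>p::nat. p \<ge> 1 \<and>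
     (\<forall>\<phi>\<in>Linfty a b.
        (\<forall>\<gamma>\<in>BV a b. (LINT x|lebesgue_on {a..b}. \<phi> x * Phi1 a b f \<gamma> x) = 0) \<longrightarrow>
        (\<forall>x\<in>{a..b}. summable (psi_term a b f p \<phi> x)) \<and>
        log_Lipschitz_on {a..b} (psi a b f p \<phi>))"
proof -
  obtain p :: nat where p: "p \<ge> 1" and block: "\<And>\<psi>. \<lbrakk>\<psi> \<in> bm; \<And>\<mu>. \<mu> \<in> ergodic_acips a b f \<Longrightarrow> (LINT x|\<mu>. \<psi> x) = 0\<rbrakk> \<Longrightarrow>
     (\<lambda>n. pn (\<lambda>x. \<Sum>j<p. \<psi> ((f ^^ j) ((f ^^ n) x)))) \<longlonglongrightarrow> 0"
    using Birkhoff_block_decay by blast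
  obtain K \<rho> where K: "0 < K" and \<rho>: "0 < \<rho>" "\<rho> < 1" and ex: "\<And>v n. \<lbrakk>v \<in> bm; (\<lambda>n. pn (\<lambda>x. v ((f ^^ n) x))) \<longlonglongrightarrow> 0\<rbrakk> \<Longrightarrow>
     pn (\<lambda>x. v ((f ^^ n) x)) \<le> K * \<rho> ^ n * pn v"
    using exponential_decay by blast
  show ?thesis
  proof (intro exI[of _ p] conjI[OF p] ballI impI)
    fix \<phi> assume \<phi>: "\<phi> \<in> Linfty a b"
      and H: "\<forall>\<gamma>\<in>BV a b. (LINT x|lebesgue_on {a..b}. \<phi> x * Phi1 a b f \<gamma> x) = 0"
    have \<phi>m: "\<phi> \<in> borel_measurable M" using \<phi> by (simp add: Linfty_def)
    obtain B0 where B0: "AE x in M. norm (\<phi> x) \<le> B0" using \<phi> by (auto simp: Linfty_def)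
    define B where "B = max 0 B0"
    have B: "0 \<le> B" by (simp add: B_def)
    \<comment> \<open>Clipping alters the real and imaginary parts of \<phi> only on a null set and
      puts them in \<open>bm\<close>.\<close>
    define u where "u x = max (- B) (min B (Re (\<phi> x)))" for x
    define w where "w x = max (- B) (min B (Im (\<phi> x)))" for x
    have u: "u \<in> bm" and w: "w \<in> bm" unfolding u_def w_def using \<phi>m B by (intro bm_clip; simp)+
    have uB: "\<bar>u x\<bar> \<le> B" and wB: "\<bar>w x\<bar> \<le> B" for x using B by (auto simp: u_def w_def)
    have \<phi>uw: "AE x in M. \<phi> x = Complex (u x) (w x)"
      using B0
    proof eventually_elim
      fix x assume "norm (\<phi> x) \<le> B0"
      then have "\<bar>Re (\<phi> x)\<bar> \<le> B" "\<bar>Im (\<phi> x)\<bar> \<le> B"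
        using abs_Re_le_cmod[of "\<phi> x"] abs_Im_le_cmod[of "\<phi> x"] by (auto simp: B_def)
      then show "\<phi> x = Complex (u x) (w x)" by (intro complex_eqI) (auto simp: u_def w_def)
    qed
    have int: "(LINT x|M. F x) = Complex (LINT x|M. g x) (LINT x|M. h x)"
      if "integrable M g" "integrable M h" "F \<in> borel_measurable M" "AE x in M. F x = Complex (g x) (h x)"
      for F :: "real \<Rightarrow> complex" and g h
    proof -
      have "(LINT x|M. F x) = (LINT x|M. of_real (g x) + \<i> * of_real (h x))"
        using that by (intro integral_cong_AE) (auto simp: Complex_eq)
      also have "\<dots> = of_real (LINT x|M. g x) + \<i> * of_real (LINT x|M. h x)" using that by simp
      finally show ?thesis by (simp add: Complex_eq)
    qed
    define R where "R t x = (\<Sum>\<mu>\<in>ergodic_acips a b f. J {a..t} (indicator (moment_basin \<mu>)) * enn2real (RN_deriv M \<mu> x))" for t x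
    have Ri: "integrable M (R t)" for t
      unfolding R_def
      by (intro Bochner_Integration.integrable_sum Bochner_Integration.integrable_mult_right
          RN_deriv_integral_real(1) invariantD(1-3) ergodic_acipsD(1))
    have Rm: "R t \<in> borel_measurable M" for t using Ri by (rule borel_measurable_integrable)
    have gR: "integrable M (\<lambda>x. g x * R t x)" if "g \<in> bm" for g t
    proof -
      obtain Bg where Bg: "Bg > 0" "\<And>x. x \<in> {a..b} \<Longrightarrow> \<bar>g x\<bar> \<le> Bg" using bmE[OF \<open>g \<in> bm\<close>] by blast
      show ?thesis
      proof (rule Bochner_Integration.integrable_bound[of _ "\<lambda>x. Bg * R t x"])
        show "AE x in M. norm (g x * R t x) \<le> norm (Bg * R t x)"
          using Bg by (intro AE_I2) (auto simp: abs_mult intro!: mult_right_mono)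
      qed (use Ri Rm bm_measurable[OF that] in auto)
    qed
    have z: "(LINT x|M. u x * R t x) = 0 \<and> (LINT x|M. w x * R t x) = 0" if t: "t \<in> {a..b}" for t
    proof -
      have "0 = (LINT x|M. \<phi> x * of_real (R t x))"
        using bspec[OF H indicator_Icc_BV[of a t b]] unfolding Phi1_indicator R_def by simp
      also have "\<dots> = Complex (LINT x|M. u x * R t x) (LINT x|M. w x * R t x)"
      proof (rule int[OF gR[OF u] gR[OF w]])
        show "(\<lambda>x. \<phi> x * complex_of_real (R t x)) \<in> borel_measurable M" using \<phi>m Rm by simp
        show "AE x in M. \<phi> x * complex_of_real (R t x) = Complex (u x * R t x) (w x * R t x)"
          using \<phi>uw by eventually_elim (simp add: complex_eq_iff)
      qed
      finally show ?thesis by (simp add: complex_eq_iff)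
    qed
    have zu: "(LINT x|\<mu>. u x) = 0" and zw: "(LINT x|\<mu>. w x) = 0" if "\<mu> \<in> ergodic_acips a b f" for \<mu>
      using z that unfolding R_def
      by (auto intro: annihilates_ergodic_acips[OF u] annihilates_ergodic_acips[OF w])
    define A where "A g x = (\<Sum>j<p. g ((f ^^ j) x))" for g :: "real \<Rightarrow> real" and x
    have A: "A g \<in> bm" if "g \<in> bm" for g unfolding A_def by (intro bm_sum bm_comp that)
    \<comment> \<open>Block number \<open>k\<close> starts at time \<open>k * p\<close>, and
      \<open>\<rho> ^ (k * p) \<le> \<rho> ^ k\<close> because \<open>p \<ge> 1\<close>.\<close>
    have Adec: "pn (\<lambda>x. A g ((f ^^ (k * p)) x)) \<le> K * pn (A g) * \<rho> ^ k"
      if g: "g \<in> bm" and zero: "\<And>\<mu>. \<mu> \<in> ergodic_acips a b f \<Longrightarrow> (LINT x|\<mu>. g x) = 0" for g k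
    proof -
      have "(\<lambda>n. pn (\<lambda>x. A g ((f ^^ n) x))) \<longlonglongrightarrow> 0" unfolding A_def by (rule block[OF g zero])
      then have "pn (\<lambda>x. A g ((f ^^ (k * p)) x)) \<le> K * \<rho> ^ (k * p) * pn (A g)" by (rule ex[OF A[OF g]])
      also have "\<dots> \<le> K * \<rho> ^ k * pn (A g)"
        using K \<rho> p pn_nonneg[OF A[OF g]] by (intro mult_right_mono mult_left_mono power_decreasing) auto
      finally show ?thesis by (simp add: mult_ac)
    qed
    have Ab: "\<bar>A g ((f ^^ n) x)\<bar> \<le> real p * B" if "\<And>x. \<bar>g x\<bar> \<le> B" for g n x
    proof -
      have "\<bar>A g ((f ^^ n) x)\<bar> \<le> (\<Sum>j<p. \<bar>g ((f ^^ j) ((f ^^ n) x))\<bar>)" unfolding A_def by (rule sum_abs)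
      also have "\<dots> \<le> (\<Sum>j<p. B)" by (intro sum_mono that)
      finally show ?thesis by simp
    qed
    let ?U = "\<lambda>k x. A u ((f ^^ (k * p)) x)" and ?W = "\<lambda>k x. A w ((f ^^ (k * p)) x)"
    have Ub: "?U k \<in> bm" and Wb: "?W k \<in> bm" for k by (intro bm_comp A u w)+
    have psi_term: "psi_term a b f p \<phi> x k = Complex (J {a..x} (?U k)) (J {a..x} (?W k))" for x k
    proof -
      have "(LINT y|M. indicator {a..x} y * (\<Sum>j<p. \<phi> ((f ^^ (k * p + j)) y)))
         = Complex (LINT y|M. indicator {a..x} y * ?U k y) (LINT y|M. indicator {a..x} y * ?W k y)"
      proof (rule int)
        show "integrable M (\<lambda>y. indicator {a..x} y * ?U k y)" "integrable M (\<lambda>y. indicator {a..x} y * ?W k y)"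
          by (intro J_int Ub Wb; simp)+
        have "(\<lambda>y. \<phi> ((f ^^ n) y)) \<in> borel_measurable M" for n by (rule measurable_compose[OF fn_meas \<phi>m])
        moreover have "(indicator {a..x} :: real \<Rightarrow> complex) \<in> borel_measurable M"
          by (intro measurable_restrict_space1 borel_measurable_indicator) auto
        ultimately show "(\<lambda>y. indicator {a..x} y * (\<Sum>j<p. \<phi> ((f ^^ (k * p + j)) y))) \<in> borel_measurable M"
          by (intro borel_measurable_times borel_measurable_sum)
        have "AE y in M. \<forall>n::nat. \<phi> ((f ^^ n) y) = Complex (u ((f ^^ n) y)) (w ((f ^^ n) y))"
          unfolding AE_all_countable by (intro allI AE_fn \<phi>uw)
        then show "AE y in M. indicator {a..x} y * (\<Sum>j<p. \<phi> ((f ^^ (k * p + j)) y)) =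
            Complex (indicator {a..x} y * ?U k y) (indicator {a..x} y * ?W k y)"
        proof eventually_elim
          fix y assume all: "\<forall>n::nat. \<phi> ((f ^^ n) y) = Complex (u ((f ^^ n) y)) (w ((f ^^ n) y))"
          have fkp: "(f ^^ (k * p + j)) y = (f ^^ j) ((f ^^ (k * p)) y)" for j
            using funpow_add[of j "k * p" f] by (simp add: add.commute)
          have "\<phi> ((f ^^ (k * p + j)) y) = Complex (u ((f ^^ j) ((f ^^ (k * p)) y))) (w ((f ^^ j) ((f ^^ (k * p)) y)))" for j
            using spec[OF all, of "k * p + j"] unfolding fkp .
          moreover have "indicator {a..x} y = complex_of_real (indicat_real {a..x} y)" by (simp add: indicator_def)
          ultimately show "indicator {a..x} y * (\<Sum>j<p. \<phi> ((f ^^ (k * p + j)) y)) =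
            Complex (indicator {a..x} y * ?U k y) (indicator {a..x} y * ?W k y)"
            by (simp add: A_def complex_eq_iff)
        qed
      qed
      then show ?thesis unfolding psi_term_def J_def .
    qed
    have nC: "norm (Complex s t) \<le> \<bar>s\<bar> + \<bar>t\<bar>" for s t using cmod_le[of "Complex s t"] by simp
    define c where "c = K * pn (A u) + K * pn (A w)"
    have c: "0 \<le> c" using K pn_nonneg[OF A[OF u]] pn_nonneg[OF A[OF w]] by (simp add: c_def)
    have decay: "norm (psi_term a b f p \<phi> x k) \<le> c * \<rho> ^ k" if x: "x \<in> {a..b}" for x k
      using nC[of "J {a..x} (?U k)" "J {a..x} (?W k)"] pn_upper[OF Ub x, of k] pn_upper[OF Wb x, of k]
        Adec[OF u zu, of k] Adec[OF w zw, of k] unfolding psi_term c_def by (simp add: distrib_right)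
    \<comment> \<open>Each term is the primitive of a sum of \<open>p\<close> functions whose real
      and imaginary parts are bounded by \<open>B\<close>, whence one Lipschitz constant for all
      \<open>k\<close>.\<close>
    have lip: "norm (psi_term a b f p \<phi> x k - psi_term a b f p \<phi> y k) \<le> (2 * (real p * B)) * \<bar>x - y\<bar>"
      if xy: "x \<in> {a..b}" "y \<in> {a..b}" for x y k
    proof -
      have "psi_term a b f p \<phi> x k - psi_term a b f p \<phi> y k
          = Complex (J {a..x} (?U k) - J {a..y} (?U k)) (J {a..x} (?W k) - J {a..y} (?W k))"
        unfolding psi_term by (simp add: complex_eq_iff)
      moreover have "\<bar>J {a..x} (?U k) - J {a..y} (?U k)\<bar> \<le> (real p * B) * \<bar>x - y\<bar>"
        by (rule prim_lipschitz[OF Ub Ab[OF uB] xy])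
      moreover have "\<bar>J {a..x} (?W k) - J {a..y} (?W k)\<bar> \<le> (real p * B) * \<bar>x - y\<bar>"
        by (rule prim_lipschitz[OF Wb Ab[OF wB] xy])
      ultimately show ?thesis
        using nC[of "J {a..x} (?U k) - J {a..y} (?U k)" "J {a..x} (?W k) - J {a..y} (?W k)"] by (simp add: algebra_simps)
    qed
    note ll = log_Lipschitz_on_suminf[of \<rho> c "2 * (real p * B)" "{a..b}" "psi_term a b f p \<phi>", OF \<rho> c _ decay lip]
    have pB: "0 \<le> 2 * (real p * B)" using B by simp
    show "(\<forall>x\<in>{a..b}. summable (psi_term a b f p \<phi> x)) \<and> log_Lipschitz_on {a..b} (psi a b f p \<phi>)"
      unfolding psi_def[abs_def] by (intro conjI ballI ll[OF pB])
  qed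
qed

end

theorem theorem3:
  fixes a b :: real and f :: "real \<Rightarrow> real"
  assumes "piecewise_C1BV_expanding a b f"
  shows "\<exists>p::nat. p \<ge> 1 \<and>
           (\<forall>\<phi>\<in>Linfty a b.
              (\<forall>\<gamma>\<in>BV a b. (LINT x|lebesgue_on {a..b}. \<phi> x * Phi1 a b f \<gamma> x) = 0) \<longrightarrow>
              (\<forall>x\<in>{a..b}. summable (psi_term a b f p \<phi> x)) \<and>
              log_Lipschitz_on {a..b} (psi a b f p \<phi>))"
proof -
  obtain \<beta> P where "expanding_partition a b f \<beta> P" using piecewise_expanding_partition[OF assms] .
  then interpret P: expanding_partition a b f \<beta> P .
  obtain C e where "dual_LY a b f C e"
  proof (rule P.Lasota_Yorke)
    fix C e assume "0 < C" "e \<longlonglongrightarrow> 0" "\<And>n g. g \<in> P.bm \<Longrightarrow> \<exists>h1\<in>P.bm. \<exists>h2\<in>P.bm. (\<forall>x. g ((f ^^ n) x) = h1 x + h2 x) \<and>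
       P.pn h1 \<le> e n * P.pn g \<and> (\<forall>x\<in>{a..b}. \<bar>h2 x\<bar> \<le> C * P.pn g)"
    then have "dual_LY a b f C e" by unfold_locales
    then show thesis by (rule that)
  qed
  then interpret dual_LY a b f C e .
  show ?thesis by (rule psi_log_Lipschitz)
qed

end
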